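(* Let $n\ge 1$ and let $f$ be an aspherical regular positive $n$-free polynomial. Then the automorphism group of $\mathcal{A}(\mathcal{D}_f)$ (the group of completely isometric unital algebra automorphisms of $\mathcal{A}(\mathcal{D}_f)$) is isomorphic, as a group, to a subgroup of the unitary group $U(n)$.
   Context: Let $\mathbb{F}_n^+$ be the free semigroup (monoid) on generators $g_1,\ldots,g_n$ with identity $g_0$; $|\alpha|$ is the length of the word $\alpha$ (with $|g_0|=0$). For $\alpha=g_{i_1}\cdots g_{i_k}$ and elements $X_1,\ldots,X_n$ of a unital ring, $X_\alpha=X_{i_1}\cdots X_{i_k}$, and $X_{g_0}=1$. An $n$-free formal power series is a formal power series $f=\sum_{\alpha\in\mathbb{F}_n^+}a_\alpha X_\alpha$ in $n$ noncommuting indeterminates; it is an $n$-free polynomial if only finitely many $a_\alpha$ are nonzero. It is regular positive if the $a_\alpha$ are real, $a_{g_0}=0$, $a_{g_i}>0$ for $i=1,\ldots,n$, $a_\alpha\ge 0$ for all $\alpha$, and $\sup_{k\ge 1}\left|\sum_{|\alpha|=k}a_\alpha^2\right|^{1/k}<\infty$ (automatic for polynomials). For a Hilbert space $\mathcal{H}$, $\mathcal{D}_f(\mathcal{H})=\{(T_1,\ldots,T_n)\in\mathcal{B}(\mathcal{H})^n:\sum_\alpha a_\alpha T_\alpha T_\alpha^*\le 1\}$. The interior of $\mathcal{D}_f(\mathbb{C})$ in $\mathbb{C}^n$ is denoted $\mathbb{D}_f^1$. Two regular positive $n$-free power series $f,g$ are permutation-rescaling equivalent if there are a permutation $\sigma$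 of $\{1,\ldots,n\}$ and positive real numbers $\lambda_1,\ldots,\lambda_n$ with $g(\lambda_1X_{\sigma(1)},\ldots,\lambda_nX_{\sigma(n)})=f(X_1,\ldots,X_n)$. The series $f$ is spherical if it is permutation-rescaling equivalent to some regular positive $g$ with $\mathbb{D}_g^1=\{z\in\mathbb{C}^n:|z_1|^2+\cdots+|z_n|^2<1\}$, and aspherical if it is not spherical. Set $b^f_{g_0}=1$ and, for $|\alpha|\ge 1$, $b^f_\alpha=\sum_{j=1}^{|\alpha|}\ \sum_{\gamma_1\cdots\gamma_j=\alpha,\ |\gamma_i|\ge 1}a_{\gamma_1}\cdots a_{\gamma_j}$. Let $(\delta_\alpha)_{\alpha\in\mathbb{F}_n^+}$ be the canonical basis of $\ell^2(\mathbb{F}_n^+)$ and define bounded operators $W_i^f$ on $\ell^2(\mathbb{F}_n^+)$ by $W_i^f\delta_\alpha=\sqrt{b^f_\alpha/b^f_{g_i\alpha}}\;\delta_{g_i\alpha}$. The noncommutative domain algebra $\mathcal{A}(\mathcal{D}_f)$ is the norm closure in $\mathcal{B}(\ell^2(\mathbb{F}_n^+))$ of the span of $\{W^f_\alpha:\alpha\in\mathbb{F}_n^+\}$. Isomorphisms between noncommutative domain algebras are completely isometric unital algebra isomorphisms. *)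

theory Defs
  imports "HOL-Analysis.Analysis" "HOL-Algebra.Bij"
begin

section \<open>The Hilbert space of square-summable families\<close>

text \<open>Only the norm of \<open>\<ell>\<^sup>2\<close> is needed below, as it determines the
  operator norm and hence all matrix norms.\<close>

definition square_summable :: "('a \<Rightarrow> complex) \<Rightarrow> bool" where
  "square_summable x \<longleftrightarrow> (\<lambda>i. (cmod (x i))\<^sup>2) summable_on UNIV"

lemma square_summableI:
  assumes "\<And>F. finite F \<Longrightarrow> L2_set (\<lambda>i. cmod (x i)) F \<le> M"
  shows "square_summable x"
  unfolding square_summable_def
proof (rule nonneg_bdd_above_summable_on)
  have "(\<Sum>i\<in>F. (cmod (x i))\<^sup>2) \<le> M\<^sup>2" if "finite F" for F
    using power_mono[OF assms[OF that], of 2] by (simp add: L2_set_def sum_nonneg)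
  then show "bdd_above (sum (\<lambda>i. (cmod (x i))\<^sup>2) ` {F. F \<subseteq> UNIV \<and> finite F})"
    by (auto intro: bdd_aboveI[where M = "M\<^sup>2"])
qed simp

lemma L2_set_le_infsum:
  assumes "square_summable x" "finite F"
  shows "L2_set (\<lambda>i. cmod (x i)) F \<le> sqrt (\<Sum>\<^sub>\<infinity>i. (cmod (x i))\<^sup>2)"
  using finite_sum_le_infsum[of "\<lambda>i. (cmod (x i))\<^sup>2" UNIV F] assms
  by (simp add: L2_set_def square_summable_def)

lemma infsum_le_L2_set:
  assumes "\<And>F. finite F \<Longrightarrow> L2_set (\<lambda>i. cmod (x i)) F \<le> M"
  shows "sqrt (\<Sum>\<^sub>\<infinity>i. (cmod (x i))\<^sup>2) \<le> M"
proof -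
  have 0: "0 \<le> M" using assms[of "{}"] by simp
  have "(\<Sum>\<^sub>\<infinity>i. (cmod (x i))\<^sup>2) \<le> M\<^sup>2"
  proof (rule infsum_le_finite_sums)
    show "(\<lambda>i. (cmod (x i))\<^sup>2) summable_on UNIV"
      using square_summableI[OF assms] by (simp add: square_summable_def)
    show "(\<Sum>i\<in>F. (cmod (x i))\<^sup>2) \<le> M\<^sup>2" if "finite F" for F
      using power_mono[OF assms[OF that], of 2] by (simp add: L2_set_def sum_nonneg)
  qed
  then show ?thesis using 0 real_le_lsqrt by auto
qed

lemma L2_set_add_le:
  "L2_set (\<lambda>i. cmod (x i + y i)) F \<le> L2_set (\<lambda>i. cmod (x i)) F + L2_set (\<lambda>i. cmod (y i)) F"
  by (rule order_trans[OF L2_set_mono L2_set_triangle_ineq]) (auto intro: norm_triangle_ineq)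

lemma L2_set_scale:
  "L2_set (\<lambda>i. cmod (c * x i)) F = cmod c * L2_set (\<lambda>i. cmod (x i)) F"
  by (simp add: L2_set_right_distrib norm_mult)

lemma square_summable_add:
  assumes "square_summable x" "square_summable y"
  shows "square_summable (\<lambda>i. x i + y i)"
  by (rule square_summableI)
    (rule order_trans[OF L2_set_add_le add_mono[OF L2_set_le_infsum[OF assms(1)]
          L2_set_le_infsum[OF assms(2)]]])

lemma square_summable_scale:
  assumes "square_summable x"
  shows "square_summable (\<lambda>i. c * x i)"
  by (rule square_summableI, unfold L2_set_scale)
    (rule mult_left_mono[OF L2_set_le_infsum[OF assms] norm_ge_zero])

typedef 'a ell2 = "{x :: 'a \<Rightarrow> complex. square_summable x}"
  morphisms coord Abs_ell2
  by (rule exI[of _ "\<lambda>_. 0"]) (simp add: square_summable_def)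

setup_lifting type_definition_ell2

lemma square_summable_coord: "square_summable (coord x)"
  using coord by blast

lemma ell2_eqI: "(\<And>i. coord x i = coord y i) \<Longrightarrow> x = y"
  by (metis coord_inject ext)

lift_definition cscale :: "complex \<Rightarrow> 'a ell2 \<Rightarrow> 'a ell2" is "\<lambda>c x i. c * x i"
  by (rule square_summable_scale)

instantiation ell2 :: (type) real_normed_vector
begin

lift_definition zero_ell2 :: "'a ell2" is "\<lambda>_. 0"
  by (simp add: square_summable_def)

lift_definition plus_ell2 :: "'a ell2 \<Rightarrow> 'a ell2 \<Rightarrow> 'a ell2" is "\<lambda>x y i. x i + y i"
  by (rule square_summable_add)

lift_definition uminus_ell2 :: "'a ell2 \<Rightarrow> 'a ell2" is "\<lambda>x i. - x i"
  by (simp add: square_summable_def)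

lift_definition minus_ell2 :: "'a ell2 \<Rightarrow> 'a ell2 \<Rightarrow> 'a ell2" is "\<lambda>x y i. x i - y i"
  subgoal for x y
    using square_summable_add[of x "\<lambda>i. - y i"] by (simp add: square_summable_def)
  done

lift_definition scaleR_ell2 :: "real \<Rightarrow> 'a ell2 \<Rightarrow> 'a ell2" is "\<lambda>r x i. of_real r * x i"
  by (rule square_summable_scale)

lift_definition norm_ell2 :: "'a ell2 \<Rightarrow> real" is "\<lambda>x. sqrt (\<Sum>\<^sub>\<infinity>i. (cmod (x i))\<^sup>2)" .

definition sgn_ell2 :: "'a ell2 \<Rightarrow> 'a ell2" where
  "sgn_ell2 x = inverse (norm x) *\<^sub>R x"

definition dist_ell2 :: "'a ell2 \<Rightarrow> 'a ell2 \<Rightarrow> real" where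
  "dist_ell2 x y = norm (x - y)"

definition uniformity_ell2 :: "('a ell2 \<times> 'a ell2) filter" where
  "uniformity_ell2 = (INF e\<in>{0 <..}. principal {(x, y). dist x y < e})"

definition open_ell2 :: "'a ell2 set \<Rightarrow> bool" where
  "open_ell2 U \<longleftrightarrow> (\<forall>x\<in>U. \<forall>\<^sub>F (x', y) in uniformity. x' = x \<longrightarrow> y \<in> U)"

lemma L2_set_le_norm: "finite F \<Longrightarrow> L2_set (\<lambda>i. cmod (coord x i)) F \<le> norm (x :: 'a ell2)"
  unfolding norm_ell2.rep_eq by (rule L2_set_le_infsum[OF square_summable_coord])

lemma norm_le_L2_set:
  "(\<And>F. finite F \<Longrightarrow> L2_set (\<lambda>i. cmod (coord x i)) F \<le> M) \<Longrightarrow> norm (x :: 'a ell2) \<le> M"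
  unfolding norm_ell2.rep_eq by (rule infsum_le_L2_set)

lemma coord_le_norm: "cmod (coord x i) \<le> norm (x :: 'a ell2)"
  using L2_set_le_norm[of "{i}" x] by simp

instance
proof
  fix a b :: real and x y z :: "'a ell2"
  show "dist x y = norm (x - y)" by (simp add: dist_ell2_def)
  show "sgn x = inverse (norm x) *\<^sub>R x" by (simp add: sgn_ell2_def)
  show "uniformity = (INF e\<in>{0 <..}. principal {(x, y :: 'a ell2). dist x y < e})"
    by (simp add: uniformity_ell2_def)
  show "open U \<longleftrightarrow> (\<forall>x\<in>U. \<forall>\<^sub>F (x', y) in uniformity. x' = x \<longrightarrow> y \<in> U)" for U :: "'a ell2 set"
    by (simp add: open_ell2_def)
  show "x + y + z = x + (y + z)" by transfer (simp add: add.assoc)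
  show "x + y = y + x" by transfer (simp add: add.commute)
  show "0 + x = x" by transfer simp
  show "- x + x = 0" by transfer simp
  show "x - y = x + - y" by transfer simp
  show "a *\<^sub>R (x + y) = a *\<^sub>R x + a *\<^sub>R y" by transfer (simp add: distrib_left)
  show "(a + b) *\<^sub>R x = a *\<^sub>R x + b *\<^sub>R x" by transfer (simp add: distrib_right)
  show "a *\<^sub>R b *\<^sub>R x = (a * b) *\<^sub>R x" by transfer (simp add: mult.assoc)
  show "1 *\<^sub>R x = x" by transfer simp
  show "norm x = 0 \<longleftrightarrow> x = 0"
  proof
    assume "norm x = 0"
    then show "x = 0"
      using coord_le_norm[of x] by (intro ell2_eqI) (simp add: zero_ell2.rep_eq)
  next
    assume "x = 0" then show "norm x = 0"
      by (simp add: norm_ell2.rep_eq zero_ell2.rep_eq)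
  qed
  show "norm (x + y) \<le> norm x + norm y"
    by (rule norm_le_L2_set, unfold plus_ell2.rep_eq)
      (rule order_trans[OF L2_set_add_le add_mono[OF L2_set_le_norm L2_set_le_norm]])
  show "norm (a *\<^sub>R x) = \<bar>a\<bar> * norm x"
    by (simp add: norm_ell2.rep_eq scaleR_ell2.rep_eq norm_mult power_mult_distrib
        infsum_cmult_right' real_sqrt_mult)
qed

end

lift_definition delta :: "'a \<Rightarrow> 'a ell2" is "\<lambda>a b. if b = a then 1 else 0"
  subgoal for a
    by (rule square_summableI[where M = 1])
      (simp add: L2_set_def if_distrib[of cmod] if_distrib[of "\<lambda>u. u\<^sup>2"] cong: if_cong)
  done

lemma norm_cscale: "norm (cscale c x) = cmod c * norm x"
  by (simp add: norm_ell2.rep_eq cscale.rep_eq norm_mult power_mult_distrib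
      infsum_cmult_right' real_sqrt_mult)

lemma bounded_linear_cscale: "bounded_linear (cscale c)"
  by (rule bounded_linear_intro[where K = "cmod c"])
    (auto intro!: ell2_eqI simp: norm_cscale cscale.rep_eq plus_ell2.rep_eq scaleR_ell2.rep_eq
      algebra_simps)


section \<open>Operators and matrices of operators\<close>

text \<open>The library's bounded linear maps are real-linear.  The algebras considered below only
  contain complex-linear operators, being norm closures of complex spans of such operators.\<close>

type_synonym 'a operator = "'a ell2 \<Rightarrow>\<^sub>L 'a ell2"

definition cscale_op :: "complex \<Rightarrow> 'a operator \<Rightarrow> 'a operator" where
  "cscale_op c T = Blinfun (\<lambda>x. cscale c (blinfun_apply T x))"

lemma cscale_op_apply [simp]: "blinfun_apply (cscale_op c T) x = cscale c (blinfun_apply T x)"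
  unfolding cscale_op_def
  by (simp add: bounded_linear_Blinfun_apply
      bounded_linear_compose[OF bounded_linear_cscale blinfun.bounded_linear_right])

interpretation operator: vector_space cscale_op
  by unfold_locales
    (auto intro!: blinfun_eqI ell2_eqI
      simp: blinfun.add_left cscale.rep_eq plus_ell2.rep_eq algebra_simps)

text \<open>The norm of a \<open>k \<times> k\<close> matrix of operators (entries with indices below \<open>k\<close>), acting
  on the Hilbert space direct sum of \<open>k\<close> copies of \<open>\<ell>\<^sup>2\<close>.\<close>

definition matrix_norm :: "nat \<Rightarrow> (nat \<Rightarrow> nat \<Rightarrow> 'a operator) \<Rightarrow> real" where
  "matrix_norm k T = (SUP x \<in> {x. L2_set (\<lambda>j. norm (x j)) {..<k} \<le> 1}.
     L2_set (\<lambda>i. norm (\<Sum>j<k. blinfun_apply (T i j) (x j))) {..<k})"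

definition completely_isometric :: "'a operator set \<Rightarrow> ('a operator \<Rightarrow> 'b operator) \<Rightarrow> bool" where
  "completely_isometric A \<Phi> \<longleftrightarrow>
     (\<forall>k T. (\<forall>i<k. \<forall>j<k. T i j \<in> A) \<longrightarrow> matrix_norm k (\<lambda>i j. \<Phi> (T i j)) = matrix_norm k T)"

text \<open>As for \<^const>\<open>auto\<close>, automorphisms are extensional, i.e. they have a fixed dummy value
  outside the algebra.\<close>

definition algebra_auto :: "'a operator set \<Rightarrow> ('a operator \<Rightarrow> 'a operator) set" where
  "algebra_auto A = {\<Phi> \<in> Bij A.
     (\<forall>S\<in>A. \<forall>T\<in>A. \<Phi> (S + T) = \<Phi> S + \<Phi> T) \<and>
     (\<forall>c. \<forall>T\<in>A. \<Phi> (cscale_op c T) = cscale_op c (\<Phi> T)) \<and>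
     (\<forall>S\<in>A. \<forall>T\<in>A. \<Phi> (S o\<^sub>L T) = \<Phi> S o\<^sub>L \<Phi> T) \<and>
     \<Phi> id_blinfun = id_blinfun \<and>
     completely_isometric A \<Phi>}"

definition algebra_auto_group :: "'a operator set \<Rightarrow> ('a operator \<Rightarrow> 'a operator) monoid" where
  "algebra_auto_group A = BijGroup A\<lparr>carrier := algebra_auto A\<rparr>"

lemma algebra_autoD:
  assumes "\<Phi> \<in> algebra_auto A"
  shows "\<Phi> \<in> Bij A"
    and "\<And>S T. S \<in> A \<Longrightarrow> T \<in> A \<Longrightarrow> \<Phi> (S + T) = \<Phi> S + \<Phi> T"
    and "\<And>c T. T \<in> A \<Longrightarrow> \<Phi> (cscale_op c T) = cscale_op c (\<Phi> T)"
    and "\<And>S T. S \<in> A \<Longrightarrow> T \<in> A \<Longrightarrow> \<Phi> (S o\<^sub>L T) = \<Phi> S o\<^sub>L \<Phi> T"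
    and "\<Phi> id_blinfun = id_blinfun"
    and "completely_isometric A \<Phi>"
  using assms by (auto simp: algebra_auto_def)

lemma matrix_norm_cong:
  assumes "\<And>i j. i < k \<Longrightarrow> j < k \<Longrightarrow> S i j = T i j"
  shows "matrix_norm k S = matrix_norm k T"
  unfolding matrix_norm_def
  by (intro SUP_cong L2_set_cong refl arg_cong[where f = norm] sum.cong) (auto simp: assms)

lemma group_algebra_auto_group:
  assumes add: "\<And>S T. S \<in> A \<Longrightarrow> T \<in> A \<Longrightarrow> S + T \<in> A"
    and scale: "\<And>c T. T \<in> A \<Longrightarrow> cscale_op c T \<in> A"
    and mult: "\<And>S T. S \<in> A \<Longrightarrow> T \<in> A \<Longrightarrow> S o\<^sub>L T \<in> A"
    and unit: "id_blinfun \<in> A"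
  shows "group (algebra_auto_group A)"
proof -
  have "subgroup (algebra_auto A) (BijGroup A)"
  proof (rule subgroup.intro)
    show "algebra_auto A \<subseteq> carrier (BijGroup A)"
      by (auto simp: algebra_auto_def BijGroup_def)
    have "completely_isometric A (\<lambda>T\<in>A. T)"
      unfolding completely_isometric_def by (auto intro!: matrix_norm_cong)
    then show "\<one>\<^bsub>BijGroup A\<^esub> \<in> algebra_auto A"
      using add scale mult unit by (simp add: algebra_auto_def BijGroup_def id_Bij)
  next
    fix \<Phi> \<Psi> assume *: "\<Phi> \<in> algebra_auto A" "\<Psi> \<in> algebra_auto A"
    note P = algebra_autoD[OF *(1)] and Q = algebra_autoD[OF *(2)]
    have QA: "\<Psi> T \<in> A" if "T \<in> A" for T
      using Bij_imp_funcset[OF Q(1)] that by auto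
    have "completely_isometric A (compose A \<Phi> \<Psi>)"
      unfolding completely_isometric_def
    proof (intro allI impI)
      fix k and T :: "nat \<Rightarrow> nat \<Rightarrow> 'a operator" assume T: "\<forall>i<k. \<forall>j<k. T i j \<in> A"
      have "matrix_norm k (\<lambda>i j. compose A \<Phi> \<Psi> (T i j)) = matrix_norm k (\<lambda>i j. \<Phi> (\<Psi> (T i j)))"
        using T by (intro matrix_norm_cong) (simp add: compose_eq)
      also have "\<dots> = matrix_norm k (\<lambda>i j. \<Psi> (T i j))"
        using P(6) T QA by (simp add: completely_isometric_def)
      also have "\<dots> = matrix_norm k T"
        using Q(6) T by (simp add: completely_isometric_def)
      finally show "matrix_norm k (\<lambda>i j. compose A \<Phi> \<Psi> (T i j)) = matrix_norm k T" .
    qed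
    then show "\<Phi> \<otimes>\<^bsub>BijGroup A\<^esub> \<Psi> \<in> algebra_auto A"
      using P Q add scale mult unit QA
      by (simp add: algebra_auto_def BijGroup_def compose_Bij compose_eq)
  next
    fix \<Phi> assume *: "\<Phi> \<in> algebra_auto A"
    note P = algebra_autoD[OF *]
    define \<Psi> where "\<Psi> = restrict (inv_into A \<Phi>) A"
    have bij: "bij_betw \<Phi> A A" using P(1) by (simp add: Bij_def)
    have \<Psi>A: "\<Psi> T \<in> A" if "T \<in> A" for T
      using that Bij_inv_into_mem[OF P(1)] by (simp add: \<Psi>_def)
    have r: "\<Phi> (\<Psi> T) = T" if "T \<in> A" for T
      using that bij by (simp add: \<Psi>_def bij_betw_inv_into_right)
    have eq: "\<Psi> T = S" if "S \<in> A" "\<Phi> S = T" for S T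
      using that bij bij_betwE[OF bij] by (auto simp: \<Psi>_def bij_betw_inv_into_left)
    have "completely_isometric A \<Psi>"
      unfolding completely_isometric_def
    proof (intro allI impI)
      fix k and T :: "nat \<Rightarrow> nat \<Rightarrow> 'a operator" assume T: "\<forall>i<k. \<forall>j<k. T i j \<in> A"
      have "matrix_norm k (\<lambda>i j. \<Psi> (T i j)) = matrix_norm k (\<lambda>i j. \<Phi> (\<Psi> (T i j)))"
        using P(6) T \<Psi>A by (simp add: completely_isometric_def)
      also have "\<dots> = matrix_norm k T"
        using T r by (intro matrix_norm_cong) simp
      finally show "matrix_norm k (\<lambda>i j. \<Psi> (T i j)) = matrix_norm k T" .
    qed
    moreover have "\<Psi> \<in> Bij A" unfolding \<Psi>_def by (rule restrict_inv_into_Bij[OF P(1)])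
    ultimately have "\<Psi> \<in> algebra_auto A"
      using P add scale mult unit \<Psi>A r
      by (auto simp: algebra_auto_def intro!: eq)
    then show "inv\<^bsub>BijGroup A\<^esub> \<Phi> \<in> algebra_auto A"
      using inv_BijGroup[OF P(1)] by (simp add: \<Psi>_def)
  qed
  then show ?thesis
    unfolding algebra_auto_group_def
    by (rule subgroup.subgroup_is_group[OF _ group_BijGroup])
qed


section \<open>Free power series\<close>

text \<open>Words over \<open>'n\<close> are lists, the empty list being the identity \<open>g\<^sub>0\<close>; a power series with
  real coefficients is its coefficient function \<open>'n list \<Rightarrow> real\<close>.\<close>

definition regular_positive :: "('n::finite list \<Rightarrow> real) \<Rightarrow> bool" where
  "regular_positive a \<longleftrightarrow>
     a [] = 0 \<and> (\<forall>i. a [i] > 0) \<and> (\<forall>\<alpha>. a \<alpha> \<ge> 0) \<and>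
     bdd_above ((\<lambda>k. root k \<bar>\<Sum>\<alpha> | length \<alpha> = k. (a \<alpha>)\<^sup>2\<bar>) ` {1..})"

definition free_polynomial :: "('n list \<Rightarrow> real) \<Rightarrow> bool" where
  "free_polynomial a \<longleftrightarrow> finite {\<alpha>. a \<alpha> \<noteq> 0}"

text \<open>\<open>\<D>\<^sub>f(\<complex>)\<close>: for scalars, \<open>T\<^sub>\<alpha> T\<^sub>\<alpha>\<^sup>*\<close> is the squared modulus of \<open>z\<^sub>\<alpha>\<close>.\<close>

definition scalar_domain :: "('n::finite list \<Rightarrow> real) \<Rightarrow> (complex ^ 'n) set" where
  "scalar_domain a = {z.
     (\<lambda>\<alpha>. a \<alpha> * (cmod (\<Prod>i\<leftarrow>\<alpha>. z $ i))\<^sup>2) summable_on UNIV \<and>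
     (\<Sum>\<^sub>\<infinity>\<alpha>. a \<alpha> * (cmod (\<Prod>i\<leftarrow>\<alpha>. z $ i))\<^sup>2) \<le> 1}"

text \<open>Coefficients of \<open>g(\<lambda>\<^sub>1 X\<^bsub>\<sigma>(1)\<^esub>, \<dots>, \<lambda>\<^sub>n X\<^bsub>\<sigma>(n)\<^esub>)\<close>: the monomial \<open>X\<^sub>\<beta>\<close> of \<open>g\<close> becomes
  \<open>\<lambda>\<^sub>\<beta> X\<^bsub>\<sigma>(\<beta>)\<^esub>\<close>.  For a permutation \<open>\<sigma>\<close> the sum has exactly one term.\<close>

definition permute_rescale ::
    "('n \<Rightarrow> 'n) \<Rightarrow> ('n \<Rightarrow> real) \<Rightarrow> ('n list \<Rightarrow> real) \<Rightarrow> 'n list \<Rightarrow> real" where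
  "permute_rescale \<sigma> c g \<alpha> = (\<Sum>\<beta> | map \<sigma> \<beta> = \<alpha>. g \<beta> * (\<Prod>i\<leftarrow>\<beta>. c i))"

definition permutation_rescaling_equivalent ::
    "('n list \<Rightarrow> real) \<Rightarrow> ('n list \<Rightarrow> real) \<Rightarrow> bool" where
  "permutation_rescaling_equivalent f g \<longleftrightarrow>
     (\<exists>\<sigma> c. bij \<sigma> \<and> (\<forall>i. c i > 0) \<and> permute_rescale \<sigma> c g = f)"

definition spherical :: "('n::finite list \<Rightarrow> real) \<Rightarrow> bool" where
  "spherical f \<longleftrightarrow> (\<exists>g. regular_positive g \<and> permutation_rescaling_equivalent f g \<and>
     interior (scalar_domain g) = {z. (\<Sum>i\<in>UNIV. (cmod (z $ i))\<^sup>2) < 1})"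

definition aspherical :: "('n::finite list \<Rightarrow> real) \<Rightarrow> bool" where
  "aspherical f \<longleftrightarrow> \<not> spherical f"

lemma permute_rescale_map:
  assumes "bij \<sigma>"
  shows "permute_rescale \<sigma> c g (map \<sigma> \<beta>) = g \<beta> * (\<Prod>i\<leftarrow>\<beta>. c i)"
proof -
  have "{\<beta>'. map \<sigma> \<beta>' = map \<sigma> \<beta>} = {\<beta>}"
    using assms by (auto simp: bij_def inj_map_eq_map)
  then show ?thesis by (simp add: permute_rescale_def)
qed


section \<open>The noncommutative domain algebra\<close>

definition weight :: "('n list \<Rightarrow> real) \<Rightarrow> 'n list \<Rightarrow> real" where
  "weight a \<alpha> = (if \<alpha> = [] then 1
     else \<Sum>j = 1..length \<alpha>.
            \<Sum>\<gamma> | length \<gamma> = j \<and> concat \<gamma> = \<alpha> \<and> (\<forall>w\<in>set \<gamma>. length w \<ge> 1). \<Prod>w\<leftarrow>\<gamma>. a w)"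

definition shift_fun :: "('n list \<Rightarrow> real) \<Rightarrow> 'n \<Rightarrow> ('n list \<Rightarrow> complex) \<Rightarrow> 'n list \<Rightarrow> complex" where
  "shift_fun a i x \<alpha> = (case \<alpha> of [] \<Rightarrow> 0
     | j # \<beta> \<Rightarrow> if j = i then of_real (sqrt (weight a \<beta> / weight a (i # \<beta>))) * x \<beta> else 0)"

text \<open>For regular positive \<open>a\<close>, \<^term>\<open>shift_fun a i\<close> does define a bounded operator; see
  \<open>shift_delta\<close> below.\<close>

definition shift :: "('n list \<Rightarrow> real) \<Rightarrow> 'n \<Rightarrow> 'n list operator" where
  "shift a i = Blinfun (\<lambda>x. Abs_ell2 (shift_fun a i (coord x)))"

definition shift_word :: "('n list \<Rightarrow> real) \<Rightarrow> 'n list \<Rightarrow> 'n list operator" where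
  "shift_word a \<alpha> = foldr (\<lambda>i T. shift a i o\<^sub>L T) \<alpha> id_blinfun"

definition domain_algebra :: "('n list \<Rightarrow> real) \<Rightarrow> 'n list operator set" where
  "domain_algebra a = closure (operator.span (range (shift_word a)))"

definition word_decomps :: "'n list \<Rightarrow> 'n list list set" where
  "word_decomps \<alpha> = {\<gamma>. concat \<gamma> = \<alpha> \<and> (\<forall>w\<in>set \<gamma>. length w \<ge> 1)}"

lemma length_word_decomp: "\<gamma> \<in> word_decomps \<alpha> \<Longrightarrow> length \<gamma> \<le> length \<alpha>"
proof (induction \<gamma> arbitrary: \<alpha>)
  case (Cons w \<gamma>)
  have "length \<gamma> \<le> length (concat \<gamma>)" "length w \<ge> 1"
    using Cons.IH[of "concat \<gamma>"] Cons.prems by (auto simp: word_decomps_def)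
  moreover have "\<alpha> = w @ concat \<gamma>" using Cons.prems by (simp add: word_decomps_def)
  ultimately show ?case by simp
qed simp

lemma finite_word_decomps: "finite (word_decomps \<alpha>)"
proof (rule finite_subset)
  let ?W = "{w. set w \<subseteq> set \<alpha> \<and> length w \<le> length \<alpha>}"
  show "word_decomps \<alpha> \<subseteq> {\<gamma>. set \<gamma> \<subseteq> ?W \<and> length \<gamma> \<le> length \<alpha>}"
  proof safe
    fix \<gamma> assume \<gamma>: "\<gamma> \<in> word_decomps \<alpha>"
    then show "length \<gamma> \<le> length \<alpha>" by (rule length_word_decomp)
    fix w assume w: "w \<in> set \<gamma>"
    have \<alpha>: "\<alpha> = concat \<gamma>" using \<gamma> by (simp add: word_decomps_def)
    show "length w \<le> length \<alpha>"
      using w member_le_sum_list[of "length w" "map length \<gamma>"] by (simp add: \<alpha> length_concat)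
    show "x \<in> set \<alpha>" if "x \<in> set w" for x using that w by (auto simp: \<alpha>)
  qed
  have "finite ?W" using finite_lists_length_le[of "set \<alpha>"] by simp
  then show "finite {\<gamma>. set \<gamma> \<subseteq> ?W \<and> length \<gamma> \<le> length \<alpha>}"
    by (rule finite_lists_length_le)
qed

lemma weight_eq: "weight a \<alpha> = (\<Sum>\<gamma>\<in>word_decomps \<alpha>. \<Prod>w\<leftarrow>\<gamma>. a w)"
proof (cases "\<alpha> = []")
  case True
  have "\<gamma> = []" if "\<gamma> \<in> word_decomps []" for \<gamma> :: "'a list list"
    using length_word_decomp[OF that] by simp
  then have "word_decomps [] = {[] :: 'a list list}" by (auto simp: word_decomps_def)
  then show ?thesis using True by (simp add: weight_def)
next
  case False
  have *: "{\<gamma>. length \<gamma> = j \<and> concat \<gamma> = \<alpha> \<and> (\<forall>w\<in>set \<gamma>. length w \<ge> 1)} =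
      {\<gamma> \<in> word_decomps \<alpha>. length \<gamma> = j}" for j
    by (auto simp: word_decomps_def)
  have "length ` word_decomps \<alpha> \<subseteq> {1..length \<alpha>}"
  proof safe
    fix \<gamma> assume \<gamma>: "\<gamma> \<in> word_decomps \<alpha>"
    then have "\<gamma> \<noteq> []" using False by (auto simp: word_decomps_def)
    then show "length \<gamma> \<in> {1..length \<alpha>}" using length_word_decomp[OF \<gamma>] by (cases \<gamma>) auto
  qed
  then show ?thesis
    using False sum.group[OF finite_word_decomps[of \<alpha>], of "{1..length \<alpha>}" length
        "\<lambda>\<gamma>. \<Prod>w\<leftarrow>\<gamma>. a w"]
    by (simp add: weight_def * del: One_nat_def)
qed

lemma prod_list_nonneg_real:
  fixes a :: "'b \<Rightarrow> real"
  shows "(\<And>w. a w \<ge> 0) \<Longrightarrow> (\<Prod>w\<leftarrow>\<gamma>. a w) \<ge> 0"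
  by (induction \<gamma>) auto

lemma weight_Cons_ge:
  assumes "regular_positive a"
  shows "a [i] * weight a \<alpha> \<le> weight a (i # \<alpha>)"
proof -
  have nn: "a w \<ge> 0" for w using assms by (simp add: regular_positive_def)
  have "a [i] * weight a \<alpha> = (\<Sum>\<gamma>\<in>word_decomps \<alpha>. \<Prod>w\<leftarrow>[i] # \<gamma>. a w)"
    by (simp add: weight_eq sum_distrib_left)
  also have "\<dots> = (\<Sum>\<gamma>\<in>Cons [i] ` word_decomps \<alpha>. \<Prod>w\<leftarrow>\<gamma>. a w)"
    by (subst sum.reindex) auto
  also have "\<dots> \<le> weight a (i # \<alpha>)"
    unfolding weight_eq
    by (rule sum_mono2[OF finite_word_decomps])
      (auto simp: word_decomps_def intro: prod_list_nonneg_real nn)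
  finally show ?thesis .
qed

lemma weight_pos:
  assumes "regular_positive a"
  shows "weight a \<alpha> > 0"
proof (induction \<alpha>)
  case (Cons i \<alpha>)
  have "0 < a [i] * weight a \<alpha>" using Cons assms by (simp add: regular_positive_def)
  also have "\<dots> \<le> weight a (i # \<alpha>)" by (rule weight_Cons_ge[OF assms])
  finally show ?case .
qed (simp add: weight_def)

lemma L2_set_shift_fun:
  assumes a: "regular_positive a" and F: "finite F"
  shows "L2_set (\<lambda>\<alpha>. cmod (shift_fun a i (coord x) \<alpha>)) F \<le> sqrt (1 / a [i]) * norm x"
proof -
  let ?G = "{\<beta>. i # \<beta> \<in> F}"
  have ai: "a [i] > 0" using a by (simp add: regular_positive_def)
  have finG: "finite ?G" using finite_vimageI[OF F, of "Cons i"] by (simp add: vimage_def)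
  have quot: "weight a \<beta> / weight a (i # \<beta>) \<le> 1 / a [i]" for \<beta>
    using weight_Cons_ge[OF a, of i \<beta>] weight_pos[OF a, of "i # \<beta>"] ai
    by (simp add: field_simps)
  have bound: "cmod (shift_fun a i (coord x) (i # \<beta>)) \<le> sqrt (1 / a [i]) * cmod (coord x \<beta>)" for \<beta>
    using real_sqrt_le_mono[OF quot[of \<beta>]] less_imp_le[OF weight_pos[OF a]]
    by (simp add: shift_fun_def norm_mult mult_right_mono)
  have "(\<Sum>\<alpha>\<in>F. (cmod (shift_fun a i (coord x) \<alpha>))\<^sup>2)
      = (\<Sum>\<alpha>\<in>Cons i ` ?G. (cmod (shift_fun a i (coord x) \<alpha>))\<^sup>2)"
    by (rule sum.mono_neutral_right[OF F]) (auto simp: shift_fun_def split: list.splits)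
  also have "\<dots> = (\<Sum>\<beta>\<in>?G. (cmod (shift_fun a i (coord x) (i # \<beta>)))\<^sup>2)"
    by (subst sum.reindex) auto
  finally have "L2_set (\<lambda>\<alpha>. cmod (shift_fun a i (coord x) \<alpha>)) F
      = L2_set (\<lambda>\<beta>. cmod (shift_fun a i (coord x) (i # \<beta>))) ?G"
    by (simp add: L2_set_def)
  also have "\<dots> \<le> L2_set (\<lambda>\<beta>. sqrt (1 / a [i]) * cmod (coord x \<beta>)) ?G"
    by (rule L2_set_mono[OF bound]) simp
  also have "\<dots> = sqrt (1 / a [i]) * L2_set (\<lambda>\<beta>. cmod (coord x \<beta>)) ?G"
    using ai by (intro L2_set_right_distrib[symmetric]) simp
  also have "\<dots> \<le> sqrt (1 / a [i]) * norm x"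
    using ai L2_set_le_norm[OF finG, of x] by (intro mult_left_mono) auto
  finally show ?thesis .
qed

lemma coord_shift:
  assumes a: "regular_positive a"
  shows "coord (blinfun_apply (shift a i) x) = shift_fun a i (coord x)"
proof -
  let ?S = "\<lambda>x. Abs_ell2 (shift_fun a i (coord x))"
  have c: "coord (?S x) = shift_fun a i (coord x)" for x
    using square_summableI[OF L2_set_shift_fun[OF a]] by (simp add: Abs_ell2_inverse)
  have "bounded_linear ?S"
  proof (rule bounded_linear_intro)
    show "norm (?S x) \<le> norm x * sqrt (1 / a [i])" for x
      using L2_set_shift_fun[OF a] by (intro norm_le_L2_set) (simp add: c mult.commute)
  next
    have lin: "shift_fun a i (\<lambda>\<beta>. u \<beta> + v \<beta>) \<alpha> = shift_fun a i u \<alpha> + shift_fun a i v \<alpha>"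
      "shift_fun a i (\<lambda>\<beta>. d * u \<beta>) \<alpha> = d * shift_fun a i u \<alpha>" for u v d \<alpha>
      by (auto simp: shift_fun_def distrib_left split: list.split)
    show "?S (x + y) = ?S x + ?S y" for x y
      by (rule ell2_eqI) (unfold c plus_ell2.rep_eq[of "?S x" "?S y"], simp only: plus_ell2.rep_eq lin)
    show "?S (r *\<^sub>R x) = r *\<^sub>R ?S x" for r x
      by (rule ell2_eqI) (unfold c scaleR_ell2.rep_eq[of r "?S x"], simp only: scaleR_ell2.rep_eq lin)
  qed
  then show ?thesis by (simp add: shift_def bounded_linear_Blinfun_apply c)
qed

lemma shift_delta:
  assumes "regular_positive a"
  shows "blinfun_apply (shift a i) (delta \<alpha>)
    = cscale (of_real (sqrt (weight a \<alpha> / weight a (i # \<alpha>)))) (delta (i # \<alpha>))"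
  by (rule ell2_eqI)
    (auto simp: coord_shift[OF assms] shift_fun_def cscale.rep_eq delta.rep_eq split: list.splits)

lemma cscale_add: "cscale c (x + y) = cscale c x + cscale c y"
  by (rule ell2_eqI) (simp add: cscale.rep_eq plus_ell2.rep_eq distrib_left)

lemma shift_cscale:
  assumes "regular_positive a"
  shows "blinfun_apply (shift a i) (cscale c x) = cscale c (blinfun_apply (shift a i) x)"
  by (rule ell2_eqI)
    (auto simp: coord_shift[OF assms] shift_fun_def cscale.rep_eq split: list.splits)

lemma shift_word_cscale:
  assumes "regular_positive a"
  shows "blinfun_apply (shift_word a \<alpha>) (cscale c x) = cscale c (blinfun_apply (shift_word a \<alpha>) x)"
  by (induction \<alpha>) (simp_all add: shift_word_def shift_cscale[OF assms])

lemma shift_word_append: "shift_word a (\<alpha> @ \<beta>) = shift_word a \<alpha> o\<^sub>L shift_word a \<beta>"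
  by (induction \<alpha>) (simp_all add: shift_word_def blinfun_eqI)

lemma domain_algebra_closed:
  assumes a: "regular_positive a"
  shows "id_blinfun \<in> domain_algebra a"
    and "S \<in> domain_algebra a \<Longrightarrow> T \<in> domain_algebra a \<Longrightarrow> S + T \<in> domain_algebra a"
    and "T \<in> domain_algebra a \<Longrightarrow> cscale_op c T \<in> domain_algebra a"
    and "S \<in> domain_algebra a \<Longrightarrow> T \<in> domain_algebra a \<Longrightarrow> S o\<^sub>L T \<in> domain_algebra a"
proof -
  let ?V = "operator.span (range (shift_word a))"
  have W: "shift_word a \<alpha> \<in> ?V" for \<alpha> by (auto intro: operator.span_base)
  have scale_lin: "bounded_linear (cscale_op c :: 'a list operator \<Rightarrow> _)" for c
  proof (rule bounded_linear_intro)
    show "norm (cscale_op c T) \<le> norm T * cmod c" for T :: "'a list operator"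
    proof (rule norm_blinfun_bound)
      show "norm (blinfun_apply (cscale_op c T) x) \<le> norm T * cmod c * norm x" for x
        using mult_left_mono[OF norm_blinfun[of T x], of "cmod c"]
        by (simp add: norm_cscale mult_ac)
    qed simp
  qed (auto intro!: blinfun_eqI ell2_eqI simp: blinfun.add_left blinfun.scaleR_left cscale.rep_eq
      plus_ell2.rep_eq scaleR_ell2.rep_eq algebra_simps)
  have left: "S o\<^sub>L T \<in> ?V" if "S \<in> ?V" "T \<in> range (shift_word a)" for S T
    using that(1)
  proof (induction rule: operator.span_induct_alt)
    case base
    then show ?case
      by (simp add: bounded_bilinear.zero_left[OF bounded_bilinear_blinfun_compose] operator.span_zero)
  next
    case (step c S S')
    have "cscale_op c S + S' o\<^sub>L T = cscale_op c (S o\<^sub>L T) + (S' o\<^sub>L T)"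
      by (rule blinfun_eqI) (simp add: blinfun.add_left)
    moreover have "S o\<^sub>L T \<in> ?V"
      using step(1) that(2) W by (auto simp: shift_word_append[symmetric])
    ultimately show ?case using step by (simp add: operator.span_add operator.span_scale)
  qed
  have lin: "blinfun_apply S (cscale c x) = cscale c (blinfun_apply S x)" if "S \<in> ?V" for S c x
    using that
  proof (induction rule: operator.span_induct_alt)
    case base
    show ?case by (rule ell2_eqI) (simp add: cscale.rep_eq zero_ell2.rep_eq)
  next
    case (step d S S')
    then obtain \<alpha> where "S = shift_word a \<alpha>" by auto
    moreover have "cscale d (cscale c y) = cscale c (cscale d y)" for y :: "'a list ell2"
      by (rule ell2_eqI) (simp add: cscale.rep_eq)
    ultimately show ?case
      using step by (simp add: blinfun.add_left shift_word_cscale[OF a] cscale_add)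
  qed
  have mult: "S o\<^sub>L T \<in> ?V" if "S \<in> ?V" "T \<in> ?V" for S T
    using that(2)
  proof (induction rule: operator.span_induct_alt)
    case base
    then show ?case
      by (simp add: bounded_bilinear.zero_right[OF bounded_bilinear_blinfun_compose] operator.span_zero)
  next
    case (step c T T')
    have "S o\<^sub>L (cscale_op c T + T') = cscale_op c (S o\<^sub>L T) + (S o\<^sub>L T')"
      by (rule blinfun_eqI) (simp add: blinfun.add_left blinfun.add_right lin[OF that(1)])
    then show ?case
      using step left[OF that(1)] by (simp add: operator.span_add operator.span_scale)
  qed
  show "id_blinfun \<in> domain_algebra a"
    using W[of "[]"] closure_subset unfolding domain_algebra_def by (auto simp: shift_word_def)
  have seqD: "\<exists>t. (\<forall>n. t n \<in> ?V) \<and> t \<longlonglongrightarrow> T" if "T \<in> domain_algebra a" for T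
    using that by (simp only: domain_algebra_def closure_sequential)
  have seqI: "T \<in> domain_algebra a" if "\<And>n. t n \<in> ?V" "t \<longlonglongrightarrow> T" for t T
    unfolding domain_algebra_def closure_sequential using that by (intro exI[of _ t]) simp
  show "S + T \<in> domain_algebra a" if ST: "S \<in> domain_algebra a" "T \<in> domain_algebra a"
  proof -
    obtain s t where s: "\<forall>n. s n \<in> ?V" "s \<longlonglongrightarrow> S" and t: "\<forall>n. t n \<in> ?V" "t \<longlonglongrightarrow> T"
      using seqD[OF ST(1)] seqD[OF ST(2)] by (elim exE conjE)
    show ?thesis
      by (rule seqI[OF _ tendsto_add[OF s(2) t(2)]]) (simp add: s(1) t(1) operator.span_add)
  qed
  show "S o\<^sub>L T \<in> domain_algebra a" if ST: "S \<in> domain_algebra a" "T \<in> domain_algebra a"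
  proof -
    obtain s t where s: "\<forall>n. s n \<in> ?V" "s \<longlonglongrightarrow> S" and t: "\<forall>n. t n \<in> ?V" "t \<longlonglongrightarrow> T"
      using seqD[OF ST(1)] seqD[OF ST(2)] by (elim exE conjE)
    show ?thesis
      by (rule seqI[OF _ bounded_bilinear.tendsto[OF bounded_bilinear_blinfun_compose s(2) t(2)]])
        (simp add: s(1) t(1) mult)
  qed
  show "cscale_op c T \<in> domain_algebra a" if T: "T \<in> domain_algebra a"
  proof -
    obtain t where t: "\<forall>n. t n \<in> ?V" "t \<longlonglongrightarrow> T"
      using seqD[OF T] by (elim exE conjE)
    show ?thesis
      by (rule seqI[OF _ bounded_linear.tendsto[OF scale_lin t(2)]]) (simp add: t(1) operator.span_scale)
  qed
qed

lemma group_domain_algebra_auto_group: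
  "regular_positive a \<Longrightarrow> group (algebra_auto_group (domain_algebra a))"
  by (rule group_algebra_auto_group) (simp_all add: domain_algebra_closed)


section \<open>The unitary group\<close>

definition unitary_group :: "(complex ^ 'n ^ 'n::finite) monoid" where
  "unitary_group =
     \<lparr>carrier = {U. map_matrix cnj (transpose U) ** U = mat 1 \<and> U ** map_matrix cnj (transpose U) = mat 1},
      mult = (**), one = mat 1\<rparr>"

lemma group_unitary_group: "group (unitary_group :: (complex ^ 'n ^ 'n::finite) monoid)"
proof (rule groupI)
  define H :: "complex ^ 'n ^ 'n \<Rightarrow> complex ^ 'n ^ 'n" where "H = (\<lambda>U. map_matrix cnj (transpose U))"
  have HH: "H (H U) = U" for U by (simp add: H_def vec_eq_iff transpose_def)
  have Hm: "H (U ** V) = H V ** H U" for U V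
    by (simp add: H_def vec_eq_iff transpose_def matrix_matrix_mult_def mult.commute)
  have H1: "H (mat 1) = mat 1" by (simp add: H_def vec_eq_iff transpose_def mat_def)
  have carr: "U \<in> carrier unitary_group \<longleftrightarrow> H U ** U = mat 1 \<and> U ** H U = mat 1" for U
    by (simp add: unitary_group_def H_def)
  have ops: "mult unitary_group = (**)" "one unitary_group = (mat 1 :: complex ^ 'n ^ 'n)"
    by (simp_all add: unitary_group_def)
  show "U \<otimes>\<^bsub>unitary_group\<^esub> V \<in> carrier unitary_group"
    if "U \<in> carrier unitary_group" "V \<in> carrier unitary_group" for U V :: "complex ^ 'n ^ 'n"
    using that unfolding carr ops Hm by (metis matrix_mul_assoc matrix_mul_rid)
  show "\<one>\<^bsub>unitary_group\<^esub> \<in> carrier (unitary_group :: (complex ^ 'n ^ 'n) monoid)"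
    unfolding carr ops H1 by simp
  show "\<exists>V\<in>carrier unitary_group. V \<otimes>\<^bsub>unitary_group\<^esub> U = \<one>\<^bsub>unitary_group\<^esub>"
    if "U \<in> carrier unitary_group" for U :: "complex ^ 'n ^ 'n"
    using that unfolding carr ops by (intro bexI[of _ "H U"]) (auto simp: carr HH)
qed (auto simp: unitary_group_def matrix_mul_assoc)

end

theory Submission
  imports Defs "HOL-Algebra.Coset" "HOL-Computational_Algebra.Polynomial"
begin

text \<open>Write \<open>P(z, w) = \<Sum> a\<^sub>\<alpha> z\<^sub>\<alpha> cnj(w\<^sub>\<alpha>)\<close> and \<open>F = 1 - P\<close>. The characters of the domain algebra that are
  needed here are the evaluations at the points of \<open>{z. P(z, z) < 1}\<close>, and their eigenvectors give
  the reproducing kernel \<open>1 / F\<close>: the recursion for the weights says exactly that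
  \<open>\<Sum> b\<^sub>\<alpha> z\<^sub>\<alpha> cnj(w\<^sub>\<alpha>) = 1 / (1 - P(z, w))\<close>. An automorphism \<open>\<Phi>\<close> therefore moves points, by a map
  \<open>\<phi>\<close> with \<open>character z (\<Phi> T) = character (\<phi> z) T\<close>.

  There are two halves. The first shows that \<open>\<phi>\<close> fixes the origin unless \<open>f\<close> is linear. The row with
  entries \<open>\<surd>a\<^sub>\<alpha> W\<^sub>\<alpha>\<close> is a contraction, and \<open>\<Phi>\<close> keeps it a contraction because it is completely
  isometric; pairing with eigenvectors turns this into positivity of the kernel
  \<open>F(\<phi> z, \<phi> w) / F(z, w)\<close> (\<open>auto_positive_kernel\<close>). The inverse automorphism makes the reciprocal
  kernel positive too, and a positive kernel with positive reciprocal has rank one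
  (\<open>positive_kernel_reciprocal\<close>). With \<open>\<phi> c = 0\<close> this yields
  \<open>F(\<phi> z, \<phi> w) F(z, c) F(c, w) = F(z, w) F(c, c)\<close> (\<open>auto_kernel_identity\<close>). The form \<open>P\<close> is
  invariant under simultaneous rotation of both arguments. Differentiating the identity along the
  rotations transports the rotation field to a vector field \<open>v\<close> which is an infinitesimal symmetry of
  \<open>F\<close> (\<open>Killing\<close>), and \<open>v(0) \<noteq> 0\<close> if \<open>c \<noteq> 0\<close>. First-order terms at the origin force \<open>v\<close> to be
  quadratic (\<open>velocity_quadratic\<close>), and its quadratic coefficients are at least as large as those
  for a ball, because all coefficients of \<open>f\<close> are nonnegative. In the top degree \<open>d\<close> of \<open>f\<close> the
  symmetry equation then reads \<open>l \<ge> d l\<close> for a number \<open>l > 0\<close>, so that \<open>d = 1\<close>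
  (\<open>linear_if_moves_origin\<close>). A linear \<open>f\<close> is spherical: after rescaling the generators, its scalar
  domain is the unit ball.

  The second half embeds the automorphisms that fix the origin into the unitary group by their linear
  part. On the span of the normalised generators \<open>\<surd>a\<^sub>j W\<^sub>j\<close> the operator norm is the Euclidean norm,
  so that the linear part of an automorphism, and that of its inverse, are contractions; hence both
  are unitary (\<open>linear_part_unitary\<close>). The linear part determines the automorphism by the argument of
  Cartan's uniqueness theorem: if it is the identity and \<open>\<Phi> W\<^sub>j\<close> differs from \<open>W\<^sub>j\<close>, the lowest
  Fourier coefficient in which they differ grows linearly under iteration of \<open>\<Phi>\<close>, while all
  iterates have the same norm (\<open>fourier_auto_generator\<close>).\<close>

section \<open>Square-summable families\<close>

lemma square_sum_coord_le:
  assumes "finite F" shows "(\<Sum>i\<in>F. (cmod (coord x i))\<^sup>2) \<le> (norm x)\<^sup>2"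
proof -
  have "(L2_set (\<lambda>i. cmod (coord x i)) F)\<^sup>2 \<le> (norm x)\<^sup>2"
    by (intro power_mono L2_set_le_norm[OF assms]) simp
  then show ?thesis by (simp add: L2_set_def sum_nonneg)
qed

lemma norm_le_if_square_sums:
  assumes "\<And>F. finite F \<Longrightarrow> (\<Sum>i\<in>F. (cmod (coord x i))\<^sup>2) \<le> M\<^sup>2" "M \<ge> 0"
  shows "norm (x :: 'a ell2) \<le> M"
proof (rule norm_le_L2_set)
  fix F :: "'a set" assume "finite F"
  from assms(1)[OF this] show "L2_set (\<lambda>i. cmod (coord x i)) F \<le> M"
    unfolding L2_set_def by (rule real_le_lsqrt[OF assms(2)])
qed

lemma coord_sum: "coord (sum f I) \<alpha> = (\<Sum>i\<in>I. coord (f i) \<alpha>)"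
  by (induction I rule: infinite_finite_induct) (simp_all add: zero_ell2.rep_eq plus_ell2.rep_eq)

text \<open>The pairing is bilinear rather than sesquilinear, so that the eigenfunctional of a character
  is the pairing with a vector that depends holomorphically on the point.\<close>

definition pair :: "'a ell2 \<Rightarrow> 'a ell2 \<Rightarrow> complex" where
  "pair y x = (\<Sum>\<^sub>\<infinity>\<alpha>. coord y \<alpha> * coord x \<alpha>)"

lemma pair_abs_bound:
  assumes "finite F" shows "(\<Sum>\<alpha>\<in>F. cmod (coord y \<alpha> * coord x \<alpha>)) \<le> norm y * norm x"
proof -
  have "(\<Sum>\<alpha>\<in>F. cmod (coord y \<alpha> * coord x \<alpha>))
      = (\<Sum>\<alpha>\<in>F. \<bar>cmod (coord y \<alpha>)\<bar> * \<bar>cmod (coord x \<alpha>)\<bar>)"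
    by (simp add: norm_mult)
  also have "\<dots> \<le> L2_set (\<lambda>i. cmod (coord y i)) F * L2_set (\<lambda>i. cmod (coord x i)) F"
    by (rule L2_set_mult_ineq)
  also have "\<dots> \<le> norm y * norm x"
    by (intro mult_mono L2_set_le_norm assms) auto
  finally show ?thesis .
qed

lemma pair_abs_summable: "(\<lambda>\<alpha>. cmod (coord y \<alpha> * coord x \<alpha>)) summable_on UNIV"
  by (rule nonneg_bdd_above_summable_on)
    (auto intro!: bdd_aboveI[where M = "norm y * norm x"] pair_abs_bound)

lemma pair_summable: "(\<lambda>\<alpha>. coord y \<alpha> * coord x \<alpha>) summable_on UNIV"
  by (rule abs_summable_summable[OF pair_abs_summable])

lemma pair_has_sum: "((\<lambda>\<alpha>. coord y \<alpha> * coord x \<alpha>) has_sum pair y x) UNIV"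
  unfolding pair_def by (rule has_sum_infsum[OF pair_summable])

lemma norm_pair_le: "cmod (pair y x) \<le> norm y * norm x"
proof -
  have "cmod (pair y x) \<le> (\<Sum>\<^sub>\<infinity>\<alpha>. cmod (coord y \<alpha> * coord x \<alpha>))"
    unfolding pair_def by (rule norm_infsum_bound[OF pair_abs_summable])
  also have "\<dots> \<le> norm y * norm x"
    by (rule infsum_le_finite_sums[OF pair_abs_summable pair_abs_bound])
  finally show ?thesis .
qed

lemma pair_add_right: "pair y (x + x') = pair y x + pair y x'"
  unfolding pair_def plus_ell2.rep_eq distrib_left
  by (rule infsum_add[OF pair_summable pair_summable])

lemma pair_add_left: "pair (y + y') x = pair y x + pair y' x"
  unfolding pair_def plus_ell2.rep_eq distrib_right
  by (rule infsum_add[OF pair_summable pair_summable])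

lemma pair_cscale_right: "pair y (cscale c x) = c * pair y x"
  unfolding pair_def cscale.rep_eq mult.left_commute[of _ c] by (rule infsum_cmult_right')

lemma pair_cscale_left: "pair (cscale c y) x = c * pair y x"
  unfolding pair_def cscale.rep_eq mult.assoc by (rule infsum_cmult_right')

lemma pair_sum_right: "pair y (sum f I) = (\<Sum>i\<in>I. pair y (f i))"
  by (induction I rule: infinite_finite_induct)
    (simp_all add: pair_add_right, simp_all add: pair_def zero_ell2.rep_eq)

lemma pair_sum_left: "pair (sum f I) x = (\<Sum>i\<in>I. pair (f i) x)"
  by (induction I rule: infinite_finite_induct)
    (simp_all add: pair_add_left, simp_all add: pair_def zero_ell2.rep_eq)

lift_definition cnj_vec :: "'a ell2 \<Rightarrow> 'a ell2" is "\<lambda>x i. cnj (x i)"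
  by (simp add: square_summable_def)

lemma norm_cnj_vec [simp]: "norm (cnj_vec x) = norm x"
  by (simp add: norm_ell2.rep_eq cnj_vec.rep_eq)

lemma cnj_vec_sum: "cnj_vec (sum f I) = (\<Sum>i\<in>I. cnj_vec (f i))"
  by (rule ell2_eqI) (simp add: cnj_vec.rep_eq coord_sum)

lemma cnj_vec_cscale: "cnj_vec (cscale c x) = cscale (cnj c) (cnj_vec x)"
  by (rule ell2_eqI) (simp add: cnj_vec.rep_eq cscale.rep_eq)

lemma pair_cnj_vec: "pair y (cnj_vec y) = of_real ((norm y)\<^sup>2)"
proof -
  have "pair y (cnj_vec y) = (\<Sum>\<^sub>\<infinity>\<alpha>. complex_of_real ((cmod (coord y \<alpha>))\<^sup>2))"
    unfolding pair_def by (simp only: cnj_vec.rep_eq complex_norm_square)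
  also have "\<dots> = of_real (\<Sum>\<^sub>\<infinity>\<alpha>. (cmod (coord y \<alpha>))\<^sup>2)"
    by (rule infsumI, rule has_sum_of_real_iff[THEN iffD2], rule has_sum_infsum)
      (use square_summable_coord[of y] in \<open>simp add: square_summable_def\<close>)
  also have "(\<Sum>\<^sub>\<infinity>\<alpha>. (cmod (coord y \<alpha>))\<^sup>2) = (norm y)\<^sup>2"
    by (simp add: norm_ell2.rep_eq infsum_nonneg)
  finally show ?thesis .
qed

lemma pair_delta: "pair y (delta \<beta>) = coord y \<beta>"
proof -
  have "pair y (delta \<beta>) = (\<Sum>\<^sub>\<infinity>\<alpha>\<in>{\<beta>}. coord y \<alpha> * coord (delta \<beta>) \<alpha>)"
    unfolding pair_def by (rule infsum_cong_neutral) (auto simp: delta.rep_eq)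
  then show ?thesis by (simp add: delta.rep_eq)
qed

lemma norm_delta [simp]: "norm (delta \<beta> :: 'a ell2) = 1"
proof -
  have "cnj_vec (delta \<beta>) = (delta \<beta> :: 'a ell2)"
    by (rule ell2_eqI) (simp add: cnj_vec.rep_eq delta.rep_eq)
  then have "complex_of_real ((norm (delta \<beta> :: 'a ell2))\<^sup>2) = 1"
    using pair_cnj_vec[of "delta \<beta> :: 'a ell2"] by (simp add: pair_delta delta.rep_eq)
  then have "(norm (delta \<beta> :: 'a ell2))\<^sup>2 = 1"
    using of_real_eq_1_iff by blast
  then show ?thesis using norm_ge_zero[of "delta \<beta> :: 'a ell2"] by (auto simp: power2_eq_1_iff)
qed

section \<open>Matrix norms\<close>

text \<open>The supremum that defines the matrix norm is one of real numbers, so it is informative only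
  together with this bound.\<close>

lemma matrix_norm_bdd:
  fixes T :: "nat \<Rightarrow> nat \<Rightarrow> 'a operator"
  shows "bdd_above ((\<lambda>x. L2_set (\<lambda>i. norm (\<Sum>j<k. blinfun_apply (T i j) (x j))) {..<k})
      ` {x. L2_set (\<lambda>j. norm (x j)) {..<k} \<le> 1})"
proof (rule bdd_aboveI2)
  fix x :: "nat \<Rightarrow> 'a ell2"
  assume "x \<in> {x. L2_set (\<lambda>j. norm (x j)) {..<k} \<le> 1}"
  then have le: "L2_set (\<lambda>j. norm (x j)) {..<k} \<le> 1" by simp
  have x: "norm (x j) \<le> 1" if "j < k" for j
    by (rule order_trans[OF member_le_L2_set le]) (use that in simp_all)
  have "L2_set (\<lambda>i. norm (\<Sum>j<k. blinfun_apply (T i j) (x j))) {..<k}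
      \<le> (\<Sum>i<k. norm (\<Sum>j<k. blinfun_apply (T i j) (x j)))"
    by (rule L2_set_le_sum) simp
  also have "\<dots> \<le> (\<Sum>i<k. \<Sum>j<k. norm (T i j))"
  proof (intro sum_mono sum_norm_le)
    fix i j assume "j \<in> {..<k}"
    then show "norm (blinfun_apply (T i j) (x j)) \<le> norm (T i j)"
      using norm_blinfun[of "T i j" "x j"] mult_left_mono[OF x, of j "norm (T i j)"] by simp
  qed
  finally show "L2_set (\<lambda>i. norm (\<Sum>j<k. blinfun_apply (T i j) (x j))) {..<k}
      \<le> (\<Sum>i<k. \<Sum>j<k. norm (T i j))" .
qed

lemma matrix_norm_upper:
  assumes "L2_set (\<lambda>j. norm (x j)) {..<k} \<le> 1"
  shows "L2_set (\<lambda>i. norm (\<Sum>j<k. blinfun_apply (T i j) (x j))) {..<k} \<le> matrix_norm k T"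
  unfolding matrix_norm_def by (rule cSUP_upper[OF _ matrix_norm_bdd]) (use assms in simp)

lemma matrix_norm_le:
  fixes T :: "nat \<Rightarrow> nat \<Rightarrow> 'a operator"
  assumes "\<And>x. L2_set (\<lambda>j. norm (x j)) {..<k} \<le> 1 \<Longrightarrow>
      L2_set (\<lambda>i. norm (\<Sum>j<k. blinfun_apply (T i j) (x j))) {..<k} \<le> M"
  shows "matrix_norm k T \<le> M"
  unfolding matrix_norm_def
proof (rule cSUP_least)
  have "(\<lambda>_. 0) \<in> {x :: nat \<Rightarrow> 'a ell2. L2_set (\<lambda>j. norm (x j)) {..<k} \<le> 1}"
    by (simp add: L2_set_def)
  then show "{x :: nat \<Rightarrow> 'a ell2. L2_set (\<lambda>j. norm (x j)) {..<k} \<le> 1} \<noteq> {}"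
    unfolding ex_in_conv[symmetric] by (rule exI[of _ "\<lambda>_. 0"])
qed (auto intro: assms)

text \<open>One row of a contractive matrix acts as a row contraction on vectors of arbitrary length; the
  definition speaks of the unit ball only, hence the rescaling.\<close>

lemma matrix_norm_row_bound:
  assumes "matrix_norm k T \<le> 1" "i < k"
  shows "norm (\<Sum>j<k. blinfun_apply (T i j) (x j)) \<le> L2_set (\<lambda>j. norm (x j)) {..<k}"
proof (cases "L2_set (\<lambda>j. norm (x j)) {..<k} = 0")
  case True
  then have "x j = 0" if "j < k" for j using that by (auto simp: L2_set_eq_0_iff)
  then show ?thesis by simp
next
  case False
  define r where "r = L2_set (\<lambda>j. norm (x j)) {..<k}"
  have r: "r > 0" using False L2_set_nonneg[of "\<lambda>j. norm (x j)" "{..<k}"] by (simp add: r_def less_le)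
  let ?x = "\<lambda>j. (1 / r) *\<^sub>R x j"
  have "(1 / r) * L2_set (\<lambda>j. norm (x j)) {..<k} = L2_set (\<lambda>j. (1 / r) * norm (x j)) {..<k}"
    by (rule L2_set_right_distrib) (use r in simp)
  then have "L2_set (\<lambda>j. norm (?x j)) {..<k} = 1"
    using r by (simp add: r_def[symmetric])
  then have "L2_set (\<lambda>j. norm (?x j)) {..<k} \<le> 1" by simp
  note upper = matrix_norm_upper[OF this, of T]
  have "(1 / r) * norm (\<Sum>j<k. blinfun_apply (T i j) (x j)) = norm (\<Sum>j<k. blinfun_apply (T i j) (?x j))"
    using r by (simp add: blinfun.scaleR_right scaleR_sum_right[symmetric])
  also have "\<dots> \<le> L2_set (\<lambda>i. norm (\<Sum>j<k. blinfun_apply (T i j) (?x j))) {..<k}"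
    by (rule member_le_L2_set) (use assms(2) in simp_all)
  also have "\<dots> \<le> 1" using upper assms(1) by linarith
  finally show ?thesis unfolding r_def[symmetric] using r by (simp add: field_simps)
qed

lemma matrix_norm_1: "matrix_norm 1 T = norm (T 0 0)"
proof (rule antisym)
  show "matrix_norm 1 T \<le> norm (T 0 0)"
  proof (rule matrix_norm_le)
    fix x :: "nat \<Rightarrow> 'a ell2" assume "L2_set (\<lambda>j. norm (x j)) {..<1} \<le> 1"
    then have "norm (x 0) \<le> 1" by (simp add: lessThan_Suc)
    then show "L2_set (\<lambda>i. norm (\<Sum>j<1. blinfun_apply (T i j) (x j))) {..<1} \<le> norm (T 0 0)"
      using norm_blinfun[of "T 0 0" "x 0"] mult_left_mono[of "norm (x 0)" 1 "norm (T 0 0)"]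
      by (simp add: lessThan_Suc)
  qed
  have nn: "matrix_norm 1 T \<ge> 0"
    using matrix_norm_upper[of "\<lambda>_. 0" 1 T] by (simp add: L2_set_def)
  show "norm (T 0 0) \<le> matrix_norm 1 T"
  proof (rule norm_blinfun_bound[OF nn])
    fix x :: "'a ell2"
    show "norm (blinfun_apply (T 0 0) x) \<le> matrix_norm 1 T * norm x"
    proof (cases "x = 0")
      case False
      then have "norm (blinfun_apply (T 0 0) ((1 / norm x) *\<^sub>R x)) \<le> matrix_norm 1 T"
        using matrix_norm_upper[of "\<lambda>_. (1 / norm x) *\<^sub>R x" 1 T] by (simp add: lessThan_Suc)
      then show ?thesis using False by (simp add: blinfun.scaleR_right field_simps)
    qed simp
  qed
qed

lemma completely_isometric_norm:
  assumes "completely_isometric A \<Phi>" "T \<in> A"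
  shows "norm (\<Phi> T) = norm T"
  using assms(1)[unfolded completely_isometric_def, THEN spec[of _ 1], THEN spec[of _ "\<lambda>_ _. T"]] assms(2)
  by (simp add: matrix_norm_1 del: One_nat_def)

section \<open>Words and weights\<close>

definition word_eval :: "('n \<Rightarrow> complex) \<Rightarrow> 'n list \<Rightarrow> complex" where
  "word_eval z \<alpha> = (\<Prod>i\<leftarrow>\<alpha>. z i)"

lemma word_eval_simps [simp]:
  "word_eval z [] = 1" "word_eval z (i # \<alpha>) = z i * word_eval z \<alpha>"
  "word_eval z (\<alpha> @ \<beta>) = word_eval z \<alpha> * word_eval z \<beta>"
  by (simp_all add: word_eval_def)

lemma word_eval_zero: "\<alpha> \<noteq> [] \<Longrightarrow> word_eval (\<lambda>_. 0) \<alpha> = 0"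
  by (cases \<alpha>) auto

lemma word_eval_prefix:
  "take n \<gamma> = \<alpha> \<Longrightarrow> word_eval z \<gamma> = word_eval z \<alpha> * word_eval z (drop n \<gamma>)"
  by (metis append_take_drop_id word_eval_simps(3))

text \<open>A factorisation of a nonempty word is its first factor together with a factorisation of the
  rest.\<close>

lemma weight_split:
  assumes "\<alpha> \<noteq> []"
  shows "weight a \<alpha> = (\<Sum>k\<in>{1..length \<alpha>}. a (take k \<alpha>) * weight a (drop k \<alpha>))"
proof -
  have decomps: "word_decomps \<alpha> = (\<Union>k\<in>{1..length \<alpha>}. (#) (take k \<alpha>) ` word_decomps (drop k \<alpha>))"
  proof (rule equalityI; rule subsetI)
    fix \<gamma> assume \<gamma>: "\<gamma> \<in> word_decomps \<alpha>"
    then obtain w \<gamma>' where c: "\<gamma> = w # \<gamma>'"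
      using assms by (cases \<gamma>) (auto simp: word_decomps_def)
    have eq: "\<alpha> = w @ concat \<gamma>'" "length w \<ge> 1" "\<forall>w\<in>set \<gamma>'. length w \<ge> 1"
      using \<gamma> c by (auto simp: word_decomps_def)
    then have "length w \<in> {1..length \<alpha>}" "take (length w) \<alpha> = w" "\<gamma>' \<in> word_decomps (drop (length w) \<alpha>)"
      by (auto simp: word_decomps_def)
    then show "\<gamma> \<in> (\<Union>k\<in>{1..length \<alpha>}. (#) (take k \<alpha>) ` word_decomps (drop k \<alpha>))"
      using c by (intro UN_I[of "length w"]) auto
  next
    fix \<gamma> assume "\<gamma> \<in> (\<Union>k\<in>{1..length \<alpha>}. (#) (take k \<alpha>) ` word_decomps (drop k \<alpha>))"
    then obtain k \<gamma>' where *: "k \<in> {1..length \<alpha>}" "\<gamma> = take k \<alpha> # \<gamma>'" "\<gamma>' \<in> word_decomps (drop k \<alpha>)"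
      by blast
    then show "\<gamma> \<in> word_decomps \<alpha>"
      by (auto simp: word_decomps_def)
  qed
  have "(\<Sum>\<gamma>\<in>word_decomps \<alpha>. \<Prod>w\<leftarrow>\<gamma>. a w)
      = (\<Sum>k\<in>{1..length \<alpha>}. \<Sum>\<gamma>\<in>(#) (take k \<alpha>) ` word_decomps (drop k \<alpha>). \<Prod>w\<leftarrow>\<gamma>. a w)"
    unfolding decomps
  proof (rule sum.UNION_disjoint)
    have "k = l" if "k \<in> {1..length \<alpha>}" "l \<in> {1..length \<alpha>}" "take k \<alpha> = take l \<alpha>" for k l
      using that by (metis atLeastAtMost_iff length_take min.absorb2)
    then show "\<forall>k\<in>{1..length \<alpha>}. \<forall>l\<in>{1..length \<alpha>}. k \<noteq> l \<longrightarrow>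
        (#) (take k \<alpha>) ` word_decomps (drop k \<alpha>) \<inter> (#) (take l \<alpha>) ` word_decomps (drop l \<alpha>) = {}"
      by blast
  qed (auto intro: finite_word_decomps)
  also have "\<dots> = (\<Sum>k\<in>{1..length \<alpha>}. a (take k \<alpha>) * weight a (drop k \<alpha>))"
    by (intro sum.cong refl) (simp add: sum.reindex weight_eq sum_distrib_left)
  finally show ?thesis by (simp add: weight_eq)
qed

text \<open>Words with prefix \<open>\<alpha>\<close> correspond to their remainders. This is the injectivity of the
  multiplication by \<open>\<alpha>\<close>, for finite estimates and for infinite sums.\<close>

lemma sum_prefix_le:
  fixes q :: "'a list \<Rightarrow> real"
  assumes "finite F" "finite G" "\<And>\<gamma>. q \<gamma> \<ge> 0"
    and "\<And>\<gamma>. \<gamma> \<in> F \<Longrightarrow> take (length \<alpha>) \<gamma> = \<alpha> \<Longrightarrow> drop (length \<alpha>) \<gamma> \<in> G"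
  shows "(\<Sum>\<gamma>\<in>F. if take (length \<alpha>) \<gamma> = \<alpha> then q (drop (length \<alpha>) \<gamma>) else 0) \<le> sum q G"
proof -
  let ?F = "{\<gamma> \<in> F. take (length \<alpha>) \<gamma> = \<alpha>}"
  have inj: "inj_on (drop (length \<alpha>)) ?F"
    by (rule inj_onI) (metis (mono_tags, lifting) append_take_drop_id mem_Collect_eq)
  have "(\<Sum>\<gamma>\<in>F. if take (length \<alpha>) \<gamma> = \<alpha> then q (drop (length \<alpha>) \<gamma>) else 0)
      = (\<Sum>\<gamma>\<in>?F. q (drop (length \<alpha>) \<gamma>))"
    by (rule sum.inter_filter[symmetric]) (rule assms(1))
  also have "\<dots> = sum q (drop (length \<alpha>) ` ?F)"
    by (simp add: sum.reindex[OF inj])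
  also have "\<dots> \<le> sum q G"
    by (rule sum_mono2) (use assms in auto)
  finally show ?thesis .
qed

lemma has_sum_prefix:
  fixes g :: "'a list \<Rightarrow> complex"
  assumes "(g has_sum K) UNIV"
  shows "((\<lambda>\<gamma>. if take (length \<alpha>) \<gamma> = \<alpha> then g (drop (length \<alpha>) \<gamma>) else 0) has_sum K) UNIV"
proof -
  have inj: "inj ((@) \<alpha>)" by (rule injI) simp
  have eq: "(\<lambda>\<gamma>. if take (length \<alpha>) \<gamma> = \<alpha> then g (drop (length \<alpha>) \<gamma>) else 0) \<circ> (@) \<alpha> = g"
    by (rule ext) simp
  have "((\<lambda>\<gamma>. if take (length \<alpha>) \<gamma> = \<alpha> then g (drop (length \<alpha>) \<gamma>) else 0) has_sum K) (range ((@) \<alpha>))"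
    unfolding has_sum_reindex[OF inj] eq by (rule assms)
  moreover have "\<gamma> \<in> range ((@) \<alpha>)" if "take (length \<alpha>) \<gamma> = \<alpha>" for \<gamma>
    using that by (metis append_take_drop_id rangeI)
  ultimately show ?thesis
    by (subst has_sum_cong_neutral[where T = "range ((@) \<alpha>)"]) auto
qed

lemma has_sum_sum_finite:
  fixes g :: "'b \<Rightarrow> 'a \<Rightarrow> complex"
  assumes "\<And>i. i \<in> I \<Longrightarrow> (g i has_sum K i) UNIV"
  shows "((\<lambda>x. \<Sum>i\<in>I. g i x) has_sum (\<Sum>i\<in>I. K i)) UNIV"
  using assms by (induction I rule: infinite_finite_induct) (auto intro: has_sum_add)

section \<open>Bounded functionals on the algebra\<close>

text \<open>Only the values on \<open>A\<close> matter, because automorphisms have a dummy value outside it, and a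
  functional composed with an automorphism has to be a functional again.\<close>

definition functional_on :: "'a operator set \<Rightarrow> ('a operator \<Rightarrow> complex) \<Rightarrow> bool" where
  "functional_on A g \<longleftrightarrow> (\<forall>S\<in>A. \<forall>T\<in>A. g (S + T) = g S + g T) \<and>
     (\<forall>c. \<forall>T\<in>A. g (cscale_op c T) = c * g T) \<and> (\<exists>B. \<forall>T\<in>A. cmod (g T) \<le> B * norm T)"

lemma functional_on_cmult: "functional_on A g \<Longrightarrow> functional_on A (\<lambda>T. c * g T)"
proof -
  assume g: "functional_on A g"
  then obtain B where B: "\<And>T. T \<in> A \<Longrightarrow> cmod (g T) \<le> B * norm T" unfolding functional_on_def by blast
  have "cmod (c * g T) \<le> (cmod c * B) * norm T" if "T \<in> A" for T
    using mult_left_mono[OF B[OF that], of "cmod c"] by (simp add: norm_mult)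
  then show ?thesis using g by (auto simp: functional_on_def distrib_left)
qed

lemma functional_on_add:
  assumes "functional_on A g" "functional_on A h"
  shows "functional_on A (\<lambda>T. g T + h T)"
proof -
  obtain B C where B: "\<And>T. T \<in> A \<Longrightarrow> cmod (g T) \<le> B * norm T" "\<And>T. T \<in> A \<Longrightarrow> cmod (h T) \<le> C * norm T"
    using assms unfolding functional_on_def by blast
  have "cmod (g T + h T) \<le> (B + C) * norm T" if "T \<in> A" for T
    using norm_triangle_ineq[of "g T" "h T"] B[OF that] by (simp add: algebra_simps)
  then show ?thesis using assms by (auto simp: functional_on_def distrib_left)
qed

lemma functional_on_zero: "functional_on A (\<lambda>_. 0)"
  by (auto simp: functional_on_def intro!: exI[of _ 0])

lemma functional_on_sum:
  "(\<And>i. i \<in> I \<Longrightarrow> functional_on A (g i)) \<Longrightarrow> functional_on A (\<lambda>T. \<Sum>i\<in>I. g i T)"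
  by (induction I rule: infinite_finite_induct) (auto intro: functional_on_add functional_on_zero)

lemma functional_on_coord: "functional_on A (\<lambda>T. coord (blinfun_apply T x) \<gamma>)"
proof -
  have "cmod (coord (blinfun_apply T x) \<gamma>) \<le> norm x * norm T" for T
    using coord_le_norm[of "blinfun_apply T x" \<gamma>] norm_blinfun[of T x] by (simp add: mult.commute)
  then show ?thesis
    by (auto simp: functional_on_def blinfun.add_left plus_ell2.rep_eq cscale.rep_eq)
qed

lemma functional_on_pair: "functional_on A (\<lambda>T. pair y (blinfun_apply T x))"
proof -
  have "cmod (pair y (blinfun_apply T x)) \<le> (norm y * norm x) * norm T" for T
    using norm_pair_le[of y "blinfun_apply T x"] mult_left_mono[OF norm_blinfun[of T x], of "norm y"]
    by (simp add: mult_ac)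
  then show ?thesis
    by (auto simp: functional_on_def blinfun.add_left pair_add_right pair_cscale_right)
qed

section \<open>The weighted shifts\<close>

locale regular_polynomial =
  fixes a :: "'n::finite list \<Rightarrow> real"
  assumes regular: "regular_positive a" and polynomial: "free_polynomial a"
begin

abbreviation A where "A \<equiv> domain_algebra a"
abbreviation b where "b \<equiv> weight a"
abbreviation W where "W \<equiv> shift_word a"

definition supp where "supp = {\<alpha>. a \<alpha> \<noteq> 0}"

lemma finite_support [simp, intro]: "finite supp"
  using polynomial by (simp add: supp_def free_polynomial_def)

lemma a_nonneg [simp]: "a \<alpha> \<ge> 0" and a_letter [simp]: "a [i] > 0" and a_Nil [simp]: "a [] = 0"
  using regular by (auto simp: regular_positive_def)

lemma Nil_notin_support [simp]: "[] \<notin> supp"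
  by (simp add: supp_def)

lemma letter_in_support [simp]: "[i] \<in> supp"
  using a_letter[of i] by (simp add: supp_def del: a_letter)

lemma b_pos [simp]: "b \<alpha> > 0"
  by (rule weight_pos[OF regular])

lemma b_Nil [simp]: "b [] = 1"
  by (simp add: weight_def)

text \<open>The coefficient form of \<open>b = 1 + f b\<close>, which expresses that the \<open>b\<^sub>\<alpha>\<close> are the coefficients of
  \<open>1 / (1 - f)\<close>.\<close>

lemma weight_recursion:
  "b \<gamma> = (if \<gamma> = [] then 1 else 0)
     + (\<Sum>\<beta>\<in>supp. if take (length \<beta>) \<gamma> = \<beta> then a \<beta> * b (drop (length \<beta>) \<gamma>) else 0)"
proof (cases "\<gamma> = []")
  case True
  have "(\<Sum>\<beta>\<in>supp. if take (length \<beta>) \<gamma> = \<beta> then a \<beta> * b (drop (length \<beta>) \<gamma>) else 0) = 0"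
    using True by (intro sum.neutral) auto
  then show ?thesis using True by simp
next
  case False
  have "(\<Sum>\<beta>\<in>supp. if take (length \<beta>) \<gamma> = \<beta> then a \<beta> * b (drop (length \<beta>) \<gamma>) else 0)
      = (\<Sum>\<beta>\<in>{\<beta> \<in> supp. take (length \<beta>) \<gamma> = \<beta>}. a \<beta> * b (drop (length \<beta>) \<gamma>))"
    by (rule sum.inter_filter[symmetric]) simp
  also have "\<dots> = (\<Sum>k\<in>{k \<in> {1..length \<gamma>}. take k \<gamma> \<in> supp}. a (take k \<gamma>) * b (drop k \<gamma>))"
  proof (rule sum.reindex_bij_witness[where i = "\<lambda>k. take k \<gamma>" and j = length])
    fix \<beta> assume "\<beta> \<in> {\<beta> \<in> supp. take (length \<beta>) \<gamma> = \<beta>}"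
    then have \<beta>: "\<beta> \<in> supp" "take (length \<beta>) \<gamma> = \<beta>" by auto
    then show "take (length \<beta>) \<gamma> = \<beta>" by simp
    have "\<beta> \<noteq> []" using \<beta>(1) by auto
    moreover have "length \<beta> \<le> length \<gamma>" using \<beta>(2) by (metis length_take min.cobounded1)
    ultimately show "length \<beta> \<in> {k \<in> {1..length \<gamma>}. take k \<gamma> \<in> supp}"
      using \<beta> by (simp add: Suc_le_eq)
    show "a (take (length \<beta>) \<gamma>) * b (drop (length \<beta>) \<gamma>) = a \<beta> * b (drop (length \<beta>) \<gamma>)"
      using \<beta> by simp
  qed auto
  also have "\<dots> = (\<Sum>k\<in>{1..length \<gamma>}. a (take k \<gamma>) * b (drop k \<gamma>))"
    by (rule sum.mono_neutral_left) (auto simp: supp_def)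
  also have "\<dots> = b \<gamma>" by (rule weight_split[OF False, symmetric])
  finally show ?thesis using False by simp
qed

lemma coord_shift_word:
  "coord (blinfun_apply (W \<alpha>) x) \<gamma> = (if take (length \<alpha>) \<gamma> = \<alpha>
     then of_real (sqrt (b (drop (length \<alpha>) \<gamma>) / b \<gamma>)) * coord x (drop (length \<alpha>) \<gamma>) else 0)"
proof (induction \<alpha> arbitrary: \<gamma>)
  case Nil
  then show ?case using b_pos[of \<gamma>] by (simp add: shift_word_def del: b_pos)
next
  case (Cons i \<alpha>)
  have step: "W (i # \<alpha>) = shift a i o\<^sub>L W \<alpha>" by (simp add: shift_word_def)
  show ?case
  proof (cases \<gamma>)
    case Nil
    then show ?thesis by (simp add: step coord_shift[OF regular] shift_fun_def)
  next
    case (Cons j \<beta>)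
    have "sqrt (b \<beta> / b (i # \<beta>)) * sqrt (u / b \<beta>) = sqrt (u / b (i # \<beta>))" for u
      using b_pos[of \<beta>] by (simp add: real_sqrt_mult[symmetric] del: b_pos)
    then have "complex_of_real (sqrt (b \<beta> / b (i # \<beta>))) * (complex_of_real (sqrt (u / b \<beta>)) * v)
        = complex_of_real (sqrt (u / b (i # \<beta>))) * v" for u v
      by (metis mult.assoc of_real_mult)
    then show ?thesis
      by (simp add: step Cons coord_shift[OF regular] shift_fun_def Cons.IH)
  qed
qed

section \<open>Fourier coefficients\<close>

text \<open>The normalisation makes \<open>\<Sum> fourier T \<gamma> \<cdot> W\<^sub>\<gamma>\<close> the formal expansion of \<open>T\<close>.\<close>

definition fourier :: "'n list operator \<Rightarrow> 'n list \<Rightarrow> complex" where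
  "fourier T \<gamma> = of_real (sqrt (b \<gamma>)) * coord (blinfun_apply T (delta [])) \<gamma>"

lemma functional_on_fourier: "functional_on A (\<lambda>T. fourier T \<gamma>)"
  unfolding fourier_def by (intro functional_on_cmult functional_on_coord)

lemma fourier_word: "fourier (W \<alpha>) \<gamma> = (if \<gamma> = \<alpha> then 1 else 0)"
proof -
  have "take (length \<alpha>) \<gamma> = \<alpha> \<and> drop (length \<alpha>) \<gamma> = [] \<longleftrightarrow> \<gamma> = \<alpha>"
    by (metis append_Nil2 append_take_drop_id drop_all le_refl take_all)
  moreover have "sqrt (b \<alpha>) * sqrt (1 / b \<alpha>) = 1"
    using b_pos[of \<alpha>] by (simp add: real_sqrt_mult[symmetric] del: b_pos)
  then have "complex_of_real (sqrt (b \<alpha>)) * complex_of_real (sqrt (1 / b \<alpha>)) = 1"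
    by (metis of_real_1 of_real_mult)
  ultimately show ?thesis
    by (auto simp: fourier_def coord_shift_word delta.rep_eq)
qed

lemma norm_fourier_le: "cmod (fourier T \<gamma>) \<le> sqrt (b \<gamma>) * norm T"
  using coord_le_norm[of "blinfun_apply T (delta [])" \<gamma>] norm_blinfun[of T "delta []"]
    less_imp_le[OF b_pos[of \<gamma>]]
  by (simp add: fourier_def norm_mult mult_left_mono del: b_pos)

lemma span_subset_A: "operator.span (range W) \<subseteq> A"
  unfolding domain_algebra_def by (rule closure_subset)

lemma W_in_A [simp]: "W \<alpha> \<in> A"
  using span_subset_A operator.span_base[of "W \<alpha>" "range W"] by blast

lemma add_in_A: "S \<in> A \<Longrightarrow> T \<in> A \<Longrightarrow> S + T \<in> A"
  by (rule domain_algebra_closed(2)[OF regular])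

lemma cscale_in_A: "T \<in> A \<Longrightarrow> cscale_op c T \<in> A"
  by (rule domain_algebra_closed(3)[OF regular])

lemma diff_eq_cscale: "S - T = S + cscale_op (-1) T"
  by (intro blinfun_eqI ell2_eqI)
    (simp add: blinfun.diff_left blinfun.add_left plus_ell2.rep_eq minus_ell2.rep_eq cscale.rep_eq)

text \<open>The difference of the two functionals vanishes on the span of the \<open>W\<^sub>\<alpha>\<close>, which is dense.
  Every identity below that is linear in an operator of \<open>A\<close> is reduced to words in this way.\<close>

lemma functional_eqI:
  assumes g: "functional_on A g" and h: "functional_on A h"
    and eq: "\<And>\<alpha>. g (W \<alpha>) = h (W \<alpha>)" and T: "T \<in> A"
  shows "g T = h T"
proof -
  define d where "d = (\<lambda>T. g T + (-1) * h T)"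
  have d: "functional_on A d" unfolding d_def by (intro functional_on_add functional_on_cmult g h)
  then obtain B where B: "\<And>T. T \<in> A \<Longrightarrow> cmod (d T) \<le> B * norm T" unfolding functional_on_def by blast
  have dadd: "d (S + T) = d S + d T" if "S \<in> A" "T \<in> A" for S T
    using d that by (auto simp: functional_on_def)
  have dscale: "d (cscale_op c T) = c * d T" if "T \<in> A" for c T
    using d that by (auto simp: functional_on_def)
  have span: "S \<in> A \<and> d S = 0" if "S \<in> operator.span (range W)" for S
    using that
  proof (induction rule: operator.span_induct_alt)
    case base
    have "cscale_op 0 (W []) = 0" by (rule operator.scale_zero_left)
    then show ?case using dscale[of "W []" 0] cscale_in_A[of "W []" 0] by auto
  next
    case (step c S S')
    then have "S \<in> A" "d S = 0" using eq by (auto simp: d_def)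
    then show ?case using step by (simp add: dadd dscale add_in_A cscale_in_A)
  qed
  obtain t where t: "\<And>n. t n \<in> operator.span (range W)" "t \<longlonglongrightarrow> T"
    using T by (auto simp: domain_algebra_def closure_sequential)
  have bound: "cmod (d T) \<le> B * norm (T - t n)" for n
  proof -
    have tn: "t n \<in> A" "d (t n) = 0" using span[OF t(1)[of n]] by auto
    have "d (T - t n) = d T"
      unfolding diff_eq_cscale
      by (simp only: dadd[OF T cscale_in_A[OF tn(1)]] dscale[OF tn(1)] tn(2) mult_zero_right add_0_right)
    moreover have "T - t n \<in> A" unfolding diff_eq_cscale by (intro add_in_A cscale_in_A T tn)
    ultimately show ?thesis using B by metis
  qed
  have "(\<lambda>n. B * norm (T - t n)) \<longlonglongrightarrow> B * norm (T - T)"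
    by (intro tendsto_intros t)
  then have "cmod (d T) \<le> B * norm (T - T)"
    by (rule Lim_bounded2[where N = 0]) (use bound in simp_all)
  then show ?thesis by (simp add: d_def)
qed

text \<open>An operator of \<open>A\<close> acts as the convolution with its Fourier coefficients. Consequently it is
  complex linear, it is determined by these coefficients, and they multiply like those of formal power
  series.\<close>

lemma coord_apply:
  assumes "T \<in> A"
  shows "coord (blinfun_apply T x) \<gamma> = (\<Sum>k\<le>length \<gamma>.
     fourier T (take k \<gamma>) * (of_real (sqrt (b (drop k \<gamma>) / b \<gamma>)) * coord x (drop k \<gamma>)))"
proof (rule functional_eqI[where T = T, OF functional_on_coord _ _ assms])
  show "functional_on A (\<lambda>T. \<Sum>k\<le>length \<gamma>. fourier T (take k \<gamma>) *
      (of_real (sqrt (b (drop k \<gamma>) / b \<gamma>)) * coord x (drop k \<gamma>)))"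
    by (subst mult.commute) (intro functional_on_sum functional_on_cmult functional_on_fourier)
  fix \<alpha>
  have "(\<Sum>k\<le>length \<gamma>. fourier (W \<alpha>) (take k \<gamma>) *
      (of_real (sqrt (b (drop k \<gamma>) / b \<gamma>)) * coord x (drop k \<gamma>)))
     = (\<Sum>k\<le>length \<gamma>. if length \<alpha> = k then (if take (length \<alpha>) \<gamma> = \<alpha>
      then of_real (sqrt (b (drop (length \<alpha>) \<gamma>) / b \<gamma>)) * coord x (drop (length \<alpha>) \<gamma>) else 0) else 0)"
    by (intro sum.cong) (auto simp: fourier_word)
  also have "\<dots> = coord (blinfun_apply (W \<alpha>) x) \<gamma>"
    unfolding coord_shift_word by auto
  finally show "coord (blinfun_apply (W \<alpha>) x) \<gamma> = (\<Sum>k\<le>length \<gamma>. fourier (W \<alpha>) (take k \<gamma>) *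
      (of_real (sqrt (b (drop k \<gamma>) / b \<gamma>)) * coord x (drop k \<gamma>)))" by simp
qed

lemma A_cscale:
  assumes "T \<in> A" shows "blinfun_apply T (cscale c x) = cscale c (blinfun_apply T x)"
  by (rule ell2_eqI) (simp add: coord_apply[OF assms] cscale.rep_eq sum_distrib_left mult_ac)

lemma fourier_inject:
  assumes "S \<in> A" "T \<in> A" "\<And>\<gamma>. fourier S \<gamma> = fourier T \<gamma>"
  shows "S = T"
  by (intro blinfun_eqI ell2_eqI) (simp add: coord_apply assms)

lemma fourier_mult:
  assumes "S \<in> A"
  shows "fourier (S o\<^sub>L T) \<gamma> = (\<Sum>k\<le>length \<gamma>. fourier S (take k \<gamma>) * fourier T (drop k \<gamma>))"
proof -
  have "sqrt (b \<gamma>) * sqrt (u / b \<gamma>) = sqrt u" for u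
    using b_pos[of \<gamma>] by (simp add: real_sqrt_mult[symmetric] del: b_pos)
  then have "complex_of_real (sqrt (b \<gamma>)) * (v * (complex_of_real (sqrt (u / b \<gamma>)) * w))
      = v * (of_real (sqrt u) * w)" for u v w
    by (metis mult.assoc mult.left_commute of_real_mult)
  note eq = this
  show ?thesis
    by (simp only: fourier_def[of "S o\<^sub>L T"] coord_apply[OF assms] sum_distrib_left fourier_def[of T]
        blinfun_compose.rep_eq o_apply eq)
qed

lemma fourier_id: "fourier id_blinfun \<gamma> = (if \<gamma> = [] then 1 else 0)"
  using fourier_word[of "[]" \<gamma>] by (simp add: shift_word_def)

text \<open>The coordinate of the left-hand side at \<open>\<gamma>\<close> is a sum over the prefixes \<open>\<alpha>\<close> of \<open>\<gamma>\<close>, say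
  \<open>\<gamma> = \<alpha>\<delta>\<close>, with coefficients \<open>\<surd>(a\<^sub>\<alpha> b\<^sub>\<delta> / b\<^sub>\<gamma>)\<close>. The squares of these coefficients have sum at
  most \<open>1\<close> by the recursion for the weights, so the Cauchy-Schwarz inequality applies.\<close>

lemma row_contraction:
  "(norm (\<Sum>\<alpha>\<in>supp. sqrt (a \<alpha>) *\<^sub>R blinfun_apply (W \<alpha>) (x \<alpha>)))\<^sup>2 \<le> (\<Sum>\<alpha>\<in>supp. (norm (x \<alpha>))\<^sup>2)"
proof -
  let ?R = "\<Sum>\<alpha>\<in>supp. sqrt (a \<alpha>) *\<^sub>R blinfun_apply (W \<alpha>) (x \<alpha>)"
  let ?pre = "\<lambda>\<alpha> \<gamma>. take (length \<alpha>) \<gamma> = \<alpha>"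
  let ?c = "\<lambda>\<alpha> \<gamma>. if ?pre \<alpha> \<gamma> then (cmod (coord (x \<alpha>) (drop (length \<alpha>) \<gamma>)))\<^sup>2 else 0"
  define M where "M = (\<Sum>\<alpha>\<in>supp. (norm (x \<alpha>))\<^sup>2)"
  have M: "M \<ge> 0" unfolding M_def by (intro sum_nonneg) simp
  have coordinate: "(cmod (coord ?R \<gamma>))\<^sup>2 \<le> (\<Sum>\<alpha>\<in>supp. ?c \<alpha> \<gamma>)" for \<gamma>
  proof -
    define u where "u \<alpha> = (if ?pre \<alpha> \<gamma> then sqrt (a \<alpha>) * sqrt (b (drop (length \<alpha>) \<gamma>) / b \<gamma>) else 0)" for \<alpha>
    define v where "v \<alpha> = (if ?pre \<alpha> \<gamma> then cmod (coord (x \<alpha>) (drop (length \<alpha>) \<gamma>)) else 0)" for \<alpha>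
    have "cmod (coord ?R \<gamma>) \<le> (\<Sum>\<alpha>\<in>supp. u \<alpha> * v \<alpha>)"
      unfolding coord_sum
    proof (rule sum_norm_le)
      fix \<alpha>
      show "cmod (coord (sqrt (a \<alpha>) *\<^sub>R blinfun_apply (W \<alpha>) (x \<alpha>)) \<gamma>) \<le> u \<alpha> * v \<alpha>"
        using less_imp_le[OF b_pos[of \<gamma>]] less_imp_le[OF b_pos[of "drop (length \<alpha>) \<gamma>"]]
        by (simp add: scaleR_ell2.rep_eq coord_shift_word norm_mult u_def v_def del: b_pos)
    qed
    then have "(cmod (coord ?R \<gamma>))\<^sup>2 \<le> (\<Sum>\<alpha>\<in>supp. u \<alpha> * v \<alpha>)\<^sup>2"
      by (rule power_mono) simp
    also have "\<dots> \<le> (\<Sum>\<alpha>\<in>supp. (u \<alpha>)\<^sup>2) * (\<Sum>\<alpha>\<in>supp. (v \<alpha>)\<^sup>2)"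
      by (rule Cauchy_Schwarz_ineq_sum)
    also have "\<dots> \<le> 1 * (\<Sum>\<alpha>\<in>supp. (v \<alpha>)\<^sup>2)"
    proof (intro mult_right_mono sum_nonneg)
      have "(\<Sum>\<alpha>\<in>supp. (u \<alpha>)\<^sup>2)
          = (\<Sum>\<alpha>\<in>supp. if ?pre \<alpha> \<gamma> then a \<alpha> * b (drop (length \<alpha>) \<gamma>) else 0) / b \<gamma>"
        unfolding sum_divide_distrib
        by (intro sum.cong refl) (simp add: u_def power_mult_distrib less_imp_le)
      also have "\<dots> \<le> b \<gamma> / b \<gamma>"
        using weight_recursion[of \<gamma>] b_pos[of \<gamma>] by (intro divide_right_mono) (auto split: if_splits)
      also have "\<dots> = 1" using b_pos[of \<gamma>] by (simp del: b_pos)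
      finally show "(\<Sum>\<alpha>\<in>supp. (u \<alpha>)\<^sup>2) \<le> 1" .
    qed simp
    also have "\<dots> = (\<Sum>\<alpha>\<in>supp. ?c \<alpha> \<gamma>)"
      unfolding mult_1_left by (intro sum.cong refl) (simp add: v_def)
    finally show ?thesis .
  qed
  have "norm ?R \<le> sqrt M"
  proof (rule norm_le_if_square_sums)
    fix F :: "'n list set" assume F: "finite F"
    have "(\<Sum>\<gamma>\<in>F. (cmod (coord ?R \<gamma>))\<^sup>2)
        \<le> (\<Sum>\<gamma>\<in>F. \<Sum>\<alpha>\<in>supp. ?c \<alpha> \<gamma>)"
      by (rule sum_mono) (rule coordinate)
    also have "\<dots> = (\<Sum>\<alpha>\<in>supp. \<Sum>\<gamma>\<in>F. ?c \<alpha> \<gamma>)"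
      by (rule sum.swap)
    also have "\<dots> \<le> M"
      unfolding M_def
    proof (rule sum_mono)
      fix \<alpha>
      have "(\<Sum>\<gamma>\<in>F. ?c \<alpha> \<gamma>)
          \<le> (\<Sum>\<gamma>\<in>drop (length \<alpha>) ` F. (cmod (coord (x \<alpha>) \<gamma>))\<^sup>2)"
        by (rule sum_prefix_le) (use F in auto)
      also have "\<dots> \<le> (norm (x \<alpha>))\<^sup>2"
        by (rule square_sum_coord_le) (use F in simp)
      finally show "(\<Sum>\<gamma>\<in>F. ?c \<alpha> \<gamma>)
          \<le> (norm (x \<alpha>))\<^sup>2" .
    qed
    finally show "(\<Sum>\<gamma>\<in>F. (cmod (coord ?R \<gamma>))\<^sup>2) \<le> (sqrt M)\<^sup>2" using M by simp
  qed (use M in simp)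
  then have "(norm ?R)\<^sup>2 \<le> (sqrt M)\<^sup>2" by (rule power_mono) simp
  then show ?thesis using M by (simp add: M_def)
qed

section \<open>The reproducing kernel\<close>

definition form :: "('n \<Rightarrow> complex) \<Rightarrow> ('n \<Rightarrow> complex) \<Rightarrow> complex" where
  "form z w = (\<Sum>\<alpha>\<in>supp. of_real (a \<alpha>) * word_eval z \<alpha> * cnj (word_eval w \<alpha>))"

definition defect :: "('n \<Rightarrow> complex) \<Rightarrow> ('n \<Rightarrow> complex) \<Rightarrow> complex" where
  "defect z w = 1 - form z w"

text \<open>The points where \<open>f\<close>, evaluated at the squared moduli of the coordinates, is less than \<open>1\<close>.\<close>

definition dom :: "('n \<Rightarrow> complex) set" where
  "dom = {z. (\<Sum>\<alpha>\<in>supp. a \<alpha> * (cmod (word_eval z \<alpha>))\<^sup>2) < 1}"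

lemma form_self: "form z z = of_real (\<Sum>\<alpha>\<in>supp. a \<alpha> * (cmod (word_eval z \<alpha>))\<^sup>2)"
  unfolding form_def of_real_sum
  by (intro sum.cong refl) (simp only: of_real_mult complex_norm_square mult.assoc)

lemma dom_iff: "z \<in> dom \<longleftrightarrow> Re (form z z) < 1"
  by (simp add: dom_def form_self)

lemma form_cnj: "cnj (form z w) = form w z"
  unfolding form_def cnj_sum by (intro sum.cong refl) (simp add: mult_ac)

lemma defect_cnj: "cnj (defect z w) = defect w z"
  by (simp add: defect_def form_cnj)

lemma form_zero [simp]: "form z (\<lambda>_. 0) = 0" "form (\<lambda>_. 0) z = 0"
proof -
  have "form z (\<lambda>_. 0) = 0" for z
    unfolding form_def
  proof (intro sum.neutral ballI)
    fix \<alpha> assume "\<alpha> \<in> supp"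
    then have "\<alpha> \<noteq> []" using Nil_notin_support by blast
    then show "of_real (a \<alpha>) * word_eval z \<alpha> * cnj (word_eval (\<lambda>_. 0) \<alpha>) = 0"
      by (simp add: word_eval_zero)
  qed
  then show "form z (\<lambda>_. 0) = 0" "form (\<lambda>_. 0) z = 0"
    using form_cnj[of z "\<lambda>_. 0"] by auto
qed

lemma defect_zero [simp]: "defect z (\<lambda>_. 0) = 1" "defect (\<lambda>_. 0) z = 1"
  by (simp_all add: defect_def)

lemma zero_in_dom [simp]: "(\<lambda>_. 0) \<in> dom"
  by (simp add: dom_iff)

text \<open>The Cauchy-Schwarz inequality for the vectors \<open>(\<surd>a\<^sub>\<alpha> z\<^sub>\<alpha>)\<close>. It keeps \<open>defect\<close> away
  from zero on \<open>dom\<close>, so that its reciprocal is defined there.\<close>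

lemma norm_form_square_le: "(cmod (form z w))\<^sup>2 \<le> Re (form z z) * Re (form w w)"
proof -
  have "cmod (form z w) \<le> (\<Sum>\<alpha>\<in>supp. (sqrt (a \<alpha>) * cmod (word_eval z \<alpha>)) * (sqrt (a \<alpha>) * cmod (word_eval w \<alpha>)))"
    unfolding form_def
  proof (rule sum_norm_le)
    fix \<alpha>
    have "a \<alpha> * (u * v) = (sqrt (a \<alpha>) * u) * (sqrt (a \<alpha>) * v)" for u v
      using real_sqrt_mult_self[of "a \<alpha>"] by (simp add: algebra_simps)
    note eq = this
    show "cmod (of_real (a \<alpha>) * word_eval z \<alpha> * cnj (word_eval w \<alpha>))
        \<le> (sqrt (a \<alpha>) * cmod (word_eval z \<alpha>)) * (sqrt (a \<alpha>) * cmod (word_eval w \<alpha>))"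
      unfolding eq[symmetric] by (simp add: norm_mult)
  qed
  then have "(cmod (form z w))\<^sup>2 \<le> (\<Sum>\<alpha>\<in>supp. (sqrt (a \<alpha>) * cmod (word_eval z \<alpha>)) * (sqrt (a \<alpha>) * cmod (word_eval w \<alpha>)))\<^sup>2"
    by (rule power_mono) simp
  also have "\<dots> \<le> (\<Sum>\<alpha>\<in>supp. (sqrt (a \<alpha>) * cmod (word_eval z \<alpha>))\<^sup>2) * (\<Sum>\<alpha>\<in>supp. (sqrt (a \<alpha>) * cmod (word_eval w \<alpha>))\<^sup>2)"
    by (rule Cauchy_Schwarz_ineq_sum)
  also have "\<dots> = Re (form z z) * Re (form w w)"
    by (simp add: form_self power_mult_distrib)
  finally show ?thesis .
qed

lemma form_self_nonneg: "Re (form z z) \<ge> 0"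
  unfolding form_self by (simp add: sum_nonneg)

lemma defect_nonzero:
  assumes "z \<in> dom" "w \<in> dom" shows "defect z w \<noteq> 0"
proof
  assume "defect z w = 0"
  then have "form z w = 1" by (simp add: defect_def)
  then have "1 \<le> Re (form z z) * Re (form w w)" using norm_form_square_le[of z w] by simp
  moreover have "Re (form z z) * Re (form w w) \<le> Re (form z z) * 1"
    using assms(2) by (intro mult_left_mono form_self_nonneg) (simp add: dom_iff)
  ultimately show False using assms(1) by (simp add: dom_iff)
qed

lemma defect_self: "defect z z = of_real (Re (defect z z))"
  by (simp add: defect_def form_self)

lemma defect_self_pos: "z \<in> dom \<Longrightarrow> Re (defect z z) > 0"
  by (simp add: defect_def dom_iff)

lemma form_scale_le:
  assumes "\<bar>t\<bar> \<le> 1"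
  shows "Re (form (\<lambda>i. of_real t * z i) (\<lambda>i. of_real t * z i)) \<le> t\<^sup>2 * Re (form z z)"
proof -
  have scale: "cmod (word_eval (\<lambda>i. of_real t * z i) \<alpha>) = \<bar>t\<bar> ^ length \<alpha> * cmod (word_eval z \<alpha>)" for \<alpha>
    by (induction \<alpha>) (simp_all add: norm_mult)
  have "a \<alpha> * (\<bar>t\<bar> ^ length \<alpha> * cmod (word_eval z \<alpha>))\<^sup>2 \<le> t\<^sup>2 * (a \<alpha> * (cmod (word_eval z \<alpha>))\<^sup>2)"
    if "\<alpha> \<in> supp" for \<alpha>
  proof -
    have "\<alpha> \<noteq> []" using that by auto
    then have "\<bar>t\<bar> ^ length \<alpha> \<le> \<bar>t\<bar> ^ 1" using assms by (intro power_decreasing) (auto simp: Suc_le_eq)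
    then have "(\<bar>t\<bar> ^ length \<alpha>)\<^sup>2 \<le> \<bar>t\<bar>\<^sup>2" using assms by (intro power_mono) auto
    then have "(\<bar>t\<bar> ^ length \<alpha>)\<^sup>2 * (a \<alpha> * (cmod (word_eval z \<alpha>))\<^sup>2) \<le> \<bar>t\<bar>\<^sup>2 * (a \<alpha> * (cmod (word_eval z \<alpha>))\<^sup>2)"
      by (rule mult_right_mono) simp
    then show ?thesis by (simp add: power_mult_distrib mult_ac)
  qed
  then show ?thesis
    unfolding form_self Re_complex_of_real scale sum_distrib_left by (rule sum_mono)
qed

lemma scale_in_dom:
  obtains t0 where "t0 > 0" "\<And>t. 0 \<le> t \<Longrightarrow> t \<le> t0 \<Longrightarrow> (\<lambda>i. of_real t * z i) \<in> dom"
proof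
  let ?p = "Re (form z z)"
  have p: "?p \<ge> 0" by (rule form_self_nonneg)
  show "1 / (1 + ?p) > 0" using p by simp
  fix t assume t: "0 \<le> t" "t \<le> 1 / (1 + ?p)"
  have "1 / (1 + ?p) \<le> 1" using p by simp
  with t have t1: "t \<le> 1" by linarith
  have "t\<^sup>2 * ?p \<le> t * ?p"
    using t(1) t1 p by (intro mult_right_mono) (auto simp: power2_eq_square mult_left_le)
  also have "\<dots> \<le> 1 / (1 + ?p) * ?p" using t p by (intro mult_right_mono) auto
  also have "\<dots> < 1" using p by (simp add: field_simps)
  finally show "(\<lambda>i. of_real t * z i) \<in> dom"
    using form_scale_le[of t z] t t1 by (simp add: dom_iff)
qed

lemma dom_scale:
  assumes "z \<in> dom" "\<bar>t\<bar> \<le> 1" shows "(\<lambda>i. of_real t * z i) \<in> dom"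
proof -
  have "t\<^sup>2 * Re (form z z) \<le> 1 * Re (form z z)"
    using assms(2) by (intro mult_right_mono form_self_nonneg) (simp add: abs_square_le_1)
  then show ?thesis using form_scale_le[OF assms(2), of z] assms(1) by (simp add: dom_iff)
qed

text \<open>The vectors \<open>kvec z\<close> are the eigenvectors of the adjoints of the \<open>W\<^sub>\<alpha>\<close>, up to conjugation.\<close>

definition kvec :: "('n \<Rightarrow> complex) \<Rightarrow> 'n list ell2" where
  "kvec z = Abs_ell2 (\<lambda>\<alpha>. of_real (sqrt (b \<alpha>)) * word_eval z \<alpha>)"

text \<open>Over the words of length at most \<open>N\<close>, the recursion \<open>b = 1 + f b\<close> gives \<open>S \<le> 1 + P(z, z) S\<close>
  for the sum \<open>S\<close>: removing a prefix does not make a word longer.\<close>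

lemma weighted_square_sum_le:
  assumes z: "z \<in> dom" and F: "finite F"
  shows "(\<Sum>\<gamma>\<in>F. b \<gamma> * (cmod (word_eval z \<gamma>))\<^sup>2) \<le> 1 / (1 - Re (form z z))"
proof -
  let ?k = "\<lambda>\<beta>. a \<beta> * (cmod (word_eval z \<beta>))\<^sup>2"
  define g where "g \<gamma> = b \<gamma> * (cmod (word_eval z \<gamma>))\<^sup>2" for \<gamma>
  let ?p = "Re (form z z)"
  have g0: "g \<gamma> \<ge> 0" for \<gamma> by (simp add: g_def less_imp_le)
  define U where "U = {\<gamma> :: 'n list. length \<gamma> \<le> Max (insert 0 (length ` F))}"
  have finU: "finite U"
    using finite_lists_length_le[of "UNIV :: 'n set"] by (simp add: U_def)
  have FU: "F \<subseteq> U" using F by (auto simp: U_def)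
  have rec: "g \<gamma> = (if \<gamma> = [] then 1 else 0) + (\<Sum>\<beta>\<in>supp. ?k \<beta> *
      (if take (length \<beta>) \<gamma> = \<beta> then g (drop (length \<beta>) \<gamma>) else 0))" for \<gamma>
  proof -
    have "g \<gamma> = (if \<gamma> = [] then 1 else 0) * (cmod (word_eval z \<gamma>))\<^sup>2 + (\<Sum>\<beta>\<in>supp.
        (if take (length \<beta>) \<gamma> = \<beta> then a \<beta> * b (drop (length \<beta>) \<gamma>) else 0) * (cmod (word_eval z \<gamma>))\<^sup>2)"
      unfolding g_def by (subst weight_recursion) (simp only: distrib_right sum_distrib_right)
    also have "(if \<gamma> = [] then 1 else 0) * (cmod (word_eval z \<gamma>))\<^sup>2 = (if \<gamma> = [] then 1 else 0)"
      by simp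
    also have "(\<Sum>\<beta>\<in>supp. (if take (length \<beta>) \<gamma> = \<beta> then a \<beta> * b (drop (length \<beta>) \<gamma>) else 0) * (cmod (word_eval z \<gamma>))\<^sup>2)
      = (\<Sum>\<beta>\<in>supp. ?k \<beta> *
      (if take (length \<beta>) \<gamma> = \<beta> then g (drop (length \<beta>) \<gamma>) else 0))"
    proof (rule sum.cong[OF refl])
      fix \<beta>
      show "(if take (length \<beta>) \<gamma> = \<beta> then a \<beta> * b (drop (length \<beta>) \<gamma>) else 0) * (cmod (word_eval z \<gamma>))\<^sup>2
        = ?k \<beta> * (if take (length \<beta>) \<gamma> = \<beta> then g (drop (length \<beta>) \<gamma>) else 0)"
      proof (cases "take (length \<beta>) \<gamma> = \<beta>")
        case True
        show ?thesis
          unfolding word_eval_prefix[OF True] g_def using True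
          by (simp add: norm_mult power_mult_distrib mult_ac)
      qed simp
    qed
    finally show ?thesis .
  qed
  have "sum g U = (\<Sum>\<gamma>\<in>U. if \<gamma> = [] then 1 else 0) + (\<Sum>\<gamma>\<in>U. \<Sum>\<beta>\<in>supp. ?k \<beta> *
      (if take (length \<beta>) \<gamma> = \<beta> then g (drop (length \<beta>) \<gamma>) else 0))"
    by (subst sum.distrib[symmetric]) (rule sum.cong[OF refl rec])
  also have "(\<Sum>\<gamma>\<in>U. if \<gamma> = [] then 1 else 0) = (1 :: real)"
    using finU by (simp add: U_def)
  also have "(\<Sum>\<gamma>\<in>U. \<Sum>\<beta>\<in>supp. ?k \<beta> *
      (if take (length \<beta>) \<gamma> = \<beta> then g (drop (length \<beta>) \<gamma>) else 0))
    = (\<Sum>\<beta>\<in>supp. ?k \<beta> *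
      (\<Sum>\<gamma>\<in>U. if take (length \<beta>) \<gamma> = \<beta> then g (drop (length \<beta>) \<gamma>) else 0))"
    by (subst sum.swap) (simp only: sum_distrib_left)
  also have "\<dots> \<le> (\<Sum>\<beta>\<in>supp. ?k \<beta> * sum g U)"
    by (intro sum_mono mult_left_mono sum_prefix_le finU g0) (auto simp: U_def)
  also have "\<dots> = ?p * sum g U"
    by (simp add: form_self sum_distrib_right)
  finally have "(1 - ?p) * sum g U \<le> 1" by (simp add: algebra_simps)
  moreover have "1 - ?p > 0" using z by (simp add: dom_iff)
  ultimately have "sum g U \<le> 1 / (1 - ?p)" by (simp add: field_simps)
  moreover have "sum g F \<le> sum g U" by (rule sum_mono2[OF finU FU]) (rule g0)
  ultimately show ?thesis unfolding g_def by linarith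
qed

lemma coord_kvec:
  assumes z: "z \<in> dom"
  shows "coord (kvec z) \<alpha> = of_real (sqrt (b \<alpha>)) * word_eval z \<alpha>"
proof -
  have "square_summable (\<lambda>\<alpha>. of_real (sqrt (b \<alpha>)) * word_eval z \<alpha>)"
  proof (rule square_summableI)
    fix F :: "'n list set" assume F: "finite F"
    show "L2_set (\<lambda>\<alpha>. cmod (of_real (sqrt (b \<alpha>)) * word_eval z \<alpha>)) F \<le> sqrt (1 / (1 - Re (form z z)))"
      using weighted_square_sum_le[OF z F]
      by (simp add: L2_set_def norm_mult power_mult_distrib less_imp_le)
  qed
  then show ?thesis by (simp add: kvec_def Abs_ell2_inverse)
qed

text \<open>Now that the series converges absolutely, its sum \<open>K\<close> satisfies \<open>K = 1 + P(z, w) K\<close>, again by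
  the recursion for the weights.\<close>

lemma kernel_inverse:
  assumes z: "z \<in> dom" and w: "w \<in> dom"
  shows "pair (kvec z) (cnj_vec (kvec w)) * defect z w = 1"
proof -
  let ?k = "\<lambda>\<beta>. of_real (a \<beta>) * word_eval z \<beta> * cnj (word_eval w \<beta>)"
  define h where "h \<gamma> = of_real (b \<gamma>) * (word_eval z \<gamma> * cnj (word_eval w \<gamma>))" for \<gamma>
  define K where "K = pair (kvec z) (cnj_vec (kvec w))"
  have sq: "complex_of_real (sqrt (b \<gamma>)) * complex_of_real (sqrt (b \<gamma>)) = of_real (b \<gamma>)" for \<gamma>
    unfolding of_real_mult[symmetric] using less_imp_le[OF b_pos[of \<gamma>]] by simp
  have "coord (kvec z) \<gamma> * coord (cnj_vec (kvec w)) \<gamma> = h \<gamma>" for \<gamma>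
    unfolding h_def sq[symmetric] by (simp add: coord_kvec z w cnj_vec.rep_eq mult_ac)
  then have hK: "(h has_sum K) UNIV"
    using pair_has_sum[of "kvec z" "cnj_vec (kvec w)"] by (simp add: K_def)
  have rec: "h \<gamma> = (if \<gamma> = [] then 1 else 0) + (\<Sum>\<beta>\<in>supp. ?k \<beta> *
      (if take (length \<beta>) \<gamma> = \<beta> then h (drop (length \<beta>) \<gamma>) else 0))" for \<gamma>
  proof -
    let ?e = "word_eval z \<gamma> * cnj (word_eval w \<gamma>)"
    have "of_real (b \<gamma>) = (if \<gamma> = [] then 1 else 0) + (\<Sum>\<beta>\<in>supp.
        if take (length \<beta>) \<gamma> = \<beta> then complex_of_real (a \<beta> * b (drop (length \<beta>) \<gamma>)) else 0)"
      by (subst weight_recursion) (simp add: if_distrib[of complex_of_real] cong: if_cong)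
    then have "h \<gamma> = (if \<gamma> = [] then 1 else 0) * ?e + (\<Sum>\<beta>\<in>supp.
        (if take (length \<beta>) \<gamma> = \<beta> then complex_of_real (a \<beta> * b (drop (length \<beta>) \<gamma>)) else 0) * ?e)"
      unfolding h_def by (simp only: distrib_right sum_distrib_right)
    also have "(if \<gamma> = [] then 1 else 0) * ?e = (if \<gamma> = [] then 1 else 0)"
      by simp
    also have "(\<Sum>\<beta>\<in>supp. (if take (length \<beta>) \<gamma> = \<beta> then complex_of_real (a \<beta> * b (drop (length \<beta>) \<gamma>)) else 0) * ?e)
      = (\<Sum>\<beta>\<in>supp. ?k \<beta> *
      (if take (length \<beta>) \<gamma> = \<beta> then h (drop (length \<beta>) \<gamma>) else 0))"
    proof (rule sum.cong[OF refl])
      fix \<beta>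
      show "(if take (length \<beta>) \<gamma> = \<beta> then complex_of_real (a \<beta> * b (drop (length \<beta>) \<gamma>)) else 0) * ?e
        = ?k \<beta> *
          (if take (length \<beta>) \<gamma> = \<beta> then h (drop (length \<beta>) \<gamma>) else 0)"
      proof (cases "take (length \<beta>) \<gamma> = \<beta>")
        case True
        show ?thesis
          unfolding word_eval_prefix[OF True] h_def using True by (simp add: mult_ac)
      qed simp
    qed
    finally show ?thesis .
  qed
  have "((\<lambda>\<gamma>. (if \<gamma> = [] then 1 else 0) + (\<Sum>\<beta>\<in>supp. ?k \<beta> *
      (if take (length \<beta>) \<gamma> = \<beta> then h (drop (length \<beta>) \<gamma>) else 0))) has_sum
      (1 + (\<Sum>\<beta>\<in>supp. ?k \<beta> * K))) UNIV"
  proof (intro has_sum_add has_sum_sum_finite has_sum_cmult_right has_sum_prefix hK)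
    have "((\<lambda>\<gamma>. if \<gamma> = [] then 1 else 0) has_sum (1::complex)) {[] :: 'n list}"
      by (rule has_sum_finiteI) auto
    then show "((\<lambda>\<gamma> :: 'n list. if \<gamma> = [] then 1 else 0) has_sum (1::complex)) UNIV"
      by (subst has_sum_cong_neutral[where T = "{[]}"]) auto
  qed
  then have "(h has_sum (1 + form z w * K)) UNIV"
    unfolding form_def sum_distrib_right rec[symmetric] .
  then have "K = 1 + form z w * K" using hK has_sum_unique by blast
  then show ?thesis unfolding K_def[symmetric] defect_def by (simp add: algebra_simps)
qed

definition character :: "('n \<Rightarrow> complex) \<Rightarrow> 'n list operator \<Rightarrow> complex" where
  "character z T = pair (kvec z) (blinfun_apply T (delta []))"

lemma pair_kvec_word:
  assumes z: "z \<in> dom"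
  shows "pair (kvec z) (blinfun_apply (W \<alpha>) x) = word_eval z \<alpha> * pair (kvec z) x"
proof (rule has_sum_unique[OF pair_has_sum])
  have "((\<lambda>\<gamma>. if take (length \<alpha>) \<gamma> = \<alpha> then word_eval z \<alpha> * (coord (kvec z) (drop (length \<alpha>) \<gamma>) * coord x (drop (length \<alpha>) \<gamma>)) else 0)
      has_sum (word_eval z \<alpha> * pair (kvec z) x)) UNIV"
    by (rule has_sum_prefix[of "\<lambda>\<delta>. word_eval z \<alpha> * (coord (kvec z) \<delta> * coord x \<delta>)"])
      (rule has_sum_cmult_right[OF pair_has_sum])
  moreover have "coord (kvec z) \<gamma> * coord (blinfun_apply (W \<alpha>) x) \<gamma> = (if take (length \<alpha>) \<gamma> = \<alpha>
      then word_eval z \<alpha> * (coord (kvec z) (drop (length \<alpha>) \<gamma>) * coord x (drop (length \<alpha>) \<gamma>)) else 0)" for \<gamma>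
  proof (cases "take (length \<alpha>) \<gamma> = \<alpha>")
    case True
    have "sqrt (b \<gamma>) * sqrt (b (drop (length \<alpha>) \<gamma>) / b \<gamma>) = sqrt (b (drop (length \<alpha>) \<gamma>))"
      using b_pos[of \<gamma>] by (simp add: real_sqrt_mult[symmetric] del: b_pos)
    then have "complex_of_real (sqrt (b \<gamma>)) * complex_of_real (sqrt (b (drop (length \<alpha>) \<gamma>) / b \<gamma>))
        = of_real (sqrt (b (drop (length \<alpha>) \<gamma>)))" by (metis of_real_mult)
    then show ?thesis
      using True word_eval_prefix[OF True, of z]
      by (simp add: coord_kvec[OF z] coord_shift_word mult_ac)
  qed (simp add: coord_shift_word)
  ultimately show "((\<lambda>\<gamma>. coord (kvec z) \<gamma> * coord (blinfun_apply (W \<alpha>) x) \<gamma>)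
      has_sum (word_eval z \<alpha> * pair (kvec z) x)) UNIV" by simp
qed

lemma pair_kvec_delta_Nil: "z \<in> dom \<Longrightarrow> pair (kvec z) (delta []) = 1"
  by (simp add: pair_delta coord_kvec)

lemma functional_on_character: "functional_on A (character z)"
  unfolding character_def by (rule functional_on_pair)

lemma character_word: "z \<in> dom \<Longrightarrow> character z (W \<alpha>) = word_eval z \<alpha>"
  by (simp add: character_def pair_kvec_word pair_kvec_delta_Nil)

lemma pair_kvec_apply:
  assumes z: "z \<in> dom" and T: "T \<in> A"
  shows "pair (kvec z) (blinfun_apply T x) = character z T * pair (kvec z) x"
proof (rule functional_eqI[where T = T, OF functional_on_pair _ _ T])
  show "functional_on A (\<lambda>T. character z T * pair (kvec z) x)"
    by (subst mult.commute) (intro functional_on_cmult functional_on_character)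
qed (simp add: character_word pair_kvec_word z)

lemma character_mult:
  assumes "z \<in> dom" "S \<in> A"
  shows "character z (S o\<^sub>L T) = character z S * character z T"
  using pair_kvec_apply[OF assms] by (simp add: character_def[of z "S o\<^sub>L T"] character_def[of z T])

lemma character_zero: "character (\<lambda>_. 0) T = fourier T []"
proof -
  have "kvec (\<lambda>_. 0) = delta []"
    by (rule ell2_eqI) (auto simp: coord_kvec delta.rep_eq word_eval_zero)
  moreover have "pair (delta []) x = coord x []" for x :: "'n list ell2"
  proof -
    have "pair x y = pair y x" for x y :: "'n list ell2" by (simp add: pair_def mult.commute)
    then show ?thesis by (metis pair_delta)
  qed
  ultimately show ?thesis by (simp add: character_def fourier_def)
qed

end

section \<open>Positive kernels with a positive reciprocal\<close>

lemma quadratic_small: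
  fixes p q :: real
  assumes "\<And>t. t > 0 \<Longrightarrow> 2 * t * p \<le> t\<^sup>2 * q"
  shows "p \<le> 0"
proof (rule ccontr)
  assume p: "\<not> p \<le> 0"
  define t where "t = p / (\<bar>q\<bar> + 1)"
  have t: "t > 0" using p by (simp add: t_def)
  have "t * (2 * p) \<le> t * (t * q)" using assms[OF t] by (simp add: power2_eq_square mult_ac)
  then have "2 * p \<le> t * q" using t by simp
  also have "\<dots> \<le> t * (\<bar>q\<bar> + 1)" using t by (intro mult_left_mono) auto
  also have "\<dots> = p" by (simp add: t_def)
  finally show False using p by simp
qed

text \<open>The index sets are sets of natural numbers, so that points may be repeated.\<close>

definition positive_kernel :: "'x set \<Rightarrow> ('x \<Rightarrow> 'x \<Rightarrow> complex) \<Rightarrow> bool" where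
  "positive_kernel X \<kappa> \<longleftrightarrow> (\<forall>x\<in>X. \<forall>y\<in>X. cnj (\<kappa> x y) = \<kappa> y x) \<and>
     (\<forall>I z \<mu>. finite (I :: nat set) \<longrightarrow> (\<forall>i\<in>I. z i \<in> X) \<longrightarrow>
        0 \<le> Re (\<Sum>i\<in>I. \<Sum>j\<in>I. \<mu> i * cnj (\<mu> j) * \<kappa> (z i) (z j)))"

lemma positive_kernel_cnj:
  "positive_kernel X \<kappa> \<Longrightarrow> x \<in> X \<Longrightarrow> y \<in> X \<Longrightarrow> cnj (\<kappa> x y) = \<kappa> y x"
  unfolding positive_kernel_def by blast

lemma positive_kernel_3:
  assumes "positive_kernel X \<kappa>" "x \<in> X" "y \<in> X" "w \<in> X"
  shows "0 \<le> Re (\<alpha> * cnj \<alpha> * \<kappa> x x + \<beta> * cnj \<beta> * \<kappa> y y + \<gamma> * cnj \<gamma> * \<kappa> w w)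
     + 2 * Re (\<alpha> * cnj \<beta> * \<kappa> x y + \<alpha> * cnj \<gamma> * \<kappa> x w + \<beta> * cnj \<gamma> * \<kappa> y w)"
proof -
  define z where "z = (\<lambda>i::nat. if i = 0 then x else if i = 1 then y else w)"
  define \<mu> where "\<mu> = (\<lambda>i::nat. if i = 0 then \<alpha> else if i = 1 then \<beta> else \<gamma>)"
  have "0 \<le> Re (\<Sum>i\<in>{0,1,2}. \<Sum>j\<in>{0,1,2}. \<mu> i * cnj (\<mu> j) * \<kappa> (z i) (z j))"
    by (rule assms(1)[unfolded positive_kernel_def, THEN conjunct2, rule_format])
      (use assms(2-4) in \<open>auto simp: z_def\<close>)
  also have "(\<Sum>i\<in>{0,1,2}. \<Sum>j\<in>{0,1,2}. \<mu> i * cnj (\<mu> j) * \<kappa> (z i) (z j))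
      = (\<alpha> * cnj \<alpha> * \<kappa> x x + \<beta> * cnj \<beta> * \<kappa> y y + \<gamma> * cnj \<gamma> * \<kappa> w w)
        + (\<alpha> * cnj \<beta> * \<kappa> x y + \<alpha> * cnj \<gamma> * \<kappa> x w + \<beta> * cnj \<gamma> * \<kappa> y w)
        + cnj (\<alpha> * cnj \<beta> * \<kappa> x y + \<alpha> * cnj \<gamma> * \<kappa> x w + \<beta> * cnj \<gamma> * \<kappa> y w)"
    using positive_kernel_cnj[OF assms(1)] assms by (simp add: z_def \<mu>_def algebra_simps)
  also have "Re (u + v + cnj v) = Re u + 2 * Re v" for u v by simp
  finally show ?thesis .
qed

lemma positive_kernel_2:
  assumes "positive_kernel X \<kappa>" "x \<in> X" "y \<in> X"
  shows "0 \<le> Re (\<alpha> * cnj \<alpha> * \<kappa> x x + \<beta> * cnj \<beta> * \<kappa> y y) + 2 * Re (\<alpha> * cnj \<beta> * \<kappa> x y)"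
  using positive_kernel_3[OF assms(1-3) assms(3), of \<alpha> \<beta> 0] by simp

lemma positive_kernel_self:
  assumes "positive_kernel X \<kappa>" "x \<in> X"
  shows "Re (\<kappa> x x) \<ge> 0" "\<kappa> x x = of_real (Re (\<kappa> x x))"
proof -
  show "Re (\<kappa> x x) \<ge> 0" using positive_kernel_2[OF assms(1) assms(2) assms(2), of 1 0] by simp
  show "\<kappa> x x = of_real (Re (\<kappa> x x))"
    using positive_kernel_cnj[OF assms(1) assms(2) assms(2)] by (metis Reals_cnj_iff of_real_Re)
qed

lemma positive_kernel_Cauchy_Schwarz:
  assumes "positive_kernel X \<kappa>" "x \<in> X" "y \<in> X"
  shows "(cmod (\<kappa> x y))\<^sup>2 \<le> Re (\<kappa> x x) * Re (\<kappa> y y)"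
proof -
  define p where "p = (cmod (\<kappa> x y))\<^sup>2"
  have prod: "\<kappa> x y * cnj (\<kappa> x y) = of_real p" "cnj (\<kappa> x y) * \<kappa> x y = of_real p"
    by (simp_all only: p_def complex_norm_square mult.commute)
  obtain X Y where XY: "\<kappa> x x = of_real X" "\<kappa> y y = of_real Y" "X \<ge> 0" "Y \<ge> 0"
    using positive_kernel_self[OF assms(1)] assms(2,3) by metis
  have q: "2 * s * p \<le> s\<^sup>2 * X + p * Y" for s :: real
  proof -
    have "0 \<le> Re (of_real s * cnj (of_real s) * of_real X + (- \<kappa> x y) * cnj (- \<kappa> x y) * of_real Y)
        + 2 * Re (of_real s * cnj (- \<kappa> x y) * \<kappa> x y)"
      using positive_kernel_2[OF assms, of "of_real s" "- \<kappa> x y"] XY by simp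
    also have "(- \<kappa> x y) * cnj (- \<kappa> x y) = of_real p" using prod by simp
    also have "of_real s * cnj (- \<kappa> x y) * \<kappa> x y = - of_real s * of_real p"
      using prod by (simp add: mult.assoc)
    finally show ?thesis by (simp add: power2_eq_square)
  qed
  show ?thesis
  proof (cases "Y = 0")
    case True
    have "p \<le> 0" by (rule quadratic_small[of p X]) (use q True in simp)
    then show ?thesis using XY True by (simp add: p_def[symmetric])
  next
    case False
    then have "Y > 0" using XY by simp
    moreover have "Y * p \<le> Y * (Y * X)" using q[of Y] by (simp add: power2_eq_square algebra_simps)
    ultimately show ?thesis using XY by (simp add: p_def[symmetric] mult.commute)
  qed
qed

text \<open>Equality in the Cauchy-Schwarz inequality for \<open>x\<close> and \<open>y\<close> provides a null vector of the positive
  form on \<open>x\<close> and \<open>y\<close>. A null vector is orthogonal to everything, in particular to \<open>w\<close>.\<close>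

lemma positive_kernel_rank_one:
  assumes "positive_kernel X \<kappa>" "x \<in> X" "y \<in> X" "w \<in> X"
    and eq: "(cmod (\<kappa> x y))\<^sup>2 = Re (\<kappa> x x) * Re (\<kappa> y y)" and pos: "Re (\<kappa> y y) > 0"
  shows "\<kappa> x w * \<kappa> y y = \<kappa> x y * \<kappa> y w"
proof -
  obtain X Y Z where XY: "\<kappa> x x = of_real X" "\<kappa> y y = of_real Y" "\<kappa> w w = of_real Z"
    using positive_kernel_self[OF assms(1)] assms(2-4) by metis
  have Y: "Y > 0" using pos XY by simp
  define d where "d = - \<kappa> x y / of_real Y"
  define v where "v = \<kappa> x w + d * \<kappa> y w"
  have prod: "\<kappa> x y * cnj (\<kappa> x y) = of_real (X * Y)"
    using eq XY by (simp only: complex_norm_square[symmetric] Re_complex_of_real of_real_power)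
  have dd: "d * cnj d = of_real (X / Y)"
    using prod Y by (simp add: d_def field_simps)
  have dx: "cnj d * \<kappa> x y = - of_real X"
    using prod Y by (simp add: d_def field_simps)
  have "2 * t * (cmod v)\<^sup>2 \<le> t\<^sup>2 * ((cmod v)\<^sup>2 * Z)" for t :: real
  proof -
    have "0 \<le> Re (\<kappa> x x + d * cnj d * \<kappa> y y + (- of_real t * v) * cnj (- of_real t * v) * \<kappa> w w)
       + 2 * Re (cnj d * \<kappa> x y + cnj (- of_real t * v) * \<kappa> x w + d * cnj (- of_real t * v) * \<kappa> y w)"
      using positive_kernel_3[OF assms(1-4), of 1 d "- of_real t * v"] by simp
    also have "cnj d * \<kappa> x y + cnj (- of_real t * v) * \<kappa> x w + d * cnj (- of_real t * v) * \<kappa> y w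
       = - of_real X - of_real t * (v * cnj v)"
      using dx by (simp add: v_def algebra_simps)
    also have "\<kappa> x x + d * cnj d * \<kappa> y y + (- of_real t * v) * cnj (- of_real t * v) * \<kappa> w w
       = of_real X + of_real X + of_real (t\<^sup>2) * (v * cnj v) * of_real Z"
      using Y unfolding dd XY by (simp add: power2_eq_square mult_ac)
    finally have "0 \<le> Re (of_real X + of_real X + of_real (t\<^sup>2) * of_real ((cmod v)\<^sup>2) * of_real Z)
       + 2 * Re (- of_real X - of_real t * of_real ((cmod v)\<^sup>2))"
      by (simp only: complex_norm_square)
    then show ?thesis by (simp add: mult.assoc del: of_real_power of_real_mult)
  qed
  then have "(cmod v)\<^sup>2 \<le> 0" by (intro quadratic_small) auto
  then have "v = 0" by simp
  then show ?thesis using Y XY by (simp add: v_def d_def field_simps)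
qed

text \<open>The Cauchy-Schwarz inequalities for \<open>\<kappa>\<close> and for \<open>1 / \<kappa>\<close> are opposite to each other, so that
  equality holds.\<close>

lemma positive_kernel_reciprocal:
  assumes k: "positive_kernel X \<kappa>" "positive_kernel X (\<lambda>x y. 1 / \<kappa> x y)"
    and nz: "\<And>x y. x \<in> X \<Longrightarrow> y \<in> X \<Longrightarrow> \<kappa> x y \<noteq> 0"
    and X: "x \<in> X" "y \<in> X" "w \<in> X"
  shows "\<kappa> x w * \<kappa> y y = \<kappa> x y * \<kappa> y w"
proof (rule positive_kernel_rank_one[OF k(1) X])
  obtain p q where pq: "\<kappa> x x = of_real p" "\<kappa> y y = of_real q" "p \<ge> 0" "q \<ge> 0"
    using positive_kernel_self[OF k(1)] X by metis
  have pos: "p > 0" "q > 0" using nz[OF X(1) X(1)] nz[OF X(2) X(2)] pq by auto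
  then show "Re (\<kappa> y y) > 0" using pq by simp
  have xy: "cmod (\<kappa> x y) > 0" using nz X by simp
  have "(cmod (\<kappa> x y))\<^sup>2 \<le> p * q"
    using positive_kernel_Cauchy_Schwarz[OF k(1) X(1,2)] pq by simp
  moreover have "(1 / cmod (\<kappa> x y))\<^sup>2 \<le> (1 / p) * (1 / q)"
    using positive_kernel_Cauchy_Schwarz[OF k(2) X(1,2)] pq by (simp add: norm_divide Re_divide_of_real)
  then have "p * q \<le> (cmod (\<kappa> x y))\<^sup>2" using pos xy by (simp add: field_simps power_divide)
  ultimately show "(cmod (\<kappa> x y))\<^sup>2 = Re (\<kappa> x x) * Re (\<kappa> y y)" using pq by simp
qed

section \<open>The action of automorphisms on points\<close>

context regular_polynomial
begin

definition point_map :: "('n list operator \<Rightarrow> 'n list operator) \<Rightarrow> ('n \<Rightarrow> complex) \<Rightarrow> 'n \<Rightarrow> complex" where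
  "point_map \<Phi> z = (\<lambda>i. character z (\<Phi> (W [i])))"

lemma auto_mem:
  assumes "\<Phi> \<in> algebra_auto A" "T \<in> A" shows "\<Phi> T \<in> A"
  using Bij_imp_funcset[OF algebra_autoD(1)[OF assms(1)]] assms(2) by auto

lemma functional_on_auto:
  assumes P: "\<Phi> \<in> algebra_auto A" and g: "functional_on A g"
  shows "functional_on A (\<lambda>T. g (\<Phi> T))"
proof -
  obtain B where B: "\<And>T. T \<in> A \<Longrightarrow> cmod (g T) \<le> B * norm T" using g unfolding functional_on_def by blast
  have "cmod (g (\<Phi> T)) \<le> B * norm T" if "T \<in> A" for T
    using B[OF auto_mem[OF P that]] completely_isometric_norm[OF algebra_autoD(6)[OF P] that] by simp
  then show ?thesis
    using g auto_mem[OF P] algebra_autoD(2,3)[OF P] unfolding functional_on_def by auto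
qed

lemma word_Cons: "W (i # \<alpha>) = W [i] o\<^sub>L W \<alpha>"
  using shift_word_append[of a "[i]" \<alpha>] by simp

lemma character_auto_word:
  assumes P: "\<Phi> \<in> algebra_auto A" and z: "z \<in> dom"
  shows "character z (\<Phi> (W \<alpha>)) = word_eval (point_map \<Phi> z) \<alpha>"
proof (induction \<alpha>)
  case Nil
  have "W [] = id_blinfun" by (simp add: shift_word_def)
  then show ?case
    using algebra_autoD(5)[OF P] by (simp add: character_def pair_kvec_delta_Nil z)
next
  case (Cons i \<alpha>)
  then show ?case
    using algebra_autoD(4)[OF P, of "W [i]" "W \<alpha>"] character_mult[OF z auto_mem[OF P, of "W [i]"]]
    by (simp add: word_Cons[of i \<alpha>] point_map_def)
qed

lemma cscale_of_real: "cscale (of_real r) x = r *\<^sub>R x"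
  by (rule ell2_eqI) (simp add: cscale.rep_eq scaleR_ell2.rep_eq)

text \<open>The row \<open>(\<surd>a\<^sub>\<alpha> W\<^sub>\<alpha>)\<close> is made into a square matrix by zero rows. It has norm at most \<open>1\<close>, hence so
  has its image. This is where complete isometry enters, since the matrix has one column for each
  monomial of \<open>f\<close>.\<close>

lemma auto_row_contraction:
  assumes P: "\<Phi> \<in> algebra_auto A"
  shows "(norm (\<Sum>\<alpha>\<in>supp. sqrt (a \<alpha>) *\<^sub>R blinfun_apply (\<Phi> (W \<alpha>)) (x \<alpha>)))\<^sup>2 \<le> (\<Sum>\<alpha>\<in>supp. (norm (x \<alpha>))\<^sup>2)"
proof -
  define N where "N = card supp"
  obtain e where e: "bij_betw e {..<N} supp"
    using ex_bij_betw_nat_finite[OF finite_support] by (auto simp: N_def atLeast0LessThan)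
  have "supp \<noteq> {}" using letter_in_support by blast
  then have N: "0 < N" by (simp add: N_def card_gt_0_iff)
  define T where "T = (\<lambda>i j. if i = (0::nat) then cscale_op (of_real (sqrt (a (e j)))) (W (e j)) else cscale_op 0 (W []))"
  have TA: "T i j \<in> A" for i j unfolding T_def by (auto simp del: operator.scale_zero_left intro!: cscale_in_A)
  have row: "matrix_norm N T \<le> 1"
  proof (rule matrix_norm_le)
    fix y :: "nat \<Rightarrow> 'n list ell2" assume y: "L2_set (\<lambda>j. norm (y j)) {..<N} \<le> 1"
    define x where "x \<alpha> = y (inv_into {..<N} e \<alpha>)" for \<alpha>
    have xe: "x (e j) = y j" if "j < N" for j
      using e that by (simp add: x_def bij_betw_inv_into_left)
    have "(\<Sum>j<N. blinfun_apply (T 0 j) (y j)) = (\<Sum>j<N. sqrt (a (e j)) *\<^sub>R blinfun_apply (W (e j)) (x (e j)))"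
      by (intro sum.cong) (simp_all add: T_def cscale_of_real xe)
    also have "\<dots> = (\<Sum>\<alpha>\<in>supp. sqrt (a \<alpha>) *\<^sub>R blinfun_apply (W \<alpha>) (x \<alpha>))"
      by (rule sum.reindex_bij_betw[OF e])
    finally have "(norm (\<Sum>j<N. blinfun_apply (T 0 j) (y j)))\<^sup>2 \<le> (\<Sum>\<alpha>\<in>supp. (norm (x \<alpha>))\<^sup>2)"
      using row_contraction[of x] by simp
    also have "\<dots> = (\<Sum>j<N. (norm (x (e j)))\<^sup>2)" by (rule sum.reindex_bij_betw[OF e, symmetric])
    also have "\<dots> = (L2_set (\<lambda>j. norm (y j)) {..<N})\<^sup>2"
      by (simp add: L2_set_def sum_nonneg xe)
    also have "\<dots> \<le> 1\<^sup>2" using y by (intro power_mono) simp_all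
    finally have le: "norm (\<Sum>j<N. blinfun_apply (T 0 j) (y j)) \<le> 1"
      by (rule power2_le_imp_le) simp
    have zero: "(\<Sum>j<N. blinfun_apply (T i j) (y j)) = 0" if "i \<noteq> 0" for i
      using that by (simp add: T_def)
    have "L2_set (\<lambda>i. norm (\<Sum>j<N. blinfun_apply (T i j) (y j))) {..<N}
        \<le> (\<Sum>i<N. norm (\<Sum>j<N. blinfun_apply (T i j) (y j)))" by (rule L2_set_le_sum) simp
    also have "\<dots> = (\<Sum>i\<in>{0}. norm (\<Sum>j<N. blinfun_apply (T i j) (y j)))"
      by (rule sum.mono_neutral_right) (use N zero in auto)
    finally show "L2_set (\<lambda>i. norm (\<Sum>j<N. blinfun_apply (T i j) (y j))) {..<N} \<le> 1"
      using le by simp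
  qed
  moreover have "matrix_norm N (\<lambda>i j. \<Phi> (T i j)) = matrix_norm N T"
    using algebra_autoD(6)[OF P] TA unfolding completely_isometric_def by metis
  ultimately have "matrix_norm N (\<lambda>i j. \<Phi> (T i j)) \<le> 1" by simp
  from matrix_norm_row_bound[OF this N, of "\<lambda>j. x (e j)"]
  have "norm (\<Sum>j<N. blinfun_apply (\<Phi> (T 0 j)) (x (e j))) \<le> L2_set (\<lambda>j. norm (x (e j))) {..<N}" .
  then have "(norm (\<Sum>j<N. blinfun_apply (\<Phi> (T 0 j)) (x (e j))))\<^sup>2 \<le> (L2_set (\<lambda>j. norm (x (e j))) {..<N})\<^sup>2"
    by (rule power_mono) simp
  also have "\<dots> = (\<Sum>j<N. (norm (x (e j)))\<^sup>2)" by (simp add: L2_set_def sum_nonneg)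
  also have "\<dots> = (\<Sum>\<alpha>\<in>supp. (norm (x \<alpha>))\<^sup>2)" by (rule sum.reindex_bij_betw[OF e])
  also have "(\<Sum>j<N. blinfun_apply (\<Phi> (T 0 j)) (x (e j)))
      = (\<Sum>j<N. sqrt (a (e j)) *\<^sub>R blinfun_apply (\<Phi> (W (e j))) (x (e j)))"
    by (intro sum.cong refl) (simp add: T_def algebra_autoD(3)[OF P] cscale_of_real)
  also have "\<dots> = (\<Sum>\<alpha>\<in>supp. sqrt (a \<alpha>) *\<^sub>R blinfun_apply (\<Phi> (W \<alpha>)) (x \<alpha>))"
    by (rule sum.reindex_bij_betw[OF e])
  finally show ?thesis .
qed

lemma pair_combination:
  "pair (\<Sum>i\<in>I. cscale (\<nu> i) (k i)) (cnj_vec (\<Sum>i\<in>I. cscale (\<nu> i) (k i)))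
    = (\<Sum>i\<in>I. \<Sum>j\<in>I. \<nu> i * cnj (\<nu> j) * pair (k i) (cnj_vec (k j)))"
proof -
  have "pair (\<Sum>i\<in>I. cscale (\<nu> i) (k i)) (cnj_vec (\<Sum>i\<in>I. cscale (\<nu> i) (k i)))
      = (\<Sum>i\<in>I. \<nu> i * pair (k i) (\<Sum>j\<in>I. cscale (cnj (\<nu> j)) (cnj_vec (k j))))"
    by (simp only: pair_sum_left pair_cscale_left cnj_vec_sum cnj_vec_cscale)
  then show ?thesis
    by (simp only: pair_sum_right pair_cscale_right sum_distrib_left mult.assoc)
qed

lemma kernel_eq: "z \<in> dom \<Longrightarrow> w \<in> dom \<Longrightarrow> pair (kvec z) (cnj_vec (kvec w)) = 1 / defect z w"
  using kernel_inverse[of z w] defect_nonzero[of z w] by (simp add: field_simps)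

text \<open>Let \<open>R\<close> be the image of the row contraction. Its transpose maps the combination
  \<open>y = \<Sum> \<mu>\<^sub>i kvec(z\<^sub>i)\<close> of eigenvectors to the column with entries
  \<open>Y\<^sub>\<alpha> = \<Sum> \<mu>\<^sub>i \<surd>a\<^sub>\<alpha> (\<phi> z\<^sub>i)\<^sub>\<alpha> kvec(z\<^sub>i)\<close>, and the value at
  \<open>\<mu>\<close> of the quadratic form of the kernel is \<open>\<parallel>y\<parallel>\<^sup>2 - \<Sum> \<parallel>Y\<^sub>\<alpha>\<parallel>\<^sup>2\<close>.\<close>

lemma auto_positive_kernel:
  assumes P: "\<Phi> \<in> algebra_auto A"
  shows "positive_kernel dom (\<lambda>z w. defect (point_map \<Phi> z) (point_map \<Phi> w) / defect z w)"
  unfolding positive_kernel_def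
proof (intro conjI ballI allI impI)
  show "cnj (defect (point_map \<Phi> z) (point_map \<Phi> w) / defect z w)
    = defect (point_map \<Phi> w) (point_map \<Phi> z) / defect w z" for z w
    by (simp add: defect_cnj)
  fix I :: "nat set" and z :: "nat \<Rightarrow> 'n \<Rightarrow> complex" and \<mu> :: "nat \<Rightarrow> complex"
  assume I: "finite I" and z: "\<forall>i\<in>I. z i \<in> dom"
  let ?\<phi> = "\<lambda>i. point_map \<Phi> (z i)"
  define K where "K i j = pair (kvec (z i)) (cnj_vec (kvec (z j)))" for i j
  define \<nu> where "\<nu> \<alpha> i = \<mu> i * (of_real (sqrt (a \<alpha>)) * word_eval (?\<phi> i) \<alpha>)" for \<alpha> i
  define y where "y = (\<Sum>i\<in>I. cscale (\<mu> i) (kvec (z i)))"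
  define Y where "Y \<alpha> = (\<Sum>i\<in>I. cscale (\<nu> \<alpha> i) (kvec (z i)))" for \<alpha>
  define v where "v = (\<Sum>\<alpha>\<in>supp. sqrt (a \<alpha>) *\<^sub>R blinfun_apply (\<Phi> (W \<alpha>)) (cnj_vec (Y \<alpha>)))"
  define m where "m = (\<Sum>\<alpha>\<in>supp. (norm (Y \<alpha>))\<^sup>2)"
  have m0: "m \<ge> 0" by (simp add: m_def sum_nonneg)
  have ny: "of_real ((norm y)\<^sup>2) = (\<Sum>i\<in>I. \<Sum>j\<in>I. \<mu> i * cnj (\<mu> j) * K i j)"
    unfolding pair_cnj_vec[symmetric] y_def K_def by (rule pair_combination)
  have nY: "of_real m = (\<Sum>i\<in>I. \<Sum>j\<in>I. \<mu> i * cnj (\<mu> j) * (form (?\<phi> i) (?\<phi> j) * K i j))"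
  proof -
    have sq: "complex_of_real (sqrt (a \<alpha>)) * complex_of_real (sqrt (a \<alpha>)) = of_real (a \<alpha>)" for \<alpha>
      unfolding of_real_mult[symmetric] by simp
    have "of_real m = (\<Sum>\<alpha>\<in>supp. \<Sum>i\<in>I. \<Sum>j\<in>I. \<nu> \<alpha> i * cnj (\<nu> \<alpha> j) * K i j)"
      unfolding m_def of_real_sum pair_cnj_vec[symmetric] Y_def K_def
      by (intro sum.cong refl pair_combination)
    also have "\<dots> = (\<Sum>i\<in>I. \<Sum>j\<in>I. \<Sum>\<alpha>\<in>supp. \<nu> \<alpha> i * cnj (\<nu> \<alpha> j) * K i j)"
      by (subst sum.swap, intro sum.cong refl, rule sum.swap)
    also have "\<dots> = (\<Sum>i\<in>I. \<Sum>j\<in>I. \<mu> i * cnj (\<mu> j) * (form (?\<phi> i) (?\<phi> j) * K i j))"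
      unfolding form_def sum_distrib_left sum_distrib_right
      by (intro sum.cong refl) (simp add: \<nu>_def sq[symmetric] mult_ac)
    finally show ?thesis .
  qed
  have "pair y v = of_real m"
  proof -
    have "pair y v = (\<Sum>\<alpha>\<in>supp. of_real (sqrt (a \<alpha>)) * pair y (blinfun_apply (\<Phi> (W \<alpha>)) (cnj_vec (Y \<alpha>))))"
      unfolding v_def pair_sum_right cscale_of_real[symmetric] pair_cscale_right ..
    also have "\<dots> = (\<Sum>\<alpha>\<in>supp. pair (Y \<alpha>) (cnj_vec (Y \<alpha>)))"
    proof (rule sum.cong[OF refl])
      fix \<alpha>
      have "pair (kvec (z i)) (blinfun_apply (\<Phi> (W \<alpha>)) (cnj_vec (Y \<alpha>)))
          = word_eval (?\<phi> i) \<alpha> * pair (kvec (z i)) (cnj_vec (Y \<alpha>))" if "i \<in> I" for i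
        using z that by (simp add: pair_kvec_apply auto_mem[OF P] character_auto_word[OF P])
      then show "of_real (sqrt (a \<alpha>)) * pair y (blinfun_apply (\<Phi> (W \<alpha>)) (cnj_vec (Y \<alpha>)))
          = pair (Y \<alpha>) (cnj_vec (Y \<alpha>))"
        unfolding y_def Y_def[of \<alpha>] pair_sum_left pair_cscale_left sum_distrib_left \<nu>_def
        by (intro sum.cong refl) (simp add: Y_def \<nu>_def mult_ac)
    qed
    also have "\<dots> = of_real m" by (simp add: m_def pair_cnj_vec)
    finally show ?thesis .
  qed
  then have "m \<le> norm y * norm v" using norm_pair_le[of y v] m0 by simp
  also have "\<dots> \<le> norm y * sqrt m"
  proof (rule mult_left_mono)
    have "(norm v)\<^sup>2 \<le> m" using auto_row_contraction[OF P, of "\<lambda>\<alpha>. cnj_vec (Y \<alpha>)"] by (simp add: v_def m_def)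
    then show "norm v \<le> sqrt m" by (rule real_le_rsqrt)
  qed simp
  finally have le: "sqrt m * sqrt m \<le> norm y * sqrt m" using m0 by simp
  have "sqrt m \<le> norm y"
  proof (cases "m = 0")
    case False
    then have "sqrt m > 0" using m0 by simp
    then show ?thesis using le by (rule mult_right_le_imp_le[rotated])
  qed simp
  then have "(sqrt m)\<^sup>2 \<le> (norm y)\<^sup>2" by (rule power_mono) (use m0 in simp)
  then have "0 \<le> Re (of_real ((norm y)\<^sup>2) - of_real m)" using m0 by simp
  also have "of_real ((norm y)\<^sup>2) - of_real m
      = (\<Sum>i\<in>I. \<Sum>j\<in>I. \<mu> i * cnj (\<mu> j) * (defect (?\<phi> i) (?\<phi> j) * K i j))"
    unfolding ny nY sum_subtractf[symmetric] by (intro sum.cong refl) (simp add: defect_def algebra_simps)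
  also have "\<dots> = (\<Sum>i\<in>I. \<Sum>j\<in>I. \<mu> i * cnj (\<mu> j) * (defect (?\<phi> i) (?\<phi> j) / defect (z i) (z j)))"
    using z by (intro sum.cong refl) (simp add: K_def kernel_eq)
  finally show "0 \<le> Re (\<Sum>i\<in>I. \<Sum>j\<in>I. \<mu> i * cnj (\<mu> j) * (defect (?\<phi> i) (?\<phi> j) / defect (z i) (z j)))" .
qed

lemma form_diff:
  "form z z - form z w - form w z + form w w
    = of_real (\<Sum>\<alpha>\<in>supp. a \<alpha> * (cmod (word_eval z \<alpha> - word_eval w \<alpha>))\<^sup>2)"
  unfolding form_def of_real_sum sum_subtractf[symmetric] sum.distrib[symmetric] of_real_mult complex_norm_square
  by (intro sum.cong refl) (simp add: algebra_simps)

lemma auto_group_mult: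
  assumes "F \<in> algebra_auto A" "H \<in> algebra_auto A" "T \<in> A"
  shows "(F \<otimes>\<^bsub>algebra_auto_group A\<^esub> H) T = F (H T)"
  using algebra_autoD(1)[OF assms(1)] algebra_autoD(1)[OF assms(2)] assms(3)
  by (simp add: algebra_auto_group_def BijGroup_def compose_eq)

lemma auto_inverse:
  assumes P: "\<Phi> \<in> algebra_auto A"
  obtains \<Psi> where "\<Psi> \<in> algebra_auto A" "\<And>T. T \<in> A \<Longrightarrow> \<Phi> (\<Psi> T) = T" "\<And>T. T \<in> A \<Longrightarrow> \<Psi> (\<Phi> T) = T"
proof -
  let ?G = "algebra_auto_group A"
  interpret group ?G by (rule group_domain_algebra_auto_group[OF regular])
  have c: "carrier ?G = algebra_auto A" by (simp add: algebra_auto_group_def)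
  have o: "\<one>\<^bsub>?G\<^esub> T = T" if "T \<in> A" for T
    using that by (simp add: algebra_auto_group_def BijGroup_def)
  show ?thesis
  proof
    show Q: "inv\<^bsub>?G\<^esub> \<Phi> \<in> algebra_auto A" using P c inv_closed by blast
    show "\<Phi> ((inv\<^bsub>?G\<^esub> \<Phi>) T) = T" "(inv\<^bsub>?G\<^esub> \<Phi>) (\<Phi> T) = T" if "T \<in> A" for T
      using auto_group_mult[OF P Q that] auto_group_mult[OF Q P that] o[OF that] P c by simp_all
  qed
qed

text \<open>Positivity gives \<open>P(\<phi> z, \<phi> z) \<le> 1\<close> only. If equality holds at one point \<open>z\<close>, the Cauchy-Schwarz
  inequality forces \<open>P(\<phi> z, \<phi> w) = 1\<close> for all \<open>w\<close>, so that \<open>\<phi>\<close> is constant. Then the characters of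
  \<open>dom\<close> agree on the image of \<open>\<Phi>\<close>, which is the whole algebra.\<close>

lemma point_map_in_dom:
  assumes P: "\<Phi> \<in> algebra_auto A" and z: "z \<in> dom"
  shows "point_map \<Phi> z \<in> dom"
proof (rule ccontr)
  assume neg: "point_map \<Phi> z \<notin> dom"
  let ?\<phi> = "point_map \<Phi>"
  note pk = auto_positive_kernel[OF P]
  have closed: "Re (form (?\<phi> w) (?\<phi> w)) \<le> 1" if w: "w \<in> dom" for w
  proof -
    have "0 \<le> Re (defect (?\<phi> w) (?\<phi> w) / defect w w)"
      using positive_kernel_self(1)[OF pk w] .
    also have "\<dots> = Re (defect (?\<phi> w) (?\<phi> w)) / Re (defect w w)"
      by (subst defect_self[of w]) (simp add: Re_divide_of_real)
    finally show ?thesis using defect_self_pos[OF w] by (simp add: zero_le_divide_iff defect_def)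
  qed
  have one: "form (?\<phi> z) (?\<phi> z) = 1"
  proof -
    have "Re (form (?\<phi> z) (?\<phi> z)) = 1" using closed[OF z] neg by (simp add: dom_iff)
    then show ?thesis by (metis form_self of_real_1 Re_complex_of_real)
  qed
  have const: "?\<phi> w = ?\<phi> z" if w: "w \<in> dom" for w
  proof -
    have "(cmod (defect (?\<phi> z) (?\<phi> w) / defect z w))\<^sup>2 \<le> 0"
      using positive_kernel_Cauchy_Schwarz[OF pk z w] one by (simp add: defect_def)
    then have "form (?\<phi> z) (?\<phi> w) = 1" using defect_nonzero[OF z w] by (simp add: defect_def)
    moreover from this have "form (?\<phi> w) (?\<phi> z) = 1" using form_cnj[of "?\<phi> z" "?\<phi> w"] by simp
    ultimately have "complex_of_real (\<Sum>\<alpha>\<in>supp. a \<alpha> * (cmod (word_eval (?\<phi> z) \<alpha> - word_eval (?\<phi> w) \<alpha>))\<^sup>2)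
        = form (?\<phi> w) (?\<phi> w) - 1"
      using form_diff[of "?\<phi> z" "?\<phi> w"] one by simp
    then have "(\<Sum>\<alpha>\<in>supp. a \<alpha> * (cmod (word_eval (?\<phi> z) \<alpha> - word_eval (?\<phi> w) \<alpha>))\<^sup>2) \<le> 0"
      using closed[OF w] by (metis Re_complex_of_real diff_le_0_iff_le minus_complex.sel(1) one_complex.sel(1))
    then have "\<forall>\<alpha>\<in>supp. a \<alpha> * (cmod (word_eval (?\<phi> z) \<alpha> - word_eval (?\<phi> w) \<alpha>))\<^sup>2 = 0"
      by (subst sum_nonneg_eq_0_iff[symmetric]) (auto intro!: antisym[OF _ sum_nonneg])
    then have "a [i] * (cmod (word_eval (?\<phi> z) [i] - word_eval (?\<phi> w) [i]))\<^sup>2 = 0" for i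
      using letter_in_support by blast
    then show ?thesis using a_letter by (auto simp: less_imp_neq[symmetric] simp del: a_letter)
  qed
  obtain \<Psi> where \<Psi>: "\<Psi> \<in> algebra_auto A" "\<And>T. T \<in> A \<Longrightarrow> \<Phi> (\<Psi> T) = T" using auto_inverse[OF P] by metis
  have "w i = z i" if w: "w \<in> dom" for w i
  proof -
    have "character w (\<Phi> T) = character z (\<Phi> T)" if "T \<in> A" for T
      by (rule functional_eqI[OF functional_on_auto[OF P functional_on_character]
            functional_on_auto[OF P functional_on_character] _ that])
        (simp add: character_auto_word[OF P] z w const[OF w])
    from this[OF auto_mem[OF \<Psi>(1) W_in_A[of "[i]"]]] show ?thesis
      by (simp add: \<Psi>(2) character_word z w)
  qed
  then have all_eq: "w i = z i" if "w \<in> dom" for w i using that by blast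
  obtain t0 where t0: "t0 > 0" "\<And>t. 0 \<le> t \<Longrightarrow> t \<le> t0 \<Longrightarrow> (\<lambda>i::'n. of_real t * 1) \<in> dom"
    using scale_in_dom[of "\<lambda>_. 1"] by blast
  have "complex_of_real t0 * 1 = 0"
    using all_eq[OF t0(2)[of t0]] all_eq[OF zero_in_dom] t0(1) by (metis less_imp_le order_refl)
  then show False using t0 by simp
qed

lemma character_auto:
  assumes P: "\<Phi> \<in> algebra_auto A" and z: "z \<in> dom" and T: "T \<in> A"
  shows "character z (\<Phi> T) = character (point_map \<Phi> z) T"
  by (rule functional_eqI[OF functional_on_auto[OF P functional_on_character] functional_on_character _ T])
    (simp add: character_auto_word[OF P z] character_word point_map_in_dom[OF P z])

lemma point_map_inverse:
  assumes P: "\<Phi> \<in> algebra_auto A" "\<Psi> \<in> algebra_auto A" "\<And>T. T \<in> A \<Longrightarrow> \<Phi> (\<Psi> T) = T" and z: "z \<in> dom"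
  shows "point_map \<Psi> (point_map \<Phi> z) = z"
proof
  fix i
  show "point_map \<Psi> (point_map \<Phi> z) i = z i"
    using character_auto[OF P(1) z auto_mem[OF P(2) W_in_A[of "[i]"]]] P(3)[of "W [i]"]
    by (simp add: point_map_def[of \<Psi>] character_word z)
qed

text \<open>The rank-one relation with base point \<open>c\<close>, where \<open>\<phi> c = 0\<close> makes the kernel
  \<open>F(\<phi> z, \<phi> c) / F(z, c)\<close> equal to \<open>1 / F(z, c)\<close>.\<close>

lemma auto_kernel_identity:
  assumes P: "\<Phi> \<in> algebra_auto A" "\<Psi> \<in> algebra_auto A"
    "\<And>T. T \<in> A \<Longrightarrow> \<Phi> (\<Psi> T) = T" "\<And>T. T \<in> A \<Longrightarrow> \<Psi> (\<Phi> T) = T"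
    and c: "c = point_map \<Psi> (\<lambda>_. 0)" and z: "z \<in> dom" "w \<in> dom"
  shows "defect (point_map \<Phi> z) (point_map \<Phi> w) * defect z c * defect c w = defect z w * defect c c"
proof -
  let ?\<phi> = "point_map \<Phi>" and ?\<psi> = "point_map \<Psi>"
  define \<kappa> where "\<kappa> z w = defect (?\<phi> z) (?\<phi> w) / defect z w" for z w
  have cd: "c \<in> dom" unfolding c by (rule point_map_in_dom[OF P(2) zero_in_dom])
  have \<phi>c: "?\<phi> c = (\<lambda>_. 0)"
    unfolding c by (rule point_map_inverse[OF P(2,1,4) zero_in_dom])
  have pk: "positive_kernel dom \<kappa>" unfolding \<kappa>_def by (rule auto_positive_kernel[OF P(1)])
  have "positive_kernel dom (\<lambda>z w. 1 / \<kappa> z w)"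
    unfolding positive_kernel_def
  proof (intro conjI ballI allI impI)
    show "cnj (1 / \<kappa> x y) = 1 / \<kappa> y x" for x y by (simp add: \<kappa>_def defect_cnj)
    fix I :: "nat set" and z :: "nat \<Rightarrow> 'n \<Rightarrow> complex" and \<mu> :: "nat \<Rightarrow> complex"
    assume I: "finite I" and z: "\<forall>i\<in>I. z i \<in> dom"
    have "0 \<le> Re (\<Sum>i\<in>I. \<Sum>j\<in>I. \<mu> i * cnj (\<mu> j) *
        (defect (?\<psi> (?\<phi> (z i))) (?\<psi> (?\<phi> (z j))) / defect (?\<phi> (z i)) (?\<phi> (z j))))"
      using auto_positive_kernel[OF P(2)] I z point_map_in_dom[OF P(1)]
      unfolding positive_kernel_def by (elim conjE allE[of _ I] allE[of _ "\<lambda>i. ?\<phi> (z i)"]) auto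
    also have "(\<Sum>i\<in>I. \<Sum>j\<in>I. \<mu> i * cnj (\<mu> j) *
        (defect (?\<psi> (?\<phi> (z i))) (?\<psi> (?\<phi> (z j))) / defect (?\<phi> (z i)) (?\<phi> (z j))))
       = (\<Sum>i\<in>I. \<Sum>j\<in>I. \<mu> i * cnj (\<mu> j) * (1 / \<kappa> (z i) (z j)))"
      using z by (intro sum.cong refl) (simp add: \<kappa>_def point_map_inverse[OF P(1,2,3)])
    finally show "0 \<le> Re (\<Sum>i\<in>I. \<Sum>j\<in>I. \<mu> i * cnj (\<mu> j) * (1 / \<kappa> (z i) (z j)))" .
  qed
  then have "\<kappa> z w * \<kappa> c c = \<kappa> z c * \<kappa> c w"
    by (rule positive_kernel_reciprocal[OF pk])
      (auto simp: \<kappa>_def defect_nonzero point_map_in_dom[OF P(1)] z cd)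
  then show ?thesis
    using defect_nonzero[OF z] defect_nonzero[OF z(1) cd] defect_nonzero[OF cd z(2)] defect_nonzero[OF cd cd]
    by (simp add: \<kappa>_def \<phi>c field_simps)
qed

end

section \<open>Infinitesimal rotations\<close>

text \<open>The derivative of the monomial \<open>z\<^sub>\<alpha>\<close> at \<open>z\<close> in the direction \<open>v\<close>, by the product rule.\<close>

fun word_deriv :: "('n \<Rightarrow> complex) \<Rightarrow> ('n \<Rightarrow> complex) \<Rightarrow> 'n list \<Rightarrow> complex" where
  "word_deriv z v [] = 0"
| "word_deriv z v (i # \<alpha>) = v i * word_eval z \<alpha> + z i * word_deriv z v \<alpha>"

lemma word_eval_has_deriv:
  assumes "\<And>i. ((\<lambda>t. y t i) has_vector_derivative v i) (at s)"
  shows "((\<lambda>t. word_eval (y t) \<alpha>) has_vector_derivative word_deriv (y s) v \<alpha>) (at s)"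
proof (induction \<alpha>)
  case (Cons i \<alpha>)
  have "((\<lambda>t. y t i * word_eval (y t) \<alpha>) has_vector_derivative
      (y s i * word_deriv (y s) v \<alpha> + v i * word_eval (y s) \<alpha>)) (at s)"
    by (rule has_vector_derivative_mult[OF assms Cons.IH])
  then show ?case by (simp add: add.commute)
qed simp

lemma word_deriv_nonzero:
  assumes "\<And>i. z i \<noteq> 0"
  shows "word_deriv z v \<alpha> = word_eval z \<alpha> * (\<Sum>i\<leftarrow>\<alpha>. v i / z i)"
  using assms by (induction \<alpha>) (auto simp: field_simps)

lemma word_deriv_at_zero: "word_deriv (\<lambda>_. 0) v \<alpha> = (if length \<alpha> = 1 then v (hd \<alpha>) else 0)"
proof (cases \<alpha>)
  case (Cons i \<beta>)
  then show ?thesis by (cases \<beta>) auto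
qed simp

text \<open>A word that does not vanish at a point of a coordinate axis is a power of one letter.\<close>

lemma word_deriv_supported:
  assumes "\<And>j. j \<noteq> i \<Longrightarrow> y j = 0" "word_eval y \<alpha> \<noteq> 0"
  shows "word_deriv w v \<alpha> = v i * word_deriv w (\<lambda>j. if j = i then 1 else 0) \<alpha>"
  using assms(2)
proof (induction \<alpha>)
  case (Cons j \<alpha>)
  then have "j = i" "word_eval y \<alpha> \<noteq> 0" using assms(1)[of j] by auto
  then show ?case using Cons.IH by (simp add: algebra_simps)
qed simp

text \<open>The derivative of \<open>word_deriv z v \<alpha>\<close> when \<open>z\<close> moves with velocity \<open>u\<close> and \<open>v\<close> with velocity \<open>l\<close>.\<close>

fun word_deriv2 :: "('n \<Rightarrow> complex) \<Rightarrow> ('n \<Rightarrow> complex) \<Rightarrow> ('n \<Rightarrow> complex) \<Rightarrow> ('n \<Rightarrow> complex) \<Rightarrow> 'n list \<Rightarrow> complex" where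
  "word_deriv2 z v u l [] = 0"
| "word_deriv2 z v u l (i # \<alpha>) = l i * word_eval z \<alpha> + v i * word_deriv z u \<alpha>
     + (u i * word_deriv z v \<alpha> + z i * word_deriv2 z v u l \<alpha>)"

lemma word_deriv_has_deriv:
  assumes "\<And>i. ((\<lambda>t. y t i) has_vector_derivative u i) (at s)"
    and "\<And>i. ((\<lambda>t. v t i) has_vector_derivative l i) (at s)"
  shows "((\<lambda>t. word_deriv (y t) (v t) \<alpha>) has_vector_derivative word_deriv2 (y s) (v s) u l \<alpha>) (at s)"
proof (induction \<alpha>)
  case (Cons i \<alpha>)
  have "((\<lambda>t. v t i * word_eval (y t) \<alpha> + y t i * word_deriv (y t) (v t) \<alpha>) has_vector_derivative
      ((v s i * word_deriv (y s) u \<alpha> + l i * word_eval (y s) \<alpha>)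
       + (y s i * word_deriv2 (y s) (v s) u l \<alpha> + u i * word_deriv (y s) (v s) \<alpha>))) (at s)"
    by (intro has_vector_derivative_add has_vector_derivative_mult assms Cons.IH
        word_eval_has_deriv)
  then show ?case by (simp add: algebra_simps)
qed simp

lemma word_deriv2_at_zero:
  "word_deriv2 (\<lambda>_. 0) v u l \<alpha> = (if length \<alpha> = 1 then l (hd \<alpha>) else 0)
    + (if length \<alpha> = 2 then v (hd \<alpha>) * u (\<alpha> ! 1) + u (hd \<alpha>) * v (\<alpha> ! 1) else 0)"
proof (cases \<alpha>)
  case (Cons i \<beta>)
  then show ?thesis by (cases \<beta>) (auto simp: word_deriv_at_zero word_eval_zero hd_conv_nth)
qed simp

lemma sum_length_1:
  fixes g :: "'n::finite list \<Rightarrow> 'b::comm_monoid_add"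
  assumes S: "finite S" and g: "\<And>\<alpha>. length \<alpha> \<noteq> 1 \<or> \<alpha> \<notin> S \<Longrightarrow> g \<alpha> = 0"
  shows "(\<Sum>\<alpha>\<in>S. g \<alpha>) = (\<Sum>i\<in>UNIV. g [i])"
proof -
  have mem: "\<alpha> \<in> range (\<lambda>i. [i])" if "length \<alpha> = 1" for \<alpha> :: "'n list"
    using that by (cases \<alpha>) auto
  have "(\<Sum>\<alpha>\<in>S. g \<alpha>) = sum g (range (\<lambda>i. [i]))"
  proof (rule sum.mono_neutral_cong[OF _ S])
    show "g \<alpha> = 0" if "\<alpha> \<in> S - range (\<lambda>i. [i])" for \<alpha>
      by (rule g) (use that mem in auto)
    show "g \<alpha> = 0" if "\<alpha> \<in> range (\<lambda>i. [i]) - S" for \<alpha>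
      by (rule g) (use that in auto)
  qed simp_all
  also have "\<dots> = (\<Sum>i\<in>UNIV. g [i])"
    by (subst sum.reindex) (auto simp: inj_def)
  finally show ?thesis .
qed

lemma sum_length_2:
  fixes g :: "'n::finite list \<Rightarrow> complex"
  assumes S: "finite S" and g: "\<And>\<alpha>. length \<alpha> \<noteq> 2 \<or> \<alpha> \<notin> S \<Longrightarrow> g \<alpha> = 0"
  shows "(\<Sum>\<alpha>\<in>S. g \<alpha>) = (\<Sum>i\<in>UNIV. \<Sum>k\<in>UNIV. g [i, k])"
proof -
  let ?R = "(\<lambda>(i, k). [i, k]) ` (UNIV \<times> UNIV) :: 'n list set"
  have mem: "\<alpha> \<in> ?R" if "length \<alpha> = 2" for \<alpha> :: "'n list"
    using that by (auto simp: length_Suc_conv numeral_2_eq_2 image_iff)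
  have "(\<Sum>\<alpha>\<in>S. g \<alpha>) = sum g ?R"
  proof (rule sum.mono_neutral_cong[OF _ S])
    show "g \<alpha> = 0" if "\<alpha> \<in> S - ?R" for \<alpha>
      by (rule g) (use that mem in auto)
    show "g \<alpha> = 0" if "\<alpha> \<in> ?R - S" for \<alpha>
      by (rule g) (use that in auto)
  qed simp_all
  also have "\<dots> = (\<Sum>(i, k)\<in>UNIV \<times> UNIV. g [i, k])"
    by (subst sum.reindex) (auto simp: inj_on_def intro!: sum.cong)
  finally show ?thesis by (simp add: sum.cartesian_product)
qed

text \<open>Subtracting \<open>2 ^ d\<close> times the sum at \<open>\<tau> / 2\<close> from the sum at \<open>\<tau>\<close> removes the component of degree
  \<open>d\<close> and multiplies the others by nonzero constants.\<close>

lemma differentiable_components: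
  fixes g :: "nat \<Rightarrow> real \<Rightarrow> complex"
  assumes "\<tau>0 > 0" "\<And>\<tau>. 0 < \<tau> \<Longrightarrow> \<tau> \<le> \<tau>0 \<Longrightarrow> (\<lambda>t. \<Sum>k<d. of_real (\<tau> ^ k) * g k t) differentiable at s"
  shows "k < d \<Longrightarrow> g k differentiable at s"
  using assms
proof (induction d arbitrary: g k)
  case (Suc d)
  let ?G = "\<lambda>\<tau> t. \<Sum>k<Suc d. of_real (\<tau> ^ k) * g k t"
  have lower: "g k differentiable at s" if "k < d" for k
  proof -
    define h where "h k t = of_real (1 - 2 ^ d / 2 ^ k) * g k t" for k t
    have "(\<lambda>t. \<Sum>k<d. of_real (\<tau> ^ k) * h k t) differentiable at s" if \<tau>: "0 < \<tau>" "\<tau> \<le> \<tau>0" for \<tau>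
    proof -
      have "(\<lambda>t. ?G \<tau> t - of_real (2 ^ d) * ?G (\<tau> / 2) t) differentiable at s"
        using Suc.prems(3)[of \<tau>] Suc.prems(3)[of "\<tau> / 2"] \<tau>
        by (intro differentiable_diff differentiable_mult differentiable_const) auto
      moreover have "?G \<tau> t - of_real (2 ^ d) * ?G (\<tau> / 2) t = (\<Sum>k<d. of_real (\<tau> ^ k) * h k t)" for t
      proof -
        have "of_real (\<tau> ^ k) * g k t - of_real (2 ^ d) * (of_real ((\<tau> / 2) ^ k) * g k t)
            = of_real (\<tau> ^ k) * h k t" for k
          by (simp add: h_def power_divide algebra_simps)
        moreover have "h d t = 0" by (simp add: h_def)
        ultimately have "?G \<tau> t - of_real (2 ^ d) * ?G (\<tau> / 2) t = (\<Sum>k<Suc d. of_real (\<tau> ^ k) * h k t)"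
          by (simp only: sum_distrib_left sum_subtractf[symmetric])
        then show ?thesis using \<open>h d t = 0\<close> by simp
      qed
      ultimately show ?thesis by simp
    qed
    then have "h k differentiable at s"
      using Suc.IH[of k h] that Suc.prems(2) by blast
    then have "(\<lambda>t. of_real (1 / (1 - 2 ^ d / 2 ^ k)) * h k t) differentiable at s"
      by (intro differentiable_mult differentiable_const)
    moreover have "(2::real) ^ d \<noteq> 2 ^ k" using that by simp
    then have "(1 - 2 ^ d / 2 ^ k :: real) \<noteq> 0" by (simp add: field_simps)
    then have "of_real (1 / (1 - 2 ^ d / 2 ^ k)) * h k t = g k t" for t
      unfolding h_def mult.assoc[symmetric] of_real_mult[symmetric] by simp
    ultimately show ?thesis by simp
  qed
  have top: "g d differentiable at s"
  proof -
    have "(\<lambda>t. of_real (\<tau>0 ^ k) * g k t) differentiable at s" if "k < d" for k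
      by (intro differentiable_mult differentiable_const lower that)
    then have "(\<lambda>t. \<Sum>k<d. of_real (\<tau>0 ^ k) * g k t) differentiable at s"
      by (intro differentiable_sum) auto
    then have "(\<lambda>t. of_real (1 / \<tau>0 ^ d) * (?G \<tau>0 t - (\<Sum>k<d. of_real (\<tau>0 ^ k) * g k t))) differentiable at s"
      using Suc.prems(3)[of \<tau>0] Suc.prems(2)
      by (intro differentiable_mult differentiable_const differentiable_diff) auto
    moreover have "of_real (1 / \<tau>0 ^ d) * (?G \<tau>0 t - (\<Sum>k<d. of_real (\<tau>0 ^ k) * g k t)) = g d t" for t
      using Suc.prems(2) by simp
    ultimately show ?thesis by simp
  qed
  show ?case
  proof (cases "k = d")
    case True
    with top show ?thesis by simp
  next
    case False
    with Suc.prems(1) show ?thesis by (intro lower) simp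
  qed
qed simp

definition rot :: "real \<Rightarrow> ('n \<Rightarrow> complex) \<Rightarrow> 'n \<Rightarrow> complex" where
  "rot t z = (\<lambda>i. cis t * z i)"

lemma rot_0 [simp]: "rot 0 z = z" by (simp add: rot_def)

lemma word_eval_rot: "word_eval (rot t z) \<alpha> = cis (t * length \<alpha>) * word_eval z \<alpha>"
  by (induction \<alpha>) (simp_all add: rot_def cis_mult[symmetric] algebra_simps flip: cis_mult)

lemma word_eval_scale: "word_eval (\<lambda>i. c * z i) \<alpha> = c ^ length \<alpha> * word_eval z \<alpha>"
  by (induction \<alpha>) simp_all

section \<open>Symmetries of the kernel\<close>

text \<open>A bijection of \<open>dom\<close> that transforms the kernel by a factor which depends on \<open>z\<close> and \<open>w\<close>
  separately.\<close>

locale kernel_symmetry = regular_polynomial a for a :: "'n::finite list \<Rightarrow> real" +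
  fixes \<phi> \<psi> :: "('n \<Rightarrow> complex) \<Rightarrow> 'n \<Rightarrow> complex"
  assumes \<phi>_dom: "\<And>z. z \<in> dom \<Longrightarrow> \<phi> z \<in> dom" and \<psi>_dom: "\<And>z. z \<in> dom \<Longrightarrow> \<psi> z \<in> dom"
    and \<phi>\<psi>: "\<And>z. z \<in> dom \<Longrightarrow> \<phi> (\<psi> z) = z" and \<psi>\<phi>: "\<And>z. z \<in> dom \<Longrightarrow> \<psi> (\<phi> z) = z"
    and identity: "\<And>z w. z \<in> dom \<Longrightarrow> w \<in> dom \<Longrightarrow>
      defect (\<phi> z) (\<phi> w) * defect z (\<psi> (\<lambda>_. 0)) * defect (\<psi> (\<lambda>_. 0)) w
        = defect z w * defect (\<psi> (\<lambda>_. 0)) (\<psi> (\<lambda>_. 0))"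
begin

abbreviation c where "c \<equiv> \<psi> (\<lambda>_. 0)"

lemma c_dom [simp]: "c \<in> dom" by (rule \<psi>_dom) simp

lemma rot_dom: "z \<in> dom \<Longrightarrow> rot t z \<in> dom"
  by (simp add: dom_def word_eval_rot norm_mult)

definition rot_deriv :: "('n \<Rightarrow> complex) \<Rightarrow> ('n \<Rightarrow> complex) \<Rightarrow> complex" where
  "rot_deriv z w = - (\<Sum>\<alpha>\<in>supp. of_real (a \<alpha> * length \<alpha>) * \<i> * word_eval z \<alpha> * cnj (word_eval w \<alpha>))"

lemma cis_has_deriv:
  "((\<lambda>t. cis (t * real k)) has_vector_derivative (real k * \<i>)) (at 0)"
  unfolding has_vector_derivative_complex_iff
  by (auto intro!: derivative_eq_intros)

lemma defect_rot_has_derivative: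
  "((\<lambda>t. defect (rot t z) w) has_vector_derivative rot_deriv z w) (at 0)"
proof -
  have "((\<lambda>t. 1 - (\<Sum>\<alpha>\<in>supp. of_real (a \<alpha>) * (cis (t * real (length \<alpha>)) * word_eval z \<alpha>) * cnj (word_eval w \<alpha>)))
    has_vector_derivative (0 - (\<Sum>\<alpha>\<in>supp. of_real (a \<alpha>) * ((real (length \<alpha>) * \<i>) * word_eval z \<alpha>) * cnj (word_eval w \<alpha>)))) (at 0)"
    by (intro has_vector_derivative_diff has_vector_derivative_const has_vector_derivative_sum
        has_vector_derivative_mult_left has_vector_derivative_mult_right cis_has_deriv)
  then show ?thesis
    by (simp add: defect_def form_def word_eval_rot rot_deriv_def mult_ac)
qed

lemma defect_rot_rot: "defect (rot t z) (rot t w) = defect z w"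
proof -
  have "(cis x * u) * cnj (cis x * w) = u * cnj w" for x u w
  proof -
    have "cis x * cnj (cis x) = 1" by (simp add: cis_cnj cis_mult)
    then have "(cis x * cnj (cis x)) * (u * cnj w) = u * cnj w" by simp
    then show ?thesis by (simp only: complex_cnj_mult mult_ac)
  qed
  note rotate = this
  show ?thesis
    unfolding defect_def form_def word_eval_rot mult.assoc[of "of_real _"] rotate ..
qed

definition unit_vec :: "'n \<Rightarrow> 'n \<Rightarrow> complex" where
  "unit_vec j = (\<lambda>i. if i = j then 1 else 0)"

text \<open>By the identity, \<open>P(\<phi> z, u)\<close> is a quotient of polynomials in \<open>z\<close> for every fixed
  \<open>u\<close>. For \<open>u\<close> on the \<open>j\<close>-th axis the linear term in \<open>u\<close> is \<open>a\<^sub>j \<phi>\<^sub>j(z)\<close>, and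
  \<open>differentiable_components\<close> extracts it.\<close>

lemma \<phi>_rot_differentiable:
  assumes z: "z \<in> dom"
  shows "(\<lambda>t. \<phi> (rot t z) j) differentiable at 0"
proof -
  obtain t0 where t0: "t0 > 0" "\<And>t. 0 \<le> t \<Longrightarrow> t \<le> t0 \<Longrightarrow> (\<lambda>i. of_real t * unit_vec j i) \<in> dom"
    using scale_in_dom[of "unit_vec j"] by blast
  define d where "d = Suc (Max (length ` supp))"
  have d: "length \<alpha> < d" if "\<alpha> \<in> supp" for \<alpha>
    using that by (simp add: d_def less_Suc_eq_le)
  define g where "g k t = (\<Sum>\<alpha>\<in>{\<alpha> \<in> supp. length \<alpha> = k}. of_real (a \<alpha>) * word_eval (\<phi> (rot t z)) \<alpha> * cnj (word_eval (unit_vec j) \<alpha>))" for k t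
  have expand: "form (\<phi> (rot t z)) (\<lambda>i. of_real \<tau> * unit_vec j i) = (\<Sum>k<d. of_real (\<tau> ^ k) * g k t)" for \<tau> t
  proof -
    have "form (\<phi> (rot t z)) (\<lambda>i. of_real \<tau> * unit_vec j i)
       = (\<Sum>\<alpha>\<in>supp. of_real (\<tau> ^ length \<alpha>) * (of_real (a \<alpha>) * word_eval (\<phi> (rot t z)) \<alpha> * cnj (word_eval (unit_vec j) \<alpha>)))"
      unfolding form_def word_eval_scale by (intro sum.cong refl) (simp add: mult_ac)
    also have "\<dots> = (\<Sum>k<d. \<Sum>\<alpha>\<in>{\<alpha> \<in> supp. length \<alpha> = k}. of_real (\<tau> ^ length \<alpha>) * (of_real (a \<alpha>) * word_eval (\<phi> (rot t z)) \<alpha> * cnj (word_eval (unit_vec j) \<alpha>)))"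
      by (rule sum.group[symmetric]) (use d in auto)
    also have "\<dots> = (\<Sum>k<d. of_real (\<tau> ^ k) * g k t)"
      unfolding g_def sum_distrib_left by (intro sum.cong refl) simp
    finally show ?thesis .
  qed
  have "(\<lambda>t. form (\<phi> (rot t z)) u) differentiable at 0" if u: "u \<in> dom" for u
  proof -
    have eq: "form (\<phi> (rot t z)) u = 1 - defect (rot t z) (\<psi> u) * defect c c / (defect (rot t z) c * defect c (\<psi> u))" for t
    proof -
      have "defect (\<phi> (rot t z)) u * defect (rot t z) c * defect c (\<psi> u) = defect (rot t z) (\<psi> u) * defect c c"
        using identity[OF rot_dom[OF z] \<psi>_dom[OF u]] \<phi>\<psi>[OF u] by simp
      then have "defect (\<phi> (rot t z)) u = defect (rot t z) (\<psi> u) * defect c c / (defect (rot t z) c * defect c (\<psi> u))"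
        using defect_nonzero[OF rot_dom[OF z] c_dom] defect_nonzero[OF c_dom \<psi>_dom[OF u]]
        by (simp add: field_simps)
      moreover have "form (\<phi> (rot t z)) u = 1 - defect (\<phi> (rot t z)) u" by (simp add: defect_def)
      ultimately show ?thesis by simp
    qed
    have dd: "(\<lambda>t. defect (rot t z) w) differentiable at 0" for w
      using defect_rot_has_derivative by (rule differentiableI_vector)
    show ?thesis
      unfolding eq
      by (intro differentiable_diff differentiable_const differentiable_divide differentiable_mult dd)
        (use defect_nonzero[OF z c_dom] defect_nonzero[OF c_dom \<psi>_dom[OF u]] in simp)
  qed
  then have "(\<lambda>t. \<Sum>k<d. of_real (\<tau> ^ k) * g k t) differentiable at 0" if "0 < \<tau>" "\<tau> \<le> t0" for \<tau>
    using t0(2)[of \<tau>] that unfolding expand[symmetric] by simp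
  then have "g 1 differentiable at 0"
    by (rule differentiable_components[OF t0(1)]) (use d[OF letter_in_support, of undefined] in auto)
  then have "(\<lambda>t. of_real (1 / a [j]) * g 1 t) differentiable at 0"
    by (intro differentiable_mult differentiable_const)
  moreover have "g 1 t = of_real (a [j]) * \<phi> (rot t z) j" for t
  proof -
    have "g 1 t = (\<Sum>\<alpha>\<in>supp. if length \<alpha> = 1 then of_real (a \<alpha>) * word_eval (\<phi> (rot t z)) \<alpha> * cnj (word_eval (unit_vec j) \<alpha>) else 0)"
      unfolding g_def by (rule sum.inter_filter) simp
    also have "\<dots> = (\<Sum>i\<in>UNIV. of_real (a [i]) * \<phi> (rot t z) i * cnj (unit_vec j i))"
      by (subst sum_length_1[OF finite_support]) (auto simp: supp_def)
    also have "\<dots> = (\<Sum>i\<in>UNIV. if i = j then of_real (a [j]) * \<phi> (rot t z) j else 0)"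
      by (intro sum.cong) (auto simp: unit_vec_def)
    finally show ?thesis by simp
  qed
  then have "of_real (1 / a [j]) * g 1 t = \<phi> (rot t z) j" for t
    using a_letter[of j] by (simp del: a_letter)
  ultimately show ?thesis by (simp only:)
qed

text \<open>The rotation field, transported by \<open>\<phi>\<close>.\<close>

definition velocity :: "('n \<Rightarrow> complex) \<Rightarrow> 'n \<Rightarrow> complex" where
  "velocity y j = vector_derivative (\<lambda>t. \<phi> (rot t (\<psi> y)) j) (at 0)"

lemma velocity_derivative:
  "y \<in> dom \<Longrightarrow> ((\<lambda>t. \<phi> (rot t (\<psi> y)) j) has_vector_derivative velocity y j) (at 0)"
  unfolding velocity_def using \<phi>_rot_differentiable[OF \<psi>_dom, of y j] vector_derivative_works by blast

text \<open>The logarithmic derivative of the factor \<open>F(z, c)\<close> along rotations, at the preimage of \<open>y\<close>.\<close>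

definition rot_rate :: "('n \<Rightarrow> complex) \<Rightarrow> complex" where
  "rot_rate y = rot_deriv (\<psi> y) c / defect (\<psi> y) c"

definition form_deriv :: "('n \<Rightarrow> complex) \<Rightarrow> ('n \<Rightarrow> complex) \<Rightarrow> ('n \<Rightarrow> complex) \<Rightarrow> ('n \<Rightarrow> complex) \<Rightarrow> complex" where
  "form_deriv y u w v = (\<Sum>\<alpha>\<in>supp. of_real (a \<alpha>) *
     (word_eval y \<alpha> * cnj (word_deriv w v \<alpha>) + word_deriv y u \<alpha> * cnj (word_eval w \<alpha>)))"

lemma form_has_derivative:
  assumes "\<And>i. ((\<lambda>t. y t i) has_vector_derivative u i) (at s)"
    and "\<And>i. ((\<lambda>t. w t i) has_vector_derivative v i) (at s)"
  shows "((\<lambda>t. form (y t) (w t)) has_vector_derivative form_deriv (y s) u (w s) v) (at s)"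
  unfolding form_def form_deriv_def mult.assoc
  by (intro has_vector_derivative_sum has_vector_derivative_mult_right has_vector_derivative_mult
      word_eval_has_deriv assms
      bounded_linear.has_vector_derivative[OF bounded_linear_cnj])

lemma defect_has_derivative:
  assumes "\<And>i. ((\<lambda>t. y t i) has_vector_derivative u i) (at s)"
    and "\<And>i. ((\<lambda>t. w t i) has_vector_derivative v i) (at s)"
  shows "((\<lambda>t. defect (y t) (w t)) has_vector_derivative - form_deriv (y s) u (w s) v) (at s)"
proof -
  have "((\<lambda>t. 1 - form (y t) (w t)) has_vector_derivative (0 - form_deriv (y s) u (w s) v)) (at s)"
    by (intro has_vector_derivative_diff has_vector_derivative_const form_has_derivative assms)
  then show ?thesis by (simp add: defect_def)
qed

text \<open>The derivative of the kernel identity at \<open>z = \<psi> y\<close>, \<open>\<psi> w\<close> along simultaneous rotation, which leaves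
  its right-hand side fixed.\<close>

lemma Killing_rate:
  assumes y: "y \<in> dom" and w: "w \<in> dom"
  shows "form_deriv y (velocity y) w (velocity w) = defect y w * (rot_rate y + cnj (rot_rate w))"
proof -
  define z x where "z = \<psi> y" and "x = \<psi> w"
  have zx: "z \<in> dom" "x \<in> dom" "\<phi> z = y" "\<phi> x = w"
    using y w by (simp_all add: z_def x_def \<psi>_dom \<phi>\<psi>)
  define F where "F t = defect (\<phi> (rot t z)) (\<phi> (rot t x))" for t
  have F: "(F has_vector_derivative - form_deriv y (velocity y) w (velocity w)) (at 0)"
    using defect_has_derivative[of "\<lambda>t. \<phi> (rot t z)" "velocity y" 0 "\<lambda>t. \<phi> (rot t x)" "velocity w"]
      velocity_derivative[OF y] velocity_derivative[OF w] zx by (simp add: F_def[abs_def] z_def x_def)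
  have G: "((\<lambda>t. defect (rot t z) c) has_vector_derivative rot_deriv z c) (at 0)"
    by (rule defect_rot_has_derivative)
  have "((\<lambda>t. cnj (defect (rot t x) c)) has_vector_derivative cnj (rot_deriv x c)) (at 0)"
    by (rule bounded_linear.has_vector_derivative[OF bounded_linear_cnj defect_rot_has_derivative])
  then have G': "((\<lambda>t. defect c (rot t x)) has_vector_derivative cnj (rot_deriv x c)) (at 0)"
    by (simp add: defect_cnj)
  have der: "((\<lambda>t. F t * defect (rot t z) c * defect c (rot t x)) has_vector_derivative
     (F 0 * defect (rot 0 z) c * cnj (rot_deriv x c) +
      (F 0 * rot_deriv z c + - form_deriv y (velocity y) w (velocity w) * defect (rot 0 z) c) * defect c (rot 0 x))) (at 0)"
    by (intro has_vector_derivative_mult F G G')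
  have "F t * defect (rot t z) c * defect c (rot t x) = defect z x * defect c c" for t
    unfolding F_def using identity[OF rot_dom[OF zx(1)] rot_dom[OF zx(2)], of t t] by (simp add: defect_rot_rot)
  then have "((\<lambda>t. F t * defect (rot t z) c * defect c (rot t x)) has_vector_derivative 0) (at 0)"
    by simp
  from vector_derivative_unique_at[OF this der]
  have "form_deriv y (velocity y) w (velocity w) * defect z c * defect c x
      = defect y w * (rot_deriv z c * defect c x + defect z c * cnj (rot_deriv x c))"
    by (simp add: F_def zx algebra_simps)
  moreover have nz: "defect z c \<noteq> 0" "defect c x \<noteq> 0" using zx by (simp_all add: defect_nonzero)
  then have "rot_deriv z c = rot_rate y * defect z c" "cnj (rot_deriv x c) = cnj (rot_rate w) * defect c x"
    by (simp_all add: rot_rate_def z_def x_def defect_cnj)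
  ultimately have "form_deriv y (velocity y) w (velocity w) * (defect z c * defect c x)
      = (defect y w * (rot_rate y + cnj (rot_rate w))) * (defect z c * defect c x)"
    by (simp add: algebra_simps)
  then show ?thesis using nz by simp
qed

abbreviation v where "v \<equiv> velocity (\<lambda>_. 0)"

definition ell :: "('n \<Rightarrow> complex) \<Rightarrow> complex" where
  "ell y = (\<Sum>i\<in>UNIV. of_real (a [i]) * y i * cnj (v i))"

lemma form_deriv_zero:
  "form_deriv y u (\<lambda>_. 0) w = (\<Sum>i\<in>UNIV. of_real (a [i]) * y i * cnj (w i))"
proof -
  have "form_deriv y u (\<lambda>_. 0) w = (\<Sum>\<alpha>\<in>supp. of_real (a \<alpha>) * word_eval y \<alpha> * cnj (if length \<alpha> = 1 then w (hd \<alpha>) else 0))"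
    unfolding form_deriv_def
  proof (rule sum.cong[OF refl])
    fix \<alpha> assume "\<alpha> \<in> supp"
    then have "\<alpha> \<noteq> []" using Nil_notin_support by blast
    then show "of_real (a \<alpha>) * (word_eval y \<alpha> * cnj (word_deriv (\<lambda>_. 0) w \<alpha>) + word_deriv y u \<alpha> * cnj (word_eval (\<lambda>_. 0) \<alpha>))
        = of_real (a \<alpha>) * word_eval y \<alpha> * cnj (if length \<alpha> = 1 then w (hd \<alpha>) else 0)"
      by (simp add: word_eval_zero word_deriv_at_zero)
  qed
  also have "\<dots> = (\<Sum>i\<in>UNIV. of_real (a [i]) * y i * cnj (w i))"
    by (subst sum_length_1[OF finite_support]) (auto simp: supp_def)
  finally show ?thesis .
qed

lemma ell_rate: "y \<in> dom \<Longrightarrow> ell y = rot_rate y + cnj (rot_rate (\<lambda>_. 0))"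
  using Killing_rate[of y "\<lambda>_. 0"] by (simp add: form_deriv_zero ell_def)

text \<open>Setting one argument to \<open>0\<close> expresses the unknown rates by the velocity at the origin.\<close>

lemma Killing:
  assumes "y \<in> dom" "w \<in> dom"
  shows "form_deriv y (velocity y) w (velocity w) = defect y w * (ell y + cnj (ell w))"
proof -
  have "rot_rate (\<lambda>_. 0) + cnj (rot_rate (\<lambda>_. 0)) = 0"
    using ell_rate[OF zero_in_dom] by (simp add: ell_def)
  then have "ell y + cnj (ell w) = rot_rate y + cnj (rot_rate w)"
    using assms by (simp add: ell_rate algebra_simps)
  then show ?thesis using Killing_rate[OF assms] by simp
qed

text \<open>If the field vanished at the origin, every rate would be minus the conjugate of the rate at the
  origin. All rates would then vanish, since the one at \<open>\<phi> 0\<close> does: its base point \<open>\<psi> (\<phi> 0) = 0\<close> is fixed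
  by rotations. But the rate at the origin is, up to a positive factor, \<open>- \<i>\<close> times a weighted sum of the
  \<open>\<bar>c\<^sub>\<alpha>\<bar>\<^sup>2\<close>, which is zero for \<open>c = 0\<close> only.\<close>

lemma v_nonzero:
  assumes "c \<noteq> (\<lambda>_. 0)"
  obtains i where "v i \<noteq> 0"
proof (rule ccontr)
  assume "\<not> thesis"
  then have v0: "v i = 0" for i using that by blast
  define y where "y = \<phi> (\<lambda>_. 0)"
  have y: "y \<in> dom" "\<psi> y = (\<lambda>_. 0)" by (simp_all add: y_def \<phi>_dom \<psi>\<phi>)
  have "rot_deriv (\<lambda>_. 0) c = 0"
    unfolding rot_deriv_def neg_equal_0_iff_equal
  proof (intro sum.neutral ballI)
    fix \<alpha> assume "\<alpha> \<in> supp"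
    then have "\<alpha> \<noteq> []" using Nil_notin_support by blast
    then show "of_real (a \<alpha> * length \<alpha>) * \<i> * word_eval (\<lambda>_. 0) \<alpha> * cnj (word_eval c \<alpha>) = 0"
      by (simp add: word_eval_zero)
  qed
  then have "rot_rate y = 0" by (simp add: rot_rate_def y)
  moreover have "ell y = 0" by (simp add: ell_def v0)
  ultimately have "rot_rate (\<lambda>_. 0) = 0" using ell_rate[OF y(1)] by simp
  then have "rot_deriv c c = 0" using defect_nonzero[OF c_dom c_dom] by (simp add: rot_rate_def)
  moreover have "rot_deriv c c = - \<i> * of_real (\<Sum>\<alpha>\<in>supp. a \<alpha> * length \<alpha> * (cmod (word_eval c \<alpha>))\<^sup>2)"
    unfolding rot_deriv_def of_real_sum sum_distrib_left sum_negf[symmetric]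
    by (intro sum.cong refl) (simp only: of_real_mult complex_norm_square, simp add: mult_ac)
  ultimately have "(\<Sum>\<alpha>\<in>supp. a \<alpha> * length \<alpha> * (cmod (word_eval c \<alpha>))\<^sup>2) = 0"
    by (simp del: of_real_sum)
  then have z: "\<forall>\<alpha>\<in>supp. a \<alpha> * length \<alpha> * (cmod (word_eval c \<alpha>))\<^sup>2 = 0"
    by (subst (asm) sum_nonneg_eq_0_iff) auto
  have "c i = 0" for i
    using z[rule_format, of "[i]"] a_letter[of i] by (simp del: a_letter)
  then show False using assms by auto
qed

lemma coefficient_sum_length_1:
  fixes g :: "'n list \<Rightarrow> complex"
  shows "(\<Sum>\<alpha>\<in>supp. of_real (a \<alpha>) * (if length \<alpha> = 1 then g \<alpha> else 0)) = (\<Sum>i\<in>UNIV. of_real (a [i]) * g [i])"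
  by (subst sum_length_1[OF finite_support]) (auto simp: supp_def)

lemma coefficient_sum_length_2:
  fixes g :: "'n list \<Rightarrow> complex"
  shows "(\<Sum>\<alpha>\<in>supp. of_real (a \<alpha>) * (if length \<alpha> = 2 then g \<alpha> else 0))
    = (\<Sum>i\<in>UNIV. \<Sum>k\<in>UNIV. of_real (a [i, k]) * g [i, k])"
  by (subst sum_length_2[OF finite_support]) (auto simp: supp_def)

lemma scaled_has_derivative:
  "((\<lambda>\<tau>::real. of_real \<tau> * (\<omega> i :: complex)) has_vector_derivative \<omega> i) (at s)"
proof -
  have "((\<lambda>\<tau>::real. of_real \<tau> * \<omega> i) has_vector_derivative 1 * \<omega> i) (at s)"
    using bounded_linear.has_vector_derivative[OF bounded_linear_of_real has_vector_derivative_id]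
    by (intro has_vector_derivative_mult_left) simp
  then show ?thesis by simp
qed

lemma ell_scale: "ell (\<lambda>i. z * y i) = z * ell y"
  by (simp add: ell_def sum_distrib_left mult_ac)

text \<open>Choose \<open>y\<close> on the \<open>j\<close>-th axis in the symmetry equation, with \<open>w = \<tau> \<omega>\<close>. The only unknown function of
  \<open>\<tau>\<close> is then \<open>cnj (velocity w j)\<close>, with coefficient \<open>q \<tau>\<close> where \<open>q 0 = a\<^sub>j t0 \<noteq> 0\<close>; the equation can
  be solved for it.\<close>

lemma velocity_differentiable:
  assumes \<omega>: "\<omega> \<in> dom"
  shows "(\<lambda>\<tau>. velocity (\<lambda>i. of_real \<tau> * \<omega> i) j) differentiable at 0"
proof -
  obtain t0 where t0: "t0 > 0" "\<And>t. 0 \<le> t \<Longrightarrow> t \<le> t0 \<Longrightarrow> (\<lambda>i. of_real t * unit_vec j i) \<in> dom"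
    using scale_in_dom[of "unit_vec j"] by blast
  define y where "y = (\<lambda>i. of_real t0 * unit_vec j i)"
  have y: "y \<in> dom" unfolding y_def by (rule t0(2)) (use t0(1) in auto)
  have yj: "y j = of_real t0" "\<And>i. i \<noteq> j \<Longrightarrow> y i = 0" by (simp_all add: y_def unit_vec_def)
  define w where "w \<tau> = (\<lambda>i. of_real \<tau> * \<omega> i)" for \<tau> :: real
  have w': "((\<lambda>\<tau>. w \<tau> i) has_vector_derivative \<omega> i) (at s)" for i s
    unfolding w_def by (rule scaled_has_derivative)
  have w0: "w 0 = (\<lambda>_. 0)" by (simp add: w_def)
  let ?q = "\<lambda>\<tau> \<alpha>. of_real (a \<alpha>) * (word_eval y \<alpha> * cnj (word_deriv (w \<tau>) (unit_vec j) \<alpha>))"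
  define q where "q \<tau> = (\<Sum>\<alpha>\<in>supp. ?q \<tau> \<alpha>)" for \<tau>
  define p where "p \<tau> = (\<Sum>\<alpha>\<in>supp. of_real (a \<alpha>) * (word_deriv y (velocity y) \<alpha> * cnj (word_eval (w \<tau>) \<alpha>)))" for \<tau>
  define r where "r \<tau> = defect y (w \<tau>) * (ell y + of_real \<tau> * cnj (ell \<omega>))" for \<tau>
  have q: "q differentiable at 0"
  proof (rule differentiableI_vector)
    show "(q has_vector_derivative (\<Sum>\<alpha>\<in>supp. of_real (a \<alpha>) * (word_eval y \<alpha> *
        cnj (word_deriv2 (w 0) (unit_vec j) \<omega> (\<lambda>_. 0) \<alpha>)))) (at 0)"
      unfolding q_def
      by (intro has_vector_derivative_sum has_vector_derivative_mult_right
          bounded_linear.has_vector_derivative[OF bounded_linear_cnj]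
          word_deriv_has_deriv has_vector_derivative_const w')
  qed
  have p: "p differentiable at 0"
  proof (rule differentiableI_vector)
    show "(p has_vector_derivative (\<Sum>\<alpha>\<in>supp. of_real (a \<alpha>) * (word_deriv y (velocity y) \<alpha> *
        cnj (word_deriv (w 0) \<omega> \<alpha>)))) (at 0)"
      unfolding p_def
      by (intro has_vector_derivative_sum has_vector_derivative_mult_right
          bounded_linear.has_vector_derivative[OF bounded_linear_cnj]
          word_eval_has_deriv w')
  qed
  have "(\<lambda>\<tau>. defect y (w \<tau>)) differentiable at 0"
    by (rule differentiableI_vector, rule defect_has_derivative, rule has_vector_derivative_const, rule w')
  moreover have "(\<lambda>\<tau>. complex_of_real \<tau> * cnj (ell \<omega>)) differentiable at 0"
    by (rule differentiableI_vector) (rule scaled_has_derivative[of "\<lambda>_. cnj (ell \<omega>)"])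
  ultimately have r: "r differentiable at 0"
    unfolding r_def by (rule differentiable_mult[OF _ differentiable_add[OF differentiable_const]])
  have q0: "q 0 = of_real (a [j] * t0)"
  proof -
    have "q 0 = (\<Sum>\<alpha>\<in>supp. of_real (a \<alpha>) * (if length \<alpha> = 1 then word_eval y \<alpha> * cnj (unit_vec j (hd \<alpha>)) else 0))"
      unfolding q_def w0 by (intro sum.cong refl) (simp add: word_deriv_at_zero)
    also have "\<dots> = (\<Sum>i\<in>UNIV. of_real (a [i]) * (y i * cnj (unit_vec j i)))"
      by (subst coefficient_sum_length_1) simp
    also have "\<dots> = (\<Sum>i\<in>UNIV. if i = j then of_real (a [j] * t0) else 0)"
      by (intro sum.cong) (auto simp: unit_vec_def yj)
    finally show ?thesis by simp
  qed
  have "continuous (at 0) q" by (rule differentiable_imp_continuous_within[OF q])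
  then have "q \<midarrow>0\<rightarrow> q 0" by (simp add: isCont_def)
  moreover have "q 0 \<noteq> 0" using q0 t0(1) a_letter[of j] by (simp del: a_letter)
  ultimately have "\<forall>\<^sub>F \<tau> in at 0. q \<tau> \<noteq> 0" by (rule tendsto_imp_eventually_ne)
  then obtain e where e: "e > 0" "\<And>\<tau>. \<tau> \<noteq> 0 \<Longrightarrow> \<bar>\<tau>\<bar> < e \<Longrightarrow> q \<tau> \<noteq> 0"
    by (auto simp: eventually_at)
  have solve: "velocity (w \<tau>) j = cnj ((r \<tau> - p \<tau>) / q \<tau>)" if \<tau>: "\<bar>\<tau>\<bar> < min e 1" for \<tau>
  proof -
    have wd: "w \<tau> \<in> dom" unfolding w_def by (rule dom_scale[OF \<omega>]) (use \<tau> in simp)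
    have q\<tau>: "q \<tau> \<noteq> 0" using e(2)[of \<tau>] \<tau> \<open>q 0 \<noteq> 0\<close> by (cases "\<tau> = 0") auto
    have "r \<tau> = form_deriv y (velocity y) (w \<tau>) (velocity (w \<tau>))"
      unfolding r_def Killing[OF y wd] by (simp add: w_def ell_scale)
    also have "\<dots> = (\<Sum>\<alpha>\<in>supp. cnj (velocity (w \<tau>) j) * (?q \<tau> \<alpha>)
        + of_real (a \<alpha>) * (word_deriv y (velocity y) \<alpha> * cnj (word_eval (w \<tau>) \<alpha>)))"
      unfolding form_deriv_def
    proof (rule sum.cong[OF refl])
      fix \<alpha>
      have "word_eval y \<alpha> * cnj (word_deriv (w \<tau>) (velocity (w \<tau>)) \<alpha>)
          = cnj (velocity (w \<tau>) j) * (word_eval y \<alpha> * cnj (word_deriv (w \<tau>) (unit_vec j) \<alpha>))"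
      proof (cases "word_eval y \<alpha> = 0")
        case False
        then show ?thesis
          using word_deriv_supported[of j y \<alpha> "w \<tau>" "velocity (w \<tau>)"] yj(2) by (simp add: unit_vec_def)
      qed simp
      note pull_out = this
      show "of_real (a \<alpha>) * (word_eval y \<alpha> * cnj (word_deriv (w \<tau>) (velocity (w \<tau>)) \<alpha>) + word_deriv y (velocity y) \<alpha> * cnj (word_eval (w \<tau>) \<alpha>))
        = cnj (velocity (w \<tau>) j) * (?q \<tau> \<alpha>)
        + of_real (a \<alpha>) * (word_deriv y (velocity y) \<alpha> * cnj (word_eval (w \<tau>) \<alpha>))"
        unfolding pull_out distrib_left by (simp only: mult.left_commute)
    qed
    also have "\<dots> = cnj (velocity (w \<tau>) j) * q \<tau> + p \<tau>"
      unfolding q_def p_def by (simp add: sum.distrib sum_distrib_left)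
    finally have "cnj (velocity (w \<tau>) j) = (r \<tau> - p \<tau>) / q \<tau>" using q\<tau> by (simp add: field_simps)
    then show ?thesis by (metis complex_cnj_cnj)
  qed
  have "(\<lambda>\<tau>. (r \<tau> - p \<tau>) / q \<tau>) differentiable at 0"
    using \<open>q 0 \<noteq> 0\<close> by (intro differentiable_divide differentiable_diff p q r)
  then have "((\<lambda>\<tau>. (r \<tau> - p \<tau>) / q \<tau>) has_vector_derivative vector_derivative (\<lambda>\<tau>. (r \<tau> - p \<tau>) / q \<tau>) (at 0)) (at 0)"
    by (simp add: vector_derivative_works)
  then have "((\<lambda>\<tau>. cnj ((r \<tau> - p \<tau>) / q \<tau>)) has_vector_derivative cnj (vector_derivative (\<lambda>\<tau>. (r \<tau> - p \<tau>) / q \<tau>) (at 0))) (at 0)"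
    by (rule bounded_linear.has_vector_derivative[OF bounded_linear_cnj])
  then have "((\<lambda>\<tau>. velocity (w \<tau>) j) has_vector_derivative cnj (vector_derivative (\<lambda>\<tau>. (r \<tau> - p \<tau>) / q \<tau>) (at 0))) (at 0)"
    by (rule has_vector_derivative_transform_within[where d = "min e 1"]) (use e solve in \<open>auto simp: dist_real_def\<close>)
  then show ?thesis unfolding w_def by (rule differentiableI_vector)
qed

text \<open>The contribution of the words of length two to the quadratic part of the field; \<open>ell\<close> is that of
  the letters.\<close>

definition excess :: "('n \<Rightarrow> complex) \<Rightarrow> 'n \<Rightarrow> complex" where
  "excess y j = (\<Sum>i\<in>UNIV. of_real ((a [i, j] + a [j, i]) / a [j]) * cnj (v i) * y i)"

text \<open>The derivative at \<open>\<tau> = 0\<close> of the symmetry equation with \<open>w = \<tau> \<omega>\<close>, for \<open>\<omega>\<close> on the \<open>j\<close>-th axis. Words of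
  length at least three have vanishing second derivative at the origin, so that the quadratic part of
  the field involves the coefficients of degrees one and two of \<open>f\<close> alone. The linear part \<open>\<beta>\<close> comes
  from the derivative of the field at the origin.\<close>

lemma velocity_quadratic:
  "\<exists>\<beta>. \<forall>y\<in>dom. \<forall>j. velocity y j = v j + (\<Sum>i\<in>UNIV. \<beta> j i * y i)
     - y j * (ell y + excess y j)"
proof -
  define R where "R j \<beta> \<longleftrightarrow> (\<forall>y\<in>dom. velocity y j = v j + (\<Sum>i\<in>UNIV. \<beta> i * y i)
     - y j * (ell y + excess y j))" for j \<beta>
  have "\<exists>\<beta>. R j \<beta>" for j
  proof -
    obtain \<epsilon> where \<epsilon>: "\<epsilon> > 0" "\<And>t. 0 \<le> t \<Longrightarrow> t \<le> \<epsilon> \<Longrightarrow> (\<lambda>i. of_real t * unit_vec j i) \<in> dom"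
      using scale_in_dom[of "unit_vec j"] by blast
    define \<omega> where "\<omega> = (\<lambda>i. of_real \<epsilon> * unit_vec j i)"
    have \<omega>: "\<omega> \<in> dom" unfolding \<omega>_def by (rule \<epsilon>(2)) (use \<epsilon>(1) in auto)
    define w where "w \<tau> = (\<lambda>i. of_real \<tau> * \<omega> i)" for \<tau> :: real
    have w': "((\<lambda>\<tau>. w \<tau> i) has_vector_derivative \<omega> i) (at s)" for i s
      unfolding w_def by (rule scaled_has_derivative)
    have w0: "w 0 = (\<lambda>_. 0)" by (simp add: w_def)
    define L where "L i = vector_derivative (\<lambda>\<tau>. velocity (w \<tau>) i) (at 0)" for i
    have L: "((\<lambda>\<tau>. velocity (w \<tau>) i) has_vector_derivative L i) (at 0)" for i
      unfolding L_def w_def using velocity_differentiable[OF \<omega>] vector_derivative_works by blast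
    have sum_unit: "(\<Sum>i\<in>UNIV. g i * cnj (\<omega> i)) = of_real \<epsilon> * g j" for g
    proof -
      have "(\<Sum>i\<in>UNIV. g i * cnj (\<omega> i)) = (\<Sum>i\<in>UNIV. if i = j then of_real \<epsilon> * g j else 0)"
        by (intro sum.cong) (auto simp: \<omega>_def unit_vec_def)
      then show ?thesis by simp
    qed
    define \<beta> where "\<beta> i = - of_real (a [i]) * cnj (L i) / (of_real (a [j]) * of_real \<epsilon>)" for i
    have "velocity y j = v j + (\<Sum>i\<in>UNIV. \<beta> i * y i)
     - y j * (ell y + excess y j)" if y: "y \<in> dom" for y
    proof -
      let ?N = "\<Sum>i\<in>UNIV. of_real (a [i]) * (y i * cnj (L i))"
      define Q where "Q = (\<Sum>i\<in>UNIV. of_real (a [i, j] + a [j, i]) * cnj (v i) * y i)"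
      have left: "((\<lambda>\<tau>. form_deriv y (velocity y) (w \<tau>) (velocity (w \<tau>))) has_vector_derivative
          (\<Sum>\<alpha>\<in>supp. of_real (a \<alpha>) * (word_eval y \<alpha> * cnj (word_deriv2 (w 0) (velocity (w 0)) \<omega> L \<alpha>)
            + word_deriv y (velocity y) \<alpha> * cnj (word_deriv (w 0) \<omega> \<alpha>)))) (at 0)"
        unfolding form_deriv_def
        by (intro has_vector_derivative_sum has_vector_derivative_mult_right has_vector_derivative_add
          bounded_linear.has_vector_derivative[OF bounded_linear_cnj]
          word_deriv_has_deriv word_eval_has_deriv w' L)
      have der: "((\<lambda>\<tau>. defect y (w \<tau>) * (ell y + of_real \<tau> * cnj (ell \<omega>))) has_vector_derivative
          (defect y (w 0) * (0 + cnj (ell \<omega>)) + - form_deriv y (\<lambda>_. 0) (w 0) \<omega> * (ell y + of_real 0 * cnj (ell \<omega>)))) (at 0)"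
        by (intro has_vector_derivative_mult has_vector_derivative_add has_vector_derivative_const
            defect_has_derivative w' scaled_has_derivative[of "\<lambda>_. cnj (ell \<omega>)"])
      have eq: "defect y (w \<tau>) * (ell y + of_real \<tau> * cnj (ell \<omega>)) = form_deriv y (velocity y) (w \<tau>) (velocity (w \<tau>))"
        if "\<tau> \<in> {-1<..<1}" for \<tau>
      proof -
        have "w \<tau> \<in> dom" unfolding w_def by (rule dom_scale[OF \<omega>]) (use that in auto)
        then show ?thesis by (simp add: Killing[OF y] w_def ell_scale)
      qed
      have val: "defect y (w 0) * (0 + cnj (ell \<omega>)) + - form_deriv y (\<lambda>_. 0) (w 0) \<omega> * (ell y + of_real 0 * cnj (ell \<omega>))
          = cnj (ell \<omega>) - form_deriv y (\<lambda>_. 0) (\<lambda>_. 0) \<omega> * ell y"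
        by (simp add: w0)
      have right: "((\<lambda>\<tau>. form_deriv y (velocity y) (w \<tau>) (velocity (w \<tau>))) has_vector_derivative
          (cnj (ell \<omega>) - form_deriv y (\<lambda>_. 0) (\<lambda>_. 0) \<omega> * ell y)) (at 0)"
        by (rule has_vector_derivative_transform_within_open[OF der[unfolded val] open_greaterThanLessThan[of "-1" 1] _ eq]) simp_all
      have "of_real \<epsilon> * (of_real (a [j]) * velocity y j)
          + (?N + of_real \<epsilon> * (y j * Q))
          = of_real \<epsilon> * (of_real (a [j]) * v j) - of_real \<epsilon> * (of_real (a [j]) * y j) * ell y"
      proof -
        have "(\<Sum>\<alpha>\<in>supp. of_real (a \<alpha>) * (word_eval y \<alpha> * cnj (word_deriv2 (w 0) (velocity (w 0)) \<omega> L \<alpha>)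
            + word_deriv y (velocity y) \<alpha> * cnj (word_deriv (w 0) \<omega> \<alpha>)))
          = (\<Sum>\<alpha>\<in>supp. of_real (a \<alpha>) * (if length \<alpha> = 1 then word_deriv y (velocity y) \<alpha> * cnj (\<omega> (hd \<alpha>)) else 0))
          + (\<Sum>\<alpha>\<in>supp. of_real (a \<alpha>) * (if length \<alpha> = 1 then word_eval y \<alpha> * cnj (L (hd \<alpha>)) else 0))
          + (\<Sum>\<alpha>\<in>supp. of_real (a \<alpha>) * (if length \<alpha> = 2 then word_eval y \<alpha> * cnj (v (hd \<alpha>) * \<omega> (\<alpha> ! 1) + \<omega> (hd \<alpha>) * v (\<alpha> ! 1)) else 0))"
          unfolding sum.distrib[symmetric] w0 word_deriv2_at_zero word_deriv_at_zero
          by (intro sum.cong refl) (simp add: algebra_simps)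
        also have "(\<Sum>\<alpha>\<in>supp. of_real (a \<alpha>) * (if length \<alpha> = 1 then word_deriv y (velocity y) \<alpha> * cnj (\<omega> (hd \<alpha>)) else 0))
            = of_real \<epsilon> * (of_real (a [j]) * velocity y j)"
          unfolding coefficient_sum_length_1 using sum_unit[of "\<lambda>i. of_real (a [i]) * velocity y i"]
          by (simp add: mult.assoc)
        also have "(\<Sum>\<alpha>\<in>supp. of_real (a \<alpha>) * (if length \<alpha> = 1 then word_eval y \<alpha> * cnj (L (hd \<alpha>)) else 0))
            = ?N"
          unfolding coefficient_sum_length_1 by simp
        also have "(\<Sum>\<alpha>\<in>supp. of_real (a \<alpha>) * (if length \<alpha> = 2 then word_eval y \<alpha> * cnj (v (hd \<alpha>) * \<omega> (\<alpha> ! 1) + \<omega> (hd \<alpha>) * v (\<alpha> ! 1)) else 0))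
            = (\<Sum>i\<in>UNIV. \<Sum>k\<in>UNIV. (of_real (a [i, k]) * y i * y k * cnj (v i)) * cnj (\<omega> k))
            + (\<Sum>i\<in>UNIV. \<Sum>k\<in>UNIV. (of_real (a [i, k]) * y i * y k * cnj (v k)) * cnj (\<omega> i))"
          unfolding coefficient_sum_length_2 sum.distrib[symmetric]
          by (intro sum.cong refl) (simp add: algebra_simps)
        also have "(\<Sum>i\<in>UNIV. \<Sum>k\<in>UNIV. (of_real (a [i, k]) * y i * y k * cnj (v k)) * cnj (\<omega> i))
            = (\<Sum>k\<in>UNIV. \<Sum>i\<in>UNIV. (of_real (a [i, k]) * y i * y k * cnj (v k)) * cnj (\<omega> i))"
          by (rule sum.swap)
        also have "(\<Sum>i\<in>UNIV. \<Sum>k\<in>UNIV. (of_real (a [i, k]) * y i * y k * cnj (v i)) * cnj (\<omega> k))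
            + (\<Sum>k\<in>UNIV. \<Sum>i\<in>UNIV. (of_real (a [i, k]) * y i * y k * cnj (v k)) * cnj (\<omega> i))
            = of_real \<epsilon> * (y j * Q)"
          unfolding sum_unit Q_def sum.distrib[symmetric] sum_distrib_left
          by (intro sum.cong refl) (simp add: algebra_simps)
        finally have "of_real \<epsilon> * (of_real (a [j]) * velocity y j)
          + (?N + of_real \<epsilon> * (y j * Q))
          = cnj (ell \<omega>) - form_deriv y (\<lambda>_. 0) (\<lambda>_. 0) \<omega> * ell y"
          using vector_derivative_unique_at[OF left right] by (simp add: add.assoc)
        moreover have "cnj (ell \<omega>) = of_real \<epsilon> * (of_real (a [j]) * v j)"
          unfolding ell_def using sum_unit[of "\<lambda>i. of_real (a [i]) * v i"] by (simp add: mult_ac)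
        moreover have "form_deriv y (\<lambda>_. 0) (\<lambda>_. 0) \<omega> = of_real \<epsilon> * (of_real (a [j]) * y j)"
          unfolding form_deriv_zero by (rule sum_unit)
        ultimately show ?thesis by simp
      qed
      then have main: "of_real \<epsilon> * of_real (a [j]) * velocity y j
          = of_real \<epsilon> * of_real (a [j]) * v j - ?N
            - y j * (of_real \<epsilon> * of_real (a [j]) * ell y + of_real \<epsilon> * Q)"
        by (simp add: algebra_simps eq_diff_eq)
      define k where "k = complex_of_real \<epsilon> * of_real (a [j])"
      have k: "k \<noteq> 0" using \<epsilon>(1) a_letter[of j] by (simp add: k_def del: a_letter)
      have "k * (\<Sum>i\<in>UNIV. \<beta> i * y i) = - ?N"
        unfolding sum_distrib_left sum_negf[symmetric]
        by (intro sum.cong refl) (use k in \<open>simp add: \<beta>_def k_def field_simps\<close>)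
      moreover have "k * excess y j = of_real \<epsilon> * Q"
        unfolding excess_def sum_distrib_left Q_def
        by (intro sum.cong refl) (use a_letter[of j] in \<open>simp add: k_def field_simps del: a_letter\<close>)
      moreover have "k * (p + q - r * (s + u)) = k * p + k * q - r * (k * s + k * u)" for p q r s u
        by (simp add: algebra_simps)
      moreover have "k * velocity y j = k * v j + - ?N
            - y j * (k * ell y + of_real \<epsilon> * Q)"
        using main unfolding k_def[symmetric] by simp
      ultimately have "k * velocity y j = k * (v j + (\<Sum>i\<in>UNIV. \<beta> i * y i)
        - y j * (ell y + excess y j))"
        by (simp only:)
      then show ?thesis using k by simp
    qed
    then show ?thesis unfolding R_def by (intro exI[of _ \<beta>] ballI)
  qed
  then have "\<exists>\<beta>. \<forall>j. R j (\<beta> j)" by (intro choice allI)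
  then show ?thesis unfolding R_def by blast
qed

lemma sum_list_minus_scale:
  "(\<Sum>i\<leftarrow>\<alpha>. C i / s + B i - s * E i) = (\<Sum>i\<leftarrow>\<alpha>. C i) / s + (\<Sum>i\<leftarrow>\<alpha>. B i) - s * (\<Sum>i\<leftarrow>\<alpha>. E i)" for s :: complex
proof (induction \<alpha>)
  case (Cons i \<alpha>)
  show ?case
    unfolding list.map sum_list.Cons Cons.IH by (simp add: add_divide_distrib distrib_left)
qed simp

text \<open>Insert \<open>y = w = t \<zeta>\<close> into the symmetry equation, with real \<open>t\<close> and with \<open>\<zeta>\<close> chosen such that
  \<open>cnj (v j) \<zeta>\<^sub>j = \<bar>v j\<bar>\<^sup>2\<close>. Then the quadratic part of the field at \<open>t \<zeta>\<close> has the coordinates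
  \<open>- t\<^sup>2 \<zeta>\<^sub>j (l + m\<^sub>j)\<close> with \<open>l > 0\<close> and \<open>m\<^sub>j \<ge> 0\<close>. The coefficient of \<open>t ^ (2 d + 1)\<close>, where
  \<open>d\<close> is the degree of \<open>f\<close>, compares \<open>l\<close> with the sum of the \<open>l + m\<^sub>i\<close> over the \<open>d\<close> letters of a word
  of top degree.\<close>

theorem linear_if_moves_origin:
  assumes c: "c \<noteq> (\<lambda>_. 0)" and \<alpha>: "\<alpha> \<in> supp"
  shows "length \<alpha> = 1"
proof (rule ccontr)
  assume "length \<alpha> \<noteq> 1"
  moreover have "length \<alpha> \<noteq> 0" using \<alpha> by auto
  ultimately have two: "2 \<le> length \<alpha>" by linarith
  define d where "d = Max (length ` supp)"
  have d: "length \<beta> \<le> d" if "\<beta> \<in> supp" for \<beta> using that by (simp add: d_def)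
  have "d \<in> length ` supp" unfolding d_def by (rule Max_in) (use \<alpha> in auto)
  then obtain \<alpha>d where \<alpha>d: "\<alpha>d \<in> supp" "length \<alpha>d = d" by auto
  have d2: "2 \<le> d" using d[OF \<alpha>] two by linarith
  \<comment> \<open>Nonzero coordinates allow division by \<open>\<zeta> j\<close>; where \<open>v j = 0\<close> any nonzero value will do.\<close>
  define \<zeta> where "\<zeta> j = (if v j = 0 then 1 else v j)" for j
  have \<zeta>0: "\<zeta> j \<noteq> 0" for j by (simp add: \<zeta>_def)
  have cnj\<zeta>: "cnj (v j) * \<zeta> j = of_real ((cmod (v j))\<^sup>2)" for j
    by (simp only: \<zeta>_def complex_norm_square mult.commute) simp
  obtain t0 where t0: "t0 > 0" "\<And>t. 0 \<le> t \<Longrightarrow> t \<le> t0 \<Longrightarrow> (\<lambda>i. of_real t * \<zeta> i) \<in> dom"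
    using scale_in_dom[of \<zeta>] by blast
  obtain \<beta> where \<beta>: "\<And>y j. y \<in> dom \<Longrightarrow> velocity y j = v j + (\<Sum>i\<in>UNIV. \<beta> j i * y i)
     - y j * (ell y + excess y j)"
    using velocity_quadratic by blast
  define l where "l = (\<Sum>i\<in>UNIV. a [i] * (cmod (v i))\<^sup>2)"
  define m where "m j = (\<Sum>i\<in>UNIV. (a [i, j] + a [j, i]) / a [j] * (cmod (v i))\<^sup>2)" for j
  have ell\<zeta>: "ell \<zeta> = of_real l"
    unfolding ell_def l_def of_real_sum of_real_mult cnj\<zeta>[symmetric] by (simp only: mult_ac)
  have m\<zeta>: "excess \<zeta> j = of_real (m j)" for j
    unfolding excess_def m_def of_real_sum of_real_mult cnj\<zeta>[symmetric] by (simp add: mult.assoc)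
  have m0: "m j \<ge> 0" for j unfolding m_def by (intro sum_nonneg) simp
  have l0: "l > 0"
  proof -
    obtain i where i: "v i \<noteq> 0" by (rule v_nonzero[OF c])
    show ?thesis unfolding l_def
      by (rule sum_pos2[of _ i]) (use i a_letter[of i] in auto)
  qed
  define B where "B j = (\<Sum>i\<in>UNIV. \<beta> j i * \<zeta> i) / \<zeta> j" for j
  define Z where "Z \<alpha> = a \<alpha> * (cmod (word_eval \<zeta> \<alpha>))\<^sup>2" for \<alpha>
  define C1 where "C1 \<alpha> = Re (\<Sum>i\<leftarrow>\<alpha>. v i / \<zeta> i)" for \<alpha>
  define B1 where "B1 \<alpha> = Re (\<Sum>i\<leftarrow>\<alpha>. B i)" for \<alpha>
  define E1 where "E1 \<alpha> = (\<Sum>i\<leftarrow>\<alpha>. l + m i)" for \<alpha>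
  have E1: "E1 \<alpha> \<ge> real (length \<alpha>) * l" for \<alpha>
    unfolding E1_def
  proof (induction \<alpha>)
    case (Cons i \<alpha>)
    then show ?case using m0[of i] by (simp add: algebra_simps)
  qed simp
  \<comment> \<open>The real part of the symmetry equation at \<open>t \<zeta>\<close>, multiplied by \<open>t\<close> to clear the denominator that
    comes from the constant part of the field.\<close>
  define q where "q \<alpha> = monom (Z \<alpha> * C1 \<alpha>) (2 * length \<alpha>) + monom (Z \<alpha> * B1 \<alpha>) (2 * length \<alpha> + 1)
      - monom (Z \<alpha> * E1 \<alpha>) (2 * length \<alpha> + 2) + monom (Z \<alpha> * l) (2 * length \<alpha> + 2)" for \<alpha>
  define p where "p = (\<Sum>\<alpha>\<in>supp. q \<alpha>) - monom l 2"
  have "poly p t = 0" if t: "0 < t" "t \<le> t0" for t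
  proof -
    let ?X = "\<Sum>\<alpha>\<in>supp. Z \<alpha> * t ^ (2 * length \<alpha>) * (C1 \<alpha> / t + B1 \<alpha> - t * E1 \<alpha>)"
    let ?Y = "\<Sum>\<alpha>\<in>supp. Z \<alpha> * t ^ (2 * length \<alpha>)"
    define y where "y = (\<lambda>i. of_real t * \<zeta> i)"
    have y: "y \<in> dom" unfolding y_def by (rule t0(2)) (use t in auto)
    have y0: "y i \<noteq> 0" for i using t \<zeta>0 by (simp add: y_def)
    have elly: "ell y = of_real (t * l)" by (simp add: y_def ell_scale ell\<zeta>)
    have "excess y j
        = of_real t * excess \<zeta> j" for j
      unfolding y_def excess_def sum_distrib_left by (intro sum.cong refl) (simp add: mult_ac)
    then have my: "excess y j = of_real (t * m j)" for j
      unfolding m\<zeta> by simp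
    have "(\<Sum>i\<in>UNIV. \<beta> j i * y i) = of_real t * (\<Sum>i\<in>UNIV. \<beta> j i * \<zeta> i)" for j
      unfolding y_def sum_distrib_left by (intro sum.cong refl) (simp add: mult_ac)
    then have By: "(\<Sum>i\<in>UNIV. \<beta> j i * y i) = y j * B j" for j
      using \<zeta>0[of j] by (simp add: y_def B_def)
    have quot: "velocity y j / y j = v j / \<zeta> j / of_real t + B j - of_real t * of_real (l + m j)" for j
    proof -
      have "velocity y j = v j + y j * B j - y j * (of_real (t * l) + of_real (t * m j))"
        unfolding \<beta>[OF y] elly my By ..
      then have "velocity y j / y j = v j / y j + B j - (of_real (t * l) + of_real (t * m j))"
        using y0[of j] by (simp add: add_divide_distrib diff_divide_distrib)
      then show ?thesis by (simp add: y_def algebra_simps)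
    qed
    define S where "S \<alpha> = (\<Sum>i\<leftarrow>\<alpha>. velocity y i / y i)" for \<alpha>
    have ReS: "Re (S \<alpha>) = C1 \<alpha> / t + B1 \<alpha> - t * E1 \<alpha>" for \<alpha>
    proof -
      have "S \<alpha> = (\<Sum>i\<leftarrow>\<alpha>. v i / \<zeta> i) / of_real t + (\<Sum>i\<leftarrow>\<alpha>. B i) - of_real t * (\<Sum>i\<leftarrow>\<alpha>. of_real (l + m i))"
        unfolding S_def quot by (rule sum_list_minus_scale)
      also have "(\<Sum>i\<leftarrow>\<alpha>. complex_of_real (l + m i)) = of_real (E1 \<alpha>)"
        unfolding E1_def by (induction \<alpha>) simp_all
      finally show ?thesis by (simp add: C1_def B1_def Re_divide_of_real)
    qed
    have Zt: "a \<alpha> * (cmod (word_eval y \<alpha>))\<^sup>2 = Z \<alpha> * t ^ (2 * length \<alpha>)" for \<alpha>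
      using t by (simp add: y_def word_eval_scale Z_def norm_mult norm_power power_mult_distrib power_mult[symmetric] mult_ac)
    have "2 * (\<Sum>\<alpha>\<in>supp. Z \<alpha> * t ^ (2 * length \<alpha>) * Re (S \<alpha>)) = Re (form_deriv y (velocity y) y (velocity y))"
      unfolding form_deriv_def Re_sum sum_distrib_left
    proof (rule sum.cong[OF refl])
      fix \<alpha>
      have "of_real (a \<alpha>) * (word_eval y \<alpha> * cnj (word_deriv y (velocity y) \<alpha>) + word_deriv y (velocity y) \<alpha> * cnj (word_eval y \<alpha>))
          = of_real (a \<alpha>) * (word_eval y \<alpha> * cnj (word_eval y \<alpha>)) * (S \<alpha> + cnj (S \<alpha>))"
        unfolding word_deriv_nonzero[OF y0] S_def[symmetric] by (simp add: algebra_simps)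
      also have "\<dots> = of_real (a \<alpha> * (cmod (word_eval y \<alpha>))\<^sup>2) * (S \<alpha> + cnj (S \<alpha>))"
        by (simp only: of_real_mult complex_norm_square)
      also have "Re \<dots> = 2 * (a \<alpha> * (cmod (word_eval y \<alpha>))\<^sup>2 * Re (S \<alpha>))"
        by (simp only: complex_add_cnj of_real_mult[symmetric] Re_complex_of_real) 
      finally show "2 * (Z \<alpha> * t ^ (2 * length \<alpha>) * Re (S \<alpha>))
        = Re (of_real (a \<alpha>) * (word_eval y \<alpha> * cnj (word_deriv y (velocity y) \<alpha>) + word_deriv y (velocity y) \<alpha> * cnj (word_eval y \<alpha>)))"
        unfolding Zt by simp
    qed
    also have "\<dots> = Re (defect y y * (ell y + cnj (ell y)))"
      unfolding Killing[OF y y] ..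
    also have "\<dots> = Re (defect y y) * (2 * (t * l))"
      unfolding elly by (subst defect_self) simp
    also have "Re (defect y y) = 1 - ?Y"
      by (simp add: defect_def form_self Zt)
    finally have "?X
        = (1 - ?Y) * (t * l)"
      unfolding ReS by simp
    then have "t * ?X
        = t * ((1 - ?Y) * (t * l))"
      by (simp only:)
    also have "\<dots> = l * t\<^sup>2 - ?Y * (l * t\<^sup>2)"
      by (simp only: power2_eq_square left_diff_distrib right_diff_distrib mult_1_left mult_ac)
    finally have "t * ?X
        = l * t\<^sup>2 - (\<Sum>\<alpha>\<in>supp. Z \<alpha> * t ^ (2 * length \<alpha>) * (l * t\<^sup>2))"
      by (simp only: sum_distrib_right)
    moreover have summand: "poly (q \<alpha>) t
      = t * (Z \<alpha> * t ^ (2 * length \<alpha>) * (C1 \<alpha> / t + B1 \<alpha> - t * E1 \<alpha>))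
        + Z \<alpha> * t ^ (2 * length \<alpha>) * (l * t\<^sup>2)" for \<alpha>
    proof -
      define D where "D = C1 \<alpha> / t"
      define P where "P = t ^ (2 * length \<alpha>)"
      have C1: "C1 \<alpha> = t * D" using t by (simp add: D_def)
      have pw: "t ^ (2 * length \<alpha> + 1) = P * t" "t ^ (2 * length \<alpha> + 2) = P * (t * t)"
        by (simp_all add: P_def power_add power2_eq_square)
      have "poly (q \<alpha>) t
        = Z \<alpha> * (t * D) * P + Z \<alpha> * B1 \<alpha> * (P * t) - Z \<alpha> * E1 \<alpha> * (P * (t * t)) + Z \<alpha> * l * (P * (t * t))"
        by (simp only: q_def poly_add poly_diff poly_monom pw P_def[symmetric] C1)
      also have "\<dots> = t * (Z \<alpha> * P * (D + B1 \<alpha> - t * E1 \<alpha>)) + Z \<alpha> * P * (l * t\<^sup>2)"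
        by (simp add: power2_eq_square algebra_simps)
      finally show ?thesis unfolding P_def D_def .
    qed
    have "poly p t = t * ?X
        + (\<Sum>\<alpha>\<in>supp. Z \<alpha> * t ^ (2 * length \<alpha>) * (l * t\<^sup>2)) - l * t\<^sup>2"
      unfolding p_def poly_diff poly_sum summand sum.distrib sum_distrib_left poly_monom ..
    ultimately show ?thesis by simp
  qed
  then have "{0<..t0} \<subseteq> {t. poly p t = 0}" by auto
  moreover have "infinite {0<..t0}" using t0(1) by simp
  ultimately have "infinite {t. poly p t = 0}" using finite_subset by blast
  then have "p = 0" using poly_roots_finite by blast
  then have "coeff p (2 * d + 2) = 0" by simp
  moreover have "coeff p (2 * d + 2) = (\<Sum>\<alpha>\<in>supp. if length \<alpha> = d then Z \<alpha> * l - Z \<alpha> * E1 \<alpha> else 0)"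
  proof -
    have "coeff (q \<alpha>) (2 * d + 2) = (if length \<alpha> = d then Z \<alpha> * l - Z \<alpha> * E1 \<alpha> else 0)" if "\<alpha> \<in> supp" for \<alpha>
      using d[OF that] unfolding q_def by auto
    moreover have "coeff (monom l 2) (2 * d + 2) = 0" using d2 by simp
    ultimately show ?thesis unfolding p_def coeff_diff coeff_sum by simp
  qed
  ultimately have "(\<Sum>\<alpha>\<in>supp. if length \<alpha> = d then Z \<alpha> * l - Z \<alpha> * E1 \<alpha> else 0) = 0"
    by simp
  moreover have "(\<Sum>\<alpha>\<in>supp. if length \<alpha> = d then Z \<alpha> * E1 \<alpha> - Z \<alpha> * l else 0)
      + (\<Sum>\<alpha>\<in>supp. if length \<alpha> = d then Z \<alpha> * l - Z \<alpha> * E1 \<alpha> else 0) = 0"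
    unfolding sum.distrib[symmetric] by (intro sum.neutral) auto
  ultimately have zero: "(\<Sum>\<alpha>\<in>supp. if length \<alpha> = d then Z \<alpha> * E1 \<alpha> - Z \<alpha> * l else 0) = 0"
    by simp
  have Zpos: "Z \<alpha> > 0" if "\<alpha> \<in> supp" for \<alpha>
  proof -
    have "a \<alpha> > 0" using that a_nonneg[of \<alpha>] by (simp add: supp_def less_le del: a_nonneg)
    moreover have "word_eval \<zeta> \<alpha> \<noteq> 0" using \<zeta>0 by (induction \<alpha>) auto
    ultimately show ?thesis by (simp add: Z_def)
  qed
  have top: "Z \<alpha> * E1 \<alpha> - Z \<alpha> * l > 0" if "\<alpha> \<in> supp" "length \<alpha> = d" for \<alpha>
  proof -
    have "2 * l \<le> real d * l" using d2 l0 by (intro mult_right_mono) auto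
    then have "E1 \<alpha> > l" using E1[of \<alpha>] l0 unfolding that(2) by linarith
    then show ?thesis using Zpos[OF that(1)] by simp
  qed
  have "(\<Sum>\<alpha>\<in>supp. if length \<alpha> = d then Z \<alpha> * E1 \<alpha> - Z \<alpha> * l else 0) > 0"
    by (rule sum_pos2[OF finite_support \<alpha>d(1)]) (use \<alpha>d top less_imp_le in auto)
  then show False using zero by simp
qed

end

section \<open>Unitary matrices\<close>

text \<open>An isometry preserves the real inner product. The real and imaginary parts of the entries of
  \<open>M\<^sup>* M\<close> are real inner products of columns of \<open>M\<close>, one of them multiplied by \<open>\<i>\<close> for the
  imaginary part.\<close>

lemma isometry_in_unitary_group:
  fixes M :: "complex ^ 'n ^ 'n::finite"
  assumes iso: "\<And>x. norm (M *v x) = norm x"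
  shows "M \<in> carrier unitary_group"
proof -
  have inner: "(M *v x) \<bullet> (M *v y) = x \<bullet> y" for x y
    unfolding dot_norm matrix_vector_right_distrib[symmetric] iso ..
  have col: "(M *v axis k z) $ i = M $ i $ k * z" for k z i
    by (simp add: matrix_vector_mult_def axis_def if_distrib cong: if_cong)
  have "(\<Sum>i\<in>UNIV. cnj (M $ i $ k) * M $ i $ j) = (if k = j then 1 else 0)" for k j
  proof (rule complex_eqI)
    have "Re (\<Sum>i\<in>UNIV. cnj (M $ i $ k) * M $ i $ j) = (M *v axis k 1) \<bullet> (M *v axis j 1)"
      by (simp add: inner_vec_def col inner_complex_def)
    also have "\<dots> = Re (if k = j then 1 else 0)"
      unfolding inner by (simp add: inner_axis_axis)
    finally show "Re (\<Sum>i\<in>UNIV. cnj (M $ i $ k) * M $ i $ j) = Re (if k = j then 1 else 0)" .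
    have "Im (\<Sum>i\<in>UNIV. cnj (M $ i $ k) * M $ i $ j) = (M *v axis k \<i>) \<bullet> (M *v axis j 1)"
      by (simp add: inner_vec_def col inner_complex_def algebra_simps)
    also have "\<dots> = Im (if k = j then 1 else 0)"
      unfolding inner by (simp add: inner_axis_axis)
    finally show "Im (\<Sum>i\<in>UNIV. cnj (M $ i $ k) * M $ i $ j) = Im (if k = j then 1 else 0)" .
  qed
  then have "map_matrix cnj (transpose M) ** M = mat 1"
    by (simp add: vec_eq_iff matrix_matrix_mult_def transpose_def mat_def)
  then show ?thesis
    unfolding unitary_group_def using matrix_left_right_inverse by auto
qed

context regular_polynomial
begin

section \<open>Automorphisms fixing the origin\<close>

lemma nonlinear_fixes_origin:
  assumes P: "\<Phi> \<in> algebra_auto A" and nonlinear: "\<alpha> \<in> supp" "length \<alpha> \<noteq> 1"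
  shows "point_map \<Phi> (\<lambda>_. 0) = (\<lambda>_. 0)"
proof -
  obtain \<Psi> where \<Psi>: "\<Psi> \<in> algebra_auto A" "\<And>T. T \<in> A \<Longrightarrow> \<Phi> (\<Psi> T) = T" "\<And>T. T \<in> A \<Longrightarrow> \<Psi> (\<Phi> T) = T"
    using auto_inverse[OF P] by metis
  have "kernel_symmetry a (point_map \<Phi>) (point_map \<Psi>)"
  proof (intro kernel_symmetry.intro kernel_symmetry_axioms.intro)
    show "regular_polynomial a" by unfold_locales
  qed (simp_all add: point_map_in_dom P \<Psi> point_map_inverse[OF P \<Psi>(1,2)] point_map_inverse[OF \<Psi>(1) P \<Psi>(3)]
      auto_kernel_identity[OF P \<Psi> refl])
  then have "point_map \<Psi> (\<lambda>_. 0) = (\<lambda>_. 0)"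
    using kernel_symmetry.linear_if_moves_origin nonlinear by blast
  then show ?thesis using point_map_inverse[OF \<Psi>(1) P \<Psi>(3) zero_in_dom] by simp
qed

definition fixes_origin :: "('n list operator \<Rightarrow> 'n list operator) \<Rightarrow> bool" where
  "fixes_origin \<Phi> \<longleftrightarrow> \<Phi> \<in> algebra_auto A \<and> (\<forall>i. fourier (\<Phi> (W [i])) [] = 0)"

lemma fixes_origin_if_nonlinear:
  assumes "\<Phi> \<in> algebra_auto A" "\<alpha> \<in> supp" "length \<alpha> \<noteq> 1"
  shows "fixes_origin \<Phi>"
  using fun_cong[OF nonlinear_fixes_origin[OF assms]] assms(1)
  by (simp add: fixes_origin_def point_map_def character_zero)

lemma W_Nil: "W [] = id_blinfun"
  by (simp add: shift_word_def)

lemma auto_W_Cons: "\<Phi> \<in> algebra_auto A \<Longrightarrow> \<Phi> (W (i # \<alpha>)) = \<Phi> (W [i]) o\<^sub>L \<Phi> (W \<alpha>)"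
  using algebra_autoD(4)[of \<Phi> A "W [i]" "W \<alpha>"] by (simp add: word_Cons[of i \<alpha>])

text \<open>An automorphism that fixes the origin does not lower the order of vanishing. This makes its
  matrix in the Fourier coefficients block triangular with respect to the length of words, and a
  coefficient of \<open>\<Phi> T\<close> involves finitely many coefficients of \<open>T\<close>.\<close>

lemma fourier_auto_low:
  assumes P: "fixes_origin \<Phi>" and "length \<gamma> < length \<alpha>"
  shows "fourier (\<Phi> (W \<alpha>)) \<gamma> = 0"
  using assms(2)
proof (induction \<alpha> arbitrary: \<gamma>)
  case (Cons i \<alpha>)
  have PA: "\<Phi> \<in> algebra_auto A" using P by (simp add: fixes_origin_def)
  have zero: "fourier (\<Phi> (W [i])) (take k \<gamma>) * fourier (\<Phi> (W \<alpha>)) (drop k \<gamma>) = 0" if "k \<le> length \<gamma>" for k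
  proof (cases "k = 0")
    case True
    then show ?thesis using P by (simp add: fixes_origin_def)
  next
    case False
    then show ?thesis using that Cons.prems by (simp add: Cons.IH)
  qed
  then show ?case
    unfolding auto_W_Cons[OF PA, of i \<alpha>] fourier_mult[OF auto_mem[OF PA W_in_A]] by (intro sum.neutral ballI zero) simp
qed simp

lemma finite_short_words: "finite {\<alpha> :: 'n list. length \<alpha> \<le> n}"
  using finite_lists_length_le[of "UNIV :: 'n set" n] by simp

lemma fourier_auto:
  assumes P: "fixes_origin \<Phi>" and T: "T \<in> A"
  shows "fourier (\<Phi> T) \<gamma> = (\<Sum>\<alpha>\<in>{\<alpha>. length \<alpha> \<le> length \<gamma>}. fourier (\<Phi> (W \<alpha>)) \<gamma> * fourier T \<alpha>)"
proof (rule functional_eqI[where T = T, OF _ _ _ T])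
  show "functional_on A (\<lambda>T. fourier (\<Phi> T) \<gamma>)"
    using P functional_on_auto[OF _ functional_on_fourier] by (simp add: fixes_origin_def)
  show "functional_on A (\<lambda>T. \<Sum>\<alpha>\<in>{\<alpha>. length \<alpha> \<le> length \<gamma>}. fourier (\<Phi> (W \<alpha>)) \<gamma> * fourier T \<alpha>)"
    by (intro functional_on_sum functional_on_cmult functional_on_fourier)
  fix \<beta>
  have "(\<Sum>\<alpha>\<in>{\<alpha>. length \<alpha> \<le> length \<gamma>}. fourier (\<Phi> (W \<alpha>)) \<gamma> * fourier (W \<beta>) \<alpha>)
      = (\<Sum>\<alpha>\<in>{\<alpha>. length \<alpha> \<le> length \<gamma>}. if \<alpha> = \<beta> then fourier (\<Phi> (W \<beta>)) \<gamma> else 0)"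
    by (intro sum.cong refl) (simp add: fourier_word)
  also have "\<dots> = (if length \<beta> \<le> length \<gamma> then fourier (\<Phi> (W \<beta>)) \<gamma> else 0)"
    using finite_short_words by simp
  also have "\<dots> = fourier (\<Phi> (W \<beta>)) \<gamma>"
    using fourier_auto_low[OF P, of \<gamma> \<beta>] by simp
  finally show "fourier (\<Phi> (W \<beta>)) \<gamma> = (\<Sum>\<alpha>\<in>{\<alpha>. length \<alpha> \<le> length \<gamma>}. fourier (\<Phi> (W \<alpha>)) \<gamma> * fourier (W \<beta>) \<alpha>)"
    by simp
qed

lemma fourier_auto_letter:
  assumes P: "fixes_origin \<Phi>" and T: "T \<in> A"
  shows "fourier (\<Phi> T) [i] = (\<Sum>k\<in>UNIV. fourier (\<Phi> (W [k])) [i] * fourier T [k])"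
proof -
  have PA: "\<Phi> \<in> algebra_auto A" using P by (simp add: fixes_origin_def)
  let ?g = "\<lambda>\<alpha>. if length \<alpha> = 1 then fourier (\<Phi> (W \<alpha>)) [i] * fourier T \<alpha> else 0"
  have "fourier (\<Phi> T) [i] = (\<Sum>\<alpha>\<in>{\<alpha>. length \<alpha> \<le> 1}. ?g \<alpha>)"
    unfolding fourier_auto[OF P T]
  proof (rule sum.cong)
    fix \<alpha> :: "'n list" assume "\<alpha> \<in> {\<alpha>. length \<alpha> \<le> 1}"
    moreover have "fourier (\<Phi> (W [])) [i] = 0"
      by (simp add: W_Nil algebra_autoD(5)[OF PA] fourier_id)
    ultimately show "fourier (\<Phi> (W \<alpha>)) [i] * fourier T \<alpha> = ?g \<alpha>" by (cases \<alpha>) auto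
  qed simp
  also have "\<dots> = (\<Sum>k\<in>UNIV. ?g [k])"
    by (rule sum_length_1[OF finite_short_words]) auto
  finally show ?thesis by simp
qed

section \<open>The linear part\<close>

text \<open>The matrix of \<open>\<Phi>\<close> on degree one with respect to the normalised generators \<open>\<surd>a\<^sub>j W\<^sub>j\<close>, which map the
  vacuum vector to the unit vectors \<open>\<delta>\<^sub>j\<close>.\<close>

definition linear_part :: "('n list operator \<Rightarrow> 'n list operator) \<Rightarrow> complex ^ 'n ^ 'n" where
  "linear_part \<Phi> = (\<chi> i j. of_real (sqrt (a [j]) / sqrt (a [i])) * fourier (\<Phi> (W [j])) [i])"

lemma linear_part_mult:
  assumes P: "fixes_origin \<Phi>" and Q: "\<Psi> \<in> algebra_auto A"
    and X: "\<And>T. T \<in> A \<Longrightarrow> X T = \<Phi> (\<Psi> T)"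
  shows "linear_part X = linear_part \<Phi> ** linear_part \<Psi>"
proof -
  have eq: "of_real (sqrt (a [j]) / sqrt (a [i])) * (u * w)
      = of_real (sqrt (a [k]) / sqrt (a [i])) * u * (of_real (sqrt (a [j]) / sqrt (a [k])) * w)" for i j k and u w :: complex
    using a_letter[of k] by (simp add: field_simps del: a_letter)
  have "linear_part X $ i $ j = (linear_part \<Phi> ** linear_part \<Psi>) $ i $ j" for i j
  proof -
    have "linear_part X $ i $ j = (\<Sum>k\<in>UNIV. of_real (sqrt (a [j]) / sqrt (a [i])) *
        (fourier (\<Phi> (W [k])) [i] * fourier (\<Psi> (W [j])) [k]))"
      by (simp add: linear_part_def X fourier_auto_letter[OF P auto_mem[OF Q W_in_A]] sum_distrib_left)
    also have "\<dots> = (linear_part \<Phi> ** linear_part \<Psi>) $ i $ j"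
      unfolding matrix_matrix_mult_def linear_part_def vec_lambda_beta by (intro sum.cong refl eq)
    finally show ?thesis .
  qed
  then show ?thesis by (simp add: vec_eq_iff)
qed

lemma fourier_combination:
  "fourier (\<Sum>j\<in>J. cscale_op (c j) (S j)) \<gamma> = (\<Sum>j\<in>J. c j * fourier (S j) \<gamma>)"
  by (simp add: fourier_def blinfun.sum_left coord_sum cscale.rep_eq sum_distrib_left mult.left_commute)

lemma combination_in_A: "finite J \<Longrightarrow> (\<And>j. j \<in> J \<Longrightarrow> S j \<in> A) \<Longrightarrow> (\<Sum>j\<in>J. cscale_op (c j) (S j)) \<in> A"
proof (induction J rule: finite_induct)
  case empty
  have "cscale_op 0 (W []) \<in> A" by (rule cscale_in_A) simp
  then show ?case by simp
qed (simp add: add_in_A cscale_in_A)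

lemma norm_linear_combination_le:
  "norm (\<Sum>j\<in>UNIV. cscale_op (x $ j * of_real (sqrt (a [j]))) (W [j])) \<le> norm (x :: complex ^ 'n)"
proof (rule norm_blinfun_bound)
  fix u :: "'n list ell2"
  let ?T = "\<Sum>j\<in>UNIV. cscale_op (x $ j * of_real (sqrt (a [j]))) (W [j])"
  define X where "X \<alpha> = (if length \<alpha> = 1 then cscale (x $ hd \<alpha>) u else 0)" for \<alpha>
  have "(\<Sum>\<alpha>\<in>supp. sqrt (a \<alpha>) *\<^sub>R blinfun_apply (W \<alpha>) (X \<alpha>)) = (\<Sum>j\<in>UNIV. sqrt (a [j]) *\<^sub>R blinfun_apply (W [j]) (X [j]))"
    by (rule sum_length_1[OF finite_support]) (auto simp: X_def supp_def)
  also have "\<dots> = blinfun_apply ?T u"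
    unfolding blinfun.sum_left
    by (intro sum.cong refl ell2_eqI) (simp add: X_def A_cscale scaleR_ell2.rep_eq cscale.rep_eq)
  finally have "(norm (blinfun_apply ?T u))\<^sup>2 \<le> (\<Sum>\<alpha>\<in>supp. (norm (X \<alpha>))\<^sup>2)"
    using row_contraction[of X] by simp
  also have "\<dots> = (\<Sum>\<alpha>\<in>supp. if length \<alpha> = 1 then (norm (X \<alpha>))\<^sup>2 else 0)"
    by (intro sum.cong refl) (simp add: X_def)
  also have "\<dots> = (\<Sum>j\<in>UNIV. (norm (X [j]))\<^sup>2)"
    by (subst sum_length_1[OF finite_support]) (auto simp: length_Suc_conv)
  also have "\<dots> = (norm x * norm u)\<^sup>2"
    by (simp add: X_def norm_cscale power_mult_distrib norm_vec_def L2_set_def sum_nonneg sum_distrib_right)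
  finally show "norm (blinfun_apply ?T u) \<le> norm x * norm u"
    by (rule power2_le_imp_le) simp
qed simp

text \<open>The vector \<open>linear_part \<Phi> *v x\<close> consists of the coordinates at the letters of the image of the vacuum
  vector under \<open>\<Phi> (\<Sum> x\<^sub>j \<surd>a\<^sub>j W\<^sub>j)\<close>, an operator of norm at most \<open>norm x\<close>.\<close>

lemma linear_part_contraction:
  assumes P: "fixes_origin \<Phi>"
  shows "norm (linear_part \<Phi> *v x) \<le> norm x"
proof -
  have PA: "\<Phi> \<in> algebra_auto A" using P by (simp add: fixes_origin_def)
  define T where "T = (\<Sum>j\<in>UNIV. cscale_op (x $ j * of_real (sqrt (a [j]))) (W [j]))"
  have T: "T \<in> A" unfolding T_def by (rule combination_in_A) auto
  have fT: "fourier T [k] = x $ k * of_real (sqrt (a [k]))" for k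
  proof -
    have "fourier T [k] = (\<Sum>j\<in>UNIV. if j = k then x $ k * of_real (sqrt (a [k])) else 0)"
      unfolding T_def fourier_combination by (intro sum.cong refl) (auto simp: fourier_word)
    then show ?thesis by simp
  qed
  let ?u = "blinfun_apply (\<Phi> T) (delta [])"
  have bi: "b [i] = a [i]" for i
    using weight_split[of "[i]" a] by simp
  have entry: "(linear_part \<Phi> *v x) $ i = coord ?u [i]" for i
  proof -
    have "(linear_part \<Phi> *v x) $ i = fourier (\<Phi> T) [i] / of_real (sqrt (a [i]))"
      unfolding fourier_auto_letter[OF P T] fT sum_divide_distrib
      by (simp add: linear_part_def matrix_vector_mult_def mult_ac)
    also have "\<dots> = coord ?u [i]"
      using a_letter[of i] by (simp add: fourier_def bi del: a_letter)
    finally show ?thesis .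
  qed
  have "(norm (linear_part \<Phi> *v x))\<^sup>2 = (\<Sum>i\<in>UNIV. (cmod (coord ?u [i]))\<^sup>2)"
    by (simp add: norm_vec_def L2_set_def sum_nonneg entry)
  also have "\<dots> = (\<Sum>\<alpha>\<in>range (\<lambda>i. [i]). (cmod (coord ?u \<alpha>))\<^sup>2)"
    by (subst sum.reindex) (auto simp: inj_def)
  also have "\<dots> \<le> (norm ?u)\<^sup>2" by (rule square_sum_coord_le) simp
  finally have "norm (linear_part \<Phi> *v x) \<le> norm ?u" by (rule power2_le_imp_le) simp
  also have "\<dots> \<le> norm (\<Phi> T)" using norm_blinfun[of "\<Phi> T" "delta []"] by simp
  also have "\<dots> = norm T" by (rule completely_isometric_norm[OF algebra_autoD(6)[OF PA] T])
  also have "\<dots> \<le> norm x" unfolding T_def by (rule norm_linear_combination_le)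
  finally show ?thesis .
qed

lemma linear_part_id:
  assumes "\<And>T. T \<in> A \<Longrightarrow> X T = T" shows "linear_part X = mat 1"
proof -
  have nz: "a [i] \<noteq> 0" for i using a_letter[of i] by linarith
  show ?thesis
    by (auto simp: linear_part_def vec_eq_iff mat_def assms fourier_word nz)
qed

lemma linear_part_unitary:
  assumes P: "fixes_origin \<Phi>" and Q: "fixes_origin \<Psi>" and inv: "\<And>T. T \<in> A \<Longrightarrow> \<Psi> (\<Phi> T) = T"
  shows "linear_part \<Phi> \<in> carrier unitary_group"
proof (rule isometry_in_unitary_group, rule antisym)
  fix x
  show "norm (linear_part \<Phi> *v x) \<le> norm x" by (rule linear_part_contraction[OF P])
  have "linear_part \<Psi> ** linear_part \<Phi> = mat 1"
    using linear_part_mult[OF Q, of \<Phi> "\<lambda>T. T"] P inv linear_part_id[of "\<lambda>T. T"]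
    by (simp add: fixes_origin_def)
  then have "x = linear_part \<Psi> *v (linear_part \<Phi> *v x)"
    by (simp add: matrix_vector_mul_assoc)
  then show "norm x \<le> norm (linear_part \<Phi> *v x)"
    using linear_part_contraction[OF Q, of "linear_part \<Phi> *v x"] by simp
qed

section \<open>Uniqueness\<close>

lemma fourier_auto_diagonal:
  assumes P: "fixes_origin \<Phi>" and M: "linear_part \<Phi> = mat 1" and "length \<gamma> = length \<alpha>"
  shows "fourier (\<Phi> (W \<alpha>)) \<gamma> = (if \<gamma> = \<alpha> then 1 else 0)"
  using assms(3)
proof (induction \<alpha> arbitrary: \<gamma>)
  case Nil
  then show ?case
    using P algebra_autoD(5)[of \<Phi> A] by (simp add: fixes_origin_def W_Nil fourier_id)
next
  case (Cons i \<alpha>)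
  have PA: "\<Phi> \<in> algebra_auto A" using P by (simp add: fixes_origin_def)
  have letter: "fourier (\<Phi> (W [i])) [l] = (if l = i then 1 else 0)" for l
  proof -
    have "linear_part \<Phi> $ l $ i = (if l = i then 1 else 0)" using M by (simp add: mat_def)
    then show ?thesis
      using a_letter[of l] a_letter[of i] by (auto simp: linear_part_def simp del: a_letter split: if_splits)
  qed
  obtain l \<delta> where \<gamma>: "\<gamma> = l # \<delta>" "length \<delta> = length \<alpha>" using Cons.prems by (cases \<gamma>) auto
  have "fourier (\<Phi> (W (i # \<alpha>))) \<gamma> = (\<Sum>k\<le>length \<gamma>. fourier (\<Phi> (W [i])) (take k \<gamma>) * fourier (\<Phi> (W \<alpha>)) (drop k \<gamma>))"
    unfolding auto_W_Cons[OF PA, of i \<alpha>] by (rule fourier_mult[OF auto_mem[OF PA W_in_A]])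
  also have "\<dots> = (\<Sum>k\<in>{1}. fourier (\<Phi> (W [i])) (take k \<gamma>) * fourier (\<Phi> (W \<alpha>)) (drop k \<gamma>))"
  proof (rule sum.mono_neutral_right)
    show "\<forall>k\<in>{..length \<gamma>} - {1}. fourier (\<Phi> (W [i])) (take k \<gamma>) * fourier (\<Phi> (W \<alpha>)) (drop k \<gamma>) = 0"
    proof
      fix k assume k: "k \<in> {..length \<gamma>} - {1}"
      show "fourier (\<Phi> (W [i])) (take k \<gamma>) * fourier (\<Phi> (W \<alpha>)) (drop k \<gamma>) = 0"
      proof (cases "k = 0")
        case True
        then show ?thesis using P by (simp add: fixes_origin_def)
      next
        case False
        then have "length (drop k \<gamma>) < length \<alpha>" using k \<gamma> by auto
        then show ?thesis by (simp only: fourier_auto_low[OF P] mult_zero_right)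
      qed
    qed
  qed (use \<gamma> in auto)
  also have "\<dots> = (if \<gamma> = i # \<alpha> then 1 else 0)"
    using \<gamma> by (simp add: letter Cons.IH)
  finally show ?case .
qed

lemma auto_power:
  fixes T :: "'n list operator"
  assumes P: "\<Phi> \<in> algebra_auto A" and T: "T \<in> A"
  shows "(\<Phi> ^^ m) T \<in> A \<and> norm ((\<Phi> ^^ m) T) = norm T"
  by (induction m) (use T auto_mem[OF P] completely_isometric_norm[OF algebra_autoD(6)[OF P]] in auto)

text \<open>Induction on the length \<open>n\<close> of \<open>\<gamma>\<close>. If \<open>\<Phi> W\<^sub>j\<close> and \<open>W\<^sub>j\<close> agree in all coefficients of length less
  than \<open>n \<ge> 2\<close>, then so do all iterates, and each further application of \<open>\<Phi>\<close> adds the same number to the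
  coefficient at \<open>\<gamma>\<close>. Since \<open>\<Phi>\<close> is isometric the coefficients of the iterates are bounded, so that
  this number is \<open>0\<close>.\<close>

lemma fourier_auto_generator:
  assumes P: "fixes_origin \<Phi>" and M: "linear_part \<Phi> = mat 1"
  shows "fourier (\<Phi> (W [j])) \<gamma> = fourier (W [j]) \<gamma>"
proof (induction "length \<gamma>" arbitrary: \<gamma> rule: less_induct)
  case less
  have PA: "\<Phi> \<in> algebra_auto A" using P by (simp add: fixes_origin_def)
  consider "length \<gamma> = 0" | "length \<gamma> = 1" | "length \<gamma> \<ge> 2" by linarith
  then show ?case
  proof cases
    case 1
    then show ?thesis using P by (simp add: fixes_origin_def fourier_word)
  next
    case 2
    then show ?thesis using fourier_auto_diagonal[OF P M, of \<gamma> "[j]"] by (simp add: fourier_word)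
  next
    case 3
    let ?t = "\<lambda>m. fourier ((\<Phi> ^^ m) (W [j]))"
    have mem: "(\<Phi> ^^ m) (W [j]) \<in> A" for m using auto_power[OF PA W_in_A] by blast
    have step: "?t (Suc m) \<beta> = (\<Sum>\<alpha>\<in>{\<alpha>. length \<alpha> \<le> length \<beta>}. fourier (\<Phi> (W \<alpha>)) \<beta> * ?t m \<alpha>)" for m and \<beta> :: "'n list"
      using fourier_auto[OF P mem] by simp
    have low: "?t m \<beta> = (if \<beta> = [j] then 1 else 0)" if "length \<beta> < length \<gamma>" for m and \<beta> :: "'n list"
      using that
    proof (induction m arbitrary: \<beta>)
      case 0
      then show ?case by (simp add: fourier_word)
    next
      case (Suc m)
      have "?t (Suc m) \<beta> = (\<Sum>\<alpha>\<in>{\<alpha>. length \<alpha> \<le> length \<beta>}. if \<alpha> = [j] then fourier (\<Phi> (W [j])) \<beta> else 0)"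
        unfolding step by (intro sum.cong refl) (use Suc in auto)
      also have "\<dots> = (if 1 \<le> length \<beta> then fourier (\<Phi> (W [j])) \<beta> else 0)"
        using finite_short_words by simp
      also have "\<dots> = (if \<beta> = [j] then 1 else 0)"
        using less[OF Suc.prems] by (auto simp: fourier_word)
      finally show ?case .
    qed
    have grow: "?t m \<gamma> = of_nat m * fourier (\<Phi> (W [j])) \<gamma>" for m
    proof (induction m)
      case 0
      then show ?case using 3 by (auto simp: fourier_word)
    next
      case (Suc m)
      have "?t (Suc m) \<gamma> = (\<Sum>\<alpha>\<in>{\<alpha>. length \<alpha> \<le> length \<gamma>}.
          (if \<alpha> = [j] then fourier (\<Phi> (W [j])) \<gamma> else 0) + (if \<alpha> = \<gamma> then ?t m \<gamma> else 0))"
        unfolding step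
      proof (intro sum.cong refl)
        fix \<alpha> :: "'n list" assume \<alpha>: "\<alpha> \<in> {\<alpha>. length \<alpha> \<le> length \<gamma>}"
        show "fourier (\<Phi> (W \<alpha>)) \<gamma> * ?t m \<alpha>
            = (if \<alpha> = [j] then fourier (\<Phi> (W [j])) \<gamma> else 0) + (if \<alpha> = \<gamma> then ?t m \<gamma> else 0)"
        proof (cases "length \<alpha> = length \<gamma>")
          case True
          then show ?thesis using fourier_auto_diagonal[OF P M, of \<gamma> \<alpha>] 3 by auto
        next
          case False
          then have "length \<alpha> < length \<gamma>" using \<alpha> by simp
          then show ?thesis using low[of \<alpha> m] by auto
        qed
      qed
      also have "\<dots> = fourier (\<Phi> (W [j])) \<gamma> + ?t m \<gamma>"
        using finite_short_words 3 by (simp add: sum.distrib)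
      finally show ?case using Suc by (simp add: algebra_simps)
    qed
    have bound: "real m * cmod (fourier (\<Phi> (W [j])) \<gamma>) \<le> sqrt (b \<gamma>) * norm (W [j])" for m
      using norm_fourier_le[of "(\<Phi> ^^ m) (W [j])" \<gamma>] auto_power[OF PA W_in_A, of m "[j]"]
      by (simp add: grow norm_mult)
    have "cmod (fourier (\<Phi> (W [j])) \<gamma>) = 0"
    proof (rule ccontr)
      assume "cmod (fourier (\<Phi> (W [j])) \<gamma>) \<noteq> 0"
      then have "cmod (fourier (\<Phi> (W [j])) \<gamma>) > 0" by simp
      then obtain m where "sqrt (b \<gamma>) * norm (W [j]) < real m * cmod (fourier (\<Phi> (W [j])) \<gamma>)"
        using reals_Archimedean3 by blast
      then show False using bound[of m] by linarith
    qed
    then show ?thesis using 3 by (auto simp: fourier_word)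
  qed
qed

lemma auto_eq_id_if_linear_part_id:
  assumes P: "fixes_origin \<Phi>" and M: "linear_part \<Phi> = mat 1" and T: "T \<in> A"
  shows "\<Phi> T = T"
proof -
  have PA: "\<Phi> \<in> algebra_auto A" using P by (simp add: fixes_origin_def)
  have letter: "\<Phi> (W [j]) = W [j]" for j
    by (rule fourier_inject[OF auto_mem[OF PA W_in_A] W_in_A fourier_auto_generator[OF P M]])
  have word: "\<Phi> (W \<alpha>) = W \<alpha>" for \<alpha>
  proof (induction \<alpha>)
    case Nil
    then show ?case by (simp add: W_Nil algebra_autoD(5)[OF PA])
  next
    case (Cons i \<alpha>)
    have "\<Phi> (W (i # \<alpha>)) = W [i] o\<^sub>L W \<alpha>"
      unfolding auto_W_Cons[OF PA, of i \<alpha>] letter Cons ..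
    then show ?case by (simp only: word_Cons[of i \<alpha>])
  qed
  show ?thesis
  proof (rule fourier_inject[OF auto_mem[OF PA T] T])
    show "fourier (\<Phi> T) \<gamma> = fourier T \<gamma>" for \<gamma>
      by (rule functional_eqI[OF functional_on_auto[OF PA functional_on_fourier] functional_on_fourier _ T])
        (simp add: word)
  qed
qed

theorem auto_group_embeds:
  assumes fixed: "\<And>\<Phi>. \<Phi> \<in> algebra_auto A \<Longrightarrow> fixes_origin \<Phi>"
  shows "\<exists>H. subgroup H (unitary_group :: (complex ^ 'n ^ 'n) monoid) \<and>
     algebra_auto_group A \<cong> (unitary_group :: (complex ^ 'n ^ 'n) monoid)\<lparr>carrier := H\<rparr>"
proof -
  let ?G = "algebra_auto_group A" and ?U = "unitary_group :: (complex ^ 'n ^ 'n) monoid"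
  have carrier: "carrier ?G = algebra_auto A" by (simp add: algebra_auto_group_def)
  interpret G: group ?G by (rule group_domain_algebra_auto_group[OF regular])
  have hom: "linear_part \<in> hom ?G ?U"
  proof (rule homI)
    fix \<Phi> assume P: "\<Phi> \<in> carrier ?G"
    then obtain \<Psi> where "\<Psi> \<in> algebra_auto A" "\<And>T. T \<in> A \<Longrightarrow> \<Psi> (\<Phi> T) = T"
      using auto_inverse carrier by metis
    then show "linear_part \<Phi> \<in> carrier ?U"
      using P carrier by (intro linear_part_unitary) (auto intro: fixed)
  next
    fix \<Phi> \<Psi> assume "\<Phi> \<in> carrier ?G" "\<Psi> \<in> carrier ?G"
    then have PQ: "\<Phi> \<in> algebra_auto A" "\<Psi> \<in> algebra_auto A" using carrier by auto
    have "linear_part (\<Phi> \<otimes>\<^bsub>?G\<^esub> \<Psi>) = linear_part \<Phi> ** linear_part \<Psi>"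
      by (rule linear_part_mult[OF fixed[OF PQ(1)] PQ(2)]) (rule auto_group_mult[OF PQ])
    then show "linear_part (\<Phi> \<otimes>\<^bsub>?G\<^esub> \<Psi>) = linear_part \<Phi> \<otimes>\<^bsub>?U\<^esub> linear_part \<Psi>"
      by (simp add: unitary_group_def)
  qed
  interpret h: group_hom ?G ?U linear_part
    by (intro group_hom.intro group_hom_axioms.intro G.is_group group_unitary_group hom)
  have "inj_on linear_part (carrier ?G)"
  proof (subst h.inj_on_one_iff, intro allI impI)
    fix \<Phi> assume P: "\<Phi> \<in> carrier ?G" and "linear_part \<Phi> = \<one>\<^bsub>?U\<^esub>"
    then have "\<Phi> T = T" if "T \<in> A" for T
      using auto_eq_id_if_linear_part_id[OF fixed _ that] carrier by (simp add: unitary_group_def)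
    then show "\<Phi> = \<one>\<^bsub>?G\<^esub>"
      using Bij_imp_extensional[OF algebra_autoD(1), of \<Phi> A] P carrier
      by (intro extensionalityI[of _ A]) (auto simp: algebra_auto_group_def BijGroup_def)
  qed
  then have "linear_part \<in> iso ?G (?U\<lparr>carrier := linear_part ` carrier ?G\<rparr>)"
    using hom by (auto simp: iso_def hom_def bij_betw_def)
  then show ?thesis
    using h.img_is_subgroup by (intro exI[of _ "linear_part ` carrier ?G"]) (auto simp: is_iso_def)
qed

end

section \<open>Linear series are spherical\<close>

text \<open>Rescaling the generators turns \<open>\<Sum> a\<^sub>i X\<^sub>i\<close> into \<open>\<Sum> X\<^sub>i\<close>, whose scalar domain is the closed unit
  ball.\<close>

lemma linear_imp_spherical:
  fixes a :: "'n::finite list \<Rightarrow> real"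
  assumes a: "regular_positive a" and linear: "\<And>\<alpha>. a \<alpha> \<noteq> 0 \<Longrightarrow> length \<alpha> = 1"
  shows "spherical a"
proof -
  define g :: "'n list \<Rightarrow> real" where "g \<alpha> = (if length \<alpha> = 1 then 1 else 0)" for \<alpha>
  have "bdd_above ((\<lambda>k. root k \<bar>\<Sum>\<alpha> | length \<alpha> = k. (g \<alpha>)\<^sup>2\<bar>) ` {1..})"
  proof (rule bdd_aboveI2)
    fix k :: nat assume k: "k \<in> {1..}"
    show "root k \<bar>\<Sum>\<alpha> | length \<alpha> = k. (g \<alpha>)\<^sup>2\<bar> \<le> root 1 \<bar>\<Sum>\<alpha> | length \<alpha> = 1. (g \<alpha>)\<^sup>2\<bar>"
    proof (cases "k = 1")
      case False
      have "(\<Sum>\<alpha> | length \<alpha> = k. (g \<alpha>)\<^sup>2) = 0" by (intro sum.neutral) (use False in \<open>auto simp: g_def\<close>)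
      then show ?thesis by simp
    qed simp
  qed
  then have g: "regular_positive g" by (auto simp: regular_positive_def g_def)
  have "permute_rescale id (\<lambda>i. a [i]) g = a"
  proof
    fix \<alpha>
    have "permute_rescale id (\<lambda>i. a [i]) g (map id \<alpha>) = g \<alpha> * (\<Prod>i\<leftarrow>\<alpha>. a [i])"
      by (rule permute_rescale_map) simp
    moreover have "g \<alpha> * (\<Prod>i\<leftarrow>\<alpha>. a [i]) = a \<alpha>"
    proof (cases "length \<alpha> = 1")
      case True
      then show ?thesis by (cases \<alpha>) (auto simp: g_def)
    next
      case False
      then show ?thesis using linear[of \<alpha>] by (auto simp: g_def)
    qed
    ultimately show "permute_rescale id (\<lambda>i. a [i]) g \<alpha> = a \<alpha>" by simp
  qed
  then have equiv: "permutation_rescaling_equivalent a g"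
    using a unfolding permutation_rescaling_equivalent_def regular_positive_def
    by (intro exI[of _ id] exI[of _ "\<lambda>i. a [i]"]) auto
  have normsq: "(norm z)\<^sup>2 = (\<Sum>i\<in>UNIV. (cmod (z $ i))\<^sup>2)" for z :: "complex ^ 'n"
    by (simp add: norm_vec_def L2_set_def sum_nonneg)
  have domain_sum: "((\<lambda>\<alpha>. g \<alpha> * (cmod (\<Prod>i\<leftarrow>\<alpha>. z $ i))\<^sup>2) has_sum (\<Sum>i\<in>UNIV. (cmod (z $ i))\<^sup>2)) UNIV" for z :: "complex ^ 'n"
  proof -
    have "((\<lambda>\<alpha>. g \<alpha> * (cmod (\<Prod>i\<leftarrow>\<alpha>. z $ i))\<^sup>2) has_sum (\<Sum>i\<in>UNIV. (cmod (z $ i))\<^sup>2)) (range (\<lambda>i. [i]))"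
      by (rule has_sum_finiteI) (auto simp: sum.reindex inj_def g_def)
    moreover have "\<alpha> \<in> range (\<lambda>i. [i])" if "length \<alpha> = 1" for \<alpha> :: "'n list"
      using that by (cases \<alpha>) auto
    ultimately show ?thesis
      by (subst has_sum_cong_neutral[where T = "range (\<lambda>i. [i])"]) (auto simp: g_def)
  qed
  have "scalar_domain g = {z. (norm z)\<^sup>2 \<le> 1}"
    unfolding scalar_domain_def normsq by (simp add: infsumI[OF domain_sum] has_sum_imp_summable[OF domain_sum])
  also have "\<dots> = cball 0 1" by (auto simp: abs_square_le_1)
  finally have "interior (scalar_domain g) = ball 0 1" by simp
  also have "\<dots> = {z. (norm z)\<^sup>2 < 1}" by (auto simp: abs_square_less_1)
  finally have "interior (scalar_domain g) = {z. (\<Sum>i\<in>UNIV. (cmod (z $ i))\<^sup>2) < 1}"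
    unfolding normsq .
  with g equiv show ?thesis unfolding spherical_def by blast
qed

theorem corollary2p17:
  fixes f :: "'n::finite list \<Rightarrow> real"
  assumes "regular_positive f"
    and "free_polynomial f"
    and "aspherical f"
  shows "\<exists>H. subgroup H (unitary_group :: (complex ^ 'n ^ 'n) monoid) \<and>
           algebra_auto_group (domain_algebra f) \<cong> (unitary_group :: (complex ^ 'n ^ 'n) monoid)\<lparr>carrier := H\<rparr>"
proof -
  interpret regular_polynomial f by unfold_locales (fact assms)+
  obtain \<alpha> where "f \<alpha> \<noteq> 0" "length \<alpha> \<noteq> 1"
    using assms(3) linear_imp_spherical[OF assms(1)] unfolding aspherical_def by blast
  then have "fixes_origin \<Phi>" if "\<Phi> \<in> algebra_auto A" for \<Phi>
    using fixes_origin_if_nonlinear[OF that, of \<alpha>] by (simp add: supp_def)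
  then show ?thesis by (rule auto_group_embeds)
qed

end
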